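(* Let $G$ be a finite abelian group of order $v$, and let $D\subseteq G$ be a $(v,k,\lambda)$ difference set in $G$ with order $n=k-\lambda$, such that, as $\chi$ ranges over the nonprincipal characters of $G$, $\chi(D)$ takes exactly three distinct values $\sqrt{n}$, $a$ and $\bar{a}$. Let $M=\{\chi_0\}\cup\{\chi\in\widehat{G}\mid \chi(D)=\sqrt{n}\}$. If (1) $D$ is a Hadamard difference set (i.e. $(v,k,\lambda)=(4n,2n\pm\sqrt{n},n\pm\sqrt{n})$) with $a+\bar{a}=0$, or (2) $G$ is a $p$-group for some prime $p$, or (3) $M$ is a subgroup of $\widehat{G}$, then $(v,k,\lambda)=(2^{2m},2^{2m-1}+2^{m-1},2^{2m-2}+2^{m-1})$ for some nonnegative integer $m$; in particular $G$ is a $2$-group. Moreover, the group ring element $H=D+D^{(-1)}-G\in\mathbb{Z}[G]$ is (the group ring element of) a subgroup of $G$, and $H^{\perp}=M$.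
   Context: A $k$-subset $D$ of a finite group $G$ of order $v$ is a $(v,k,\lambda)$ difference set if every nonidentity element of $G$ can be written as $d_1d_2^{-1}$ with $d_1,d_2\in D$ in exactly $\lambda$ ways; its order is $n=k-\lambda$, and $\sqrt{n}$ denotes the positive square root. A subset $A\subseteq G$ is identified with the group ring element $\sum_{g\in A}g\in\mathbb{Z}[G]$, and $A^{(-1)}=\{g^{-1}:g\in A\}$. $\widehat{G}$ is the character group of $G$, $\chi_0$ the principal character, and $\chi(D)=\sum_{g\in D}\chi(g)$. For a subgroup $H\le G$, $H^{\perp}=\{\chi\in\widehat{G}:\chi(h)=1\ \forall h\in H\}$.
   Formalization: The formal theorem adds the hypothesis λ ≥ 1; without it the claim is false, e.g. a one-element set {g}, g ≠ 1, in Z_3 × Z_3 is a (9,1,0) difference set satisfying (2) and (3), and the conclusion never holds when λ = 0. *)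

theory Defs
  imports
    Complex_Main
    "HOL-Library.Indicator_Function"
    "HOL-Computational_Algebra.Primes"
    "HOL-Algebra.Coset"
begin

definition finite_p_group :: "nat \<Rightarrow> ('a, 'b) monoid_scheme \<Rightarrow> bool" where
  "finite_p_group p G \<longleftrightarrow>
     prime p \<and> group G \<and> finite (carrier G) \<and> (\<exists>e. card (carrier G) = p ^ e)"

text \<open>Trivial parameters are not excluded: singletons (\<open>k = 1\<close>, \<open>l = 0\<close>) and the complements
  of singletons are difference sets.\<close>

definition difference_set ::
  "('a, 'b) monoid_scheme \<Rightarrow> 'a set \<Rightarrow> nat \<Rightarrow> nat \<Rightarrow> nat \<Rightarrow> bool" where
  "difference_set G D v k l \<longleftrightarrow>
     group G \<and> finite (carrier G) \<and> card (carrier G) = v \<and>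
     D \<subseteq> carrier G \<and> card D = k \<and>
     (\<forall>g \<in> carrier G - {\<one>\<^bsub>G\<^esub>}.
        card {(d1, d2). d1 \<in> D \<and> d2 \<in> D \<and> d1 \<otimes>\<^bsub>G\<^esub> inv\<^bsub>G\<^esub> d2 = g} = l)"

text \<open>The sign is the same in \<open>k\<close> and in \<open>l\<close>.\<close>

definition hadamard_difference_set ::
  "('a, 'b) monoid_scheme \<Rightarrow> 'a set \<Rightarrow> nat \<Rightarrow> nat \<Rightarrow> nat \<Rightarrow> bool" where
  "hadamard_difference_set G D v k l \<longleftrightarrow>
     difference_set G D v k l \<and>
     (let n = real k - real l in
        real v = 4 * n \<and>
        (real k = 2 * n + sqrt n \<and> real l = n + sqrt n \<or>
         real k = 2 * n - sqrt n \<and> real l = n - sqrt n))"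

definition complex_units :: "complex monoid" where
  "complex_units = \<lparr>carrier = UNIV - {0}, mult = (*), one = 1\<rparr>"

text \<open>Characters are normalised to be \<open>undefined\<close> outside the carrier, so that equality of
  functions is equality of characters.\<close>

definition char_group :: "('a, 'b) monoid_scheme \<Rightarrow> ('a \<Rightarrow> complex) monoid" where
  "char_group G =
     \<lparr>carrier = hom G complex_units \<inter> extensional (carrier G),
      mult = (\<lambda>X Y. \<lambda>g\<in>carrier G. X g * Y g),
      one = (\<lambda>g\<in>carrier G. 1)\<rparr>"

definition char_sum :: "('a \<Rightarrow> complex) \<Rightarrow> 'a set \<Rightarrow> complex" where
  "char_sum X A = (\<Sum>g\<in>A. X g)"

definition char_perp :: "('a, 'b) monoid_scheme \<Rightarrow> 'a set \<Rightarrow> ('a \<Rightarrow> complex) set" where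
  "char_perp G N = {X \<in> carrier (char_group G). \<forall>h\<in>N. X h = 1}"

text \<open>Elements of the integral group ring are represented by their coefficient functions
  (zero outside the carrier), with pointwise addition; a subset is identified with its
  indicator function.\<close>

definition ring_elem :: "'a set \<Rightarrow> 'a \<Rightarrow> int" where
  "ring_elem A = indicator A"

end

theory Submission
  imports Defs "HOL-Algebra.Sylow" "HOL-Algebra.Multiplicative_Group" "Jordan_Normal_Form.Char_Poly"
begin

text \<open>Write \<open>s = \<surd>n\<close>, \<open>t = a + cnj a\<close> and \<open>F = D + D\<^sup>(\<^sup>-\<^sup>1\<^sup>)\<close>.  The transform of \<open>F\<close> takes only
  the values \<open>2k\<close>, \<open>2s\<close> (on \<open>M\<close>) and \<open>t\<close>, while the coefficients of \<open>F\<close> are \<open>0\<close>, \<open>1\<close> or \<open>2\<close>.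
  Each of the three hypotheses forces \<open>v = 4s\<^sup>2\<close>, \<open>k = 2s\<^sup>2 + s\<close> and \<open>t = 0\<close>.  Then \<open>B = F - G\<close>
  satisfies \<open>B * B = 2sB\<close>, so comparing coefficient sums shows that \<open>B\<close> is the indicator of a
  subgroup \<open>H\<close> of order \<open>2s\<close> with annihilator \<open>M\<close>.  Finally \<open>E = D - D\<^sup>(\<^sup>-\<^sup>1\<^sup>)\<close> satisfies
  \<open>E * E = -4s\<^sup>2 + 2sH\<close>; projected to the part of \<open>G\<close> of odd order this is impossible unless
  \<open>H\<close> is a 2-group.

  If \<open>M\<close> is a subgroup, the three equations are read off from the coefficients of \<open>F\<close>.  For
  Hadamard parameters with \<open>k = 2s\<^sup>2 - s\<close>, \<open>C = G + 1 - F\<close> is a product-free set of size 5 in a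
  group of order 16 (the connection set of a Clebsch graph) that contains all involutions, which
  is contradictory.  For \<open>p\<close>-groups, Parseval's identity makes \<open>s\<close> and \<open>t\<close> rational,
  divisibility by powers of \<open>p\<close> yields \<open>v = 4s\<^sup>2\<close>, and total ramification of 2 in \<open>\<int>[\<zeta>]\<close>
  makes \<open>a / s\<close> a unit of \<open>\<int>[\<zeta>]\<close>, so that \<open>t / s\<close> is an integer divisible by \<open>1 - \<zeta>\<close> of
  absolute value less than 2, hence 0.\<close>

section \<open>Characters of finite abelian groups\<close>

text \<open>The three equations amount to saying that the transform of \<open>F - G\<close> is
  \<open>2s\<close> on \<open>M\<close> and zero elsewhere, since \<open>2k - v = 2s\<close>; so the
  three hypotheses meet in \<open>hadamard_plus\<close>. Besides the range of the coefficients of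
  \<open>F\<close>, their parity is decisive: at self-inverse elements they are even, which settles
  the coefficient at the identity in each argument. \<open>F\<close> alone cannot show that
  \<open>G\<close> is a 2-group, as it yields only \<open>v = (2s)^2\<close> with \<open>2s\<close>
  the order of \<open>H\<close>. The skew part \<open>E\<close> retains more of \<open>D\<close>:
  its transform vanishes on \<open>M\<close> and is \<open>2is\<close> up to sign elsewhere, which
  explains the formula for \<open>E * E\<close>. The rationality of \<open>s\<close> and
  \<open>t\<close> rests on two relations, one linear and one quadratic in \<open>t\<close>;
  eliminating \<open>t\<close> leaves an equation linear in \<open>s\<close>, because
  \<open>s^2\<close> is an integer.\<close>

lemma eq_zero_if_eq_mult: "S = c * S \<Longrightarrow> c \<noteq> 1 \<Longrightarrow> S = (0::complex)"
  by (metis mult_cancel_right2)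

locale finite_abelian_group = comm_group G for G (structure) +
  assumes fin: "finite (carrier G)"
begin

abbreviation chars :: "('a \<Rightarrow> complex) set" where
  "chars \<equiv> carrier (char_group G)"

abbreviation triv :: "'a \<Rightarrow> complex" where
  "triv \<equiv> \<one>\<^bsub>char_group G\<^esub>"

lemma triv_apply [simp]: "g \<in> carrier G \<Longrightarrow> triv g = 1"
  by (simp add: char_group_def)

lemma chars_iff:
  "X \<in> chars \<longleftrightarrow> X \<in> extensional (carrier G) \<and> (\<forall>x\<in>carrier G. X x \<noteq> 0) \<and>
     (\<forall>x\<in>carrier G. \<forall>y\<in>carrier G. X (x \<otimes> y) = X x * X y)"
  by (auto simp: char_group_def hom_def complex_units_def)

lemma char_mult: "X \<in> chars \<Longrightarrow> x \<in> carrier G \<Longrightarrow> y \<in> carrier G \<Longrightarrow> X (x \<otimes> y) = X x * X y"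
  by (simp add: chars_iff)

lemma char_nonzero: "X \<in> chars \<Longrightarrow> x \<in> carrier G \<Longrightarrow> X x \<noteq> 0"
  by (simp add: chars_iff)

lemma char_eqI: "X \<in> chars \<Longrightarrow> Y \<in> chars \<Longrightarrow> (\<And>x. x \<in> carrier G \<Longrightarrow> X x = Y x) \<Longrightarrow> X = Y"
  by (metis chars_iff extensionalityI)

lemma triv_in_chars [simp]: "triv \<in> chars"
  by (simp add: chars_iff) (simp add: char_group_def)

lemma char_one [simp]: "X \<in> chars \<Longrightarrow> X \<one> = 1"
  using char_mult[of X \<one> \<one>] char_nonzero[of X \<one>] by simp

lemma char_pow: "X \<in> chars \<Longrightarrow> x \<in> carrier G \<Longrightarrow> X (x [^] (i::nat)) = X x ^ i"
  by (induction i) (auto simp: char_mult mult.commute)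

lemma char_root_of_unity: "X \<in> chars \<Longrightarrow> x \<in> carrier G \<Longrightarrow> X x ^ card (carrier G) = 1"
  using char_pow[of X x "card (carrier G)"] pow_order_eq_1[of x] by (simp add: Coset.order_def)

lemma card_pos: "card (carrier G) > 0"
  using fin by (auto simp: card_gt_0_iff)

lemma norm_char: "X \<in> chars \<Longrightarrow> x \<in> carrier G \<Longrightarrow> norm (X x) = 1"
  using power_eq_1_iff[OF char_root_of_unity[of X x]] card_pos by simp

lemma char_cnj_mult: "X \<in> chars \<Longrightarrow> x \<in> carrier G \<Longrightarrow> X x * cnj (X x) = 1"
  by (simp add: complex_norm_square[symmetric] norm_char)

lemma char_inv: "X \<in> chars \<Longrightarrow> x \<in> carrier G \<Longrightarrow> X (inv x) = cnj (X x)"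
proof -
  assume X: "X \<in> chars" and x: "x \<in> carrier G"
  have "X x * X (inv x) = X x * cnj (X x)"
    using char_mult[OF X x, of "inv x"] x X by (simp add: char_cnj_mult)
  then show ?thesis using char_nonzero[OF X x] by simp
qed

lemma char_mult_closed: "X \<in> chars \<Longrightarrow> Y \<in> chars \<Longrightarrow> X \<otimes>\<^bsub>char_group G\<^esub> Y \<in> chars"
  by (simp add: chars_iff) (simp add: char_group_def)

lemma char_group_mult_apply: "x \<in> carrier G \<Longrightarrow> (X \<otimes>\<^bsub>char_group G\<^esub> Y) x = X x * Y x"
  by (simp add: char_group_def)

lemma finite_chars: "finite chars"
proof (rule finite_subset)
  let ?U = "{z::complex. z ^ card (carrier G) = 1}"
  show "chars \<subseteq> PiE (carrier G) (\<lambda>_. ?U)"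
    by (auto simp: PiE_def Pi_def char_root_of_unity) (auto simp: chars_iff)
  show "finite (PiE (carrier G) (\<lambda>_. ?U))"
    using fin card_pos by (intro finite_PiE finite_roots_unity) auto
qed

lemma char_mult_left_inj:
  assumes "X \<in> chars" shows "inj_on (\<lambda>Y. X \<otimes>\<^bsub>char_group G\<^esub> Y) chars"
proof (rule inj_onI)
  fix Y Z assume Y: "Y \<in> chars" and Z: "Z \<in> chars"
    and eq: "X \<otimes>\<^bsub>char_group G\<^esub> Y = X \<otimes>\<^bsub>char_group G\<^esub> Z"
  show "Y = Z"
  proof (rule char_eqI[OF Y Z])
    fix x assume x: "x \<in> carrier G"
    have "X x * Y x = X x * Z x" using eq x by (metis char_group_mult_apply)
    then show "Y x = Z x" using char_nonzero[OF assms x] by simp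
  qed
qed

lemma sum_group_shift:
  assumes "x \<in> carrier G"
  shows "(\<Sum>g\<in>carrier G. f (x \<otimes> g)) = (\<Sum>g\<in>carrier G. f g)"
  by (rule sum.reindex_bij_witness[of _ "\<lambda>g. inv x \<otimes> g" "\<lambda>g. x \<otimes> g"])
    (use assms in \<open>auto simp: m_assoc[symmetric]\<close>)

lemma sum_group_inv: "(\<Sum>g\<in>carrier G. f (inv g)) = (\<Sum>g\<in>carrier G. f g)"
  by (rule sum.reindex_bij_witness[of _ "\<lambda>g. inv g" "\<lambda>g. inv g"]) auto

lemma orthogonality:
  assumes X: "X \<in> chars" and Y: "Y \<in> chars"
  shows "(\<Sum>g\<in>carrier G. X g * cnj (Y g)) = (if X = Y then of_nat (card (carrier G)) else 0)"
proof (cases "X = Y")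
  case True
  then show ?thesis using X by (simp add: char_cnj_mult)
next
  case False
  then obtain y where y: "y \<in> carrier G" "X y \<noteq> Y y" using char_eqI[OF X Y] by blast
  let ?S = "\<Sum>g\<in>carrier G. X g * cnj (Y g)"
  have "?S = (\<Sum>g\<in>carrier G. X (y \<otimes> g) * cnj (Y (y \<otimes> g)))"
    using sum_group_shift[OF y(1), of "\<lambda>g. X g * cnj (Y g)"] by simp
  also have "\<dots> = X y * cnj (Y y) * ?S"
    using y X Y by (simp add: char_mult sum_distrib_left ac_simps)
  finally have "?S = X y * cnj (Y y) * ?S" .
  moreover have "X y * cnj (Y y) \<noteq> 1"
  proof
    assume "X y * cnj (Y y) = 1"
    then have "X y * (Y y * cnj (Y y)) = Y y" by (simp add: ac_simps)
    then show False using y char_cnj_mult[OF Y y(1)] by simp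
  qed
  ultimately have "?S = 0" by (rule eq_zero_if_eq_mult)
  then show ?thesis using False by simp
qed

lemma sum_char:
  assumes X: "X \<in> chars"
  shows "(\<Sum>g\<in>carrier G. X g) = (if X = triv then of_nat (card (carrier G)) else 0)"
  using orthogonality[OF X triv_in_chars] by simp

section \<open>Extension of characters from subgroups, and the order of the dual group\<close>

definition partial_char :: "'a set \<Rightarrow> ('a \<Rightarrow> complex) \<Rightarrow> bool" where
  "partial_char K f \<longleftrightarrow> subgroup K G \<and> (\<forall>x\<in>K. f x \<noteq> 0) \<and> (\<forall>x\<in>K. \<forall>y\<in>K. f (x \<otimes> y) = f x * f y)"

lemma partial_char_pow:
  assumes "partial_char K f" "x \<in> K"
  shows "f (x [^] (i::nat)) = f x ^ i"
proof -
  have K: "subgroup K G" using assms by (simp add: partial_char_def)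
  have 1: "f \<one> = 1"
  proof -
    have "\<one> \<in> K" by (rule subgroup.one_closed[OF K])
    then have "f (\<one> \<otimes> \<one>) = f \<one> * f \<one>" "f \<one> \<noteq> 0" using assms unfolding partial_char_def by blast+
    then show ?thesis by simp
  qed
  have "x [^] i \<in> K" for i :: nat
    by (induction i) (auto simp: subgroup.one_closed[OF K] subgroup.m_closed[OF K] assms)
  then show ?thesis
    using assms by (induction i) (auto simp: 1 partial_char_def)
qed

text \<open>The relations between \<open>x\<close> and \<open>K\<close> all follow from the
  membership of \<open>x [^] r\<close> for the least such \<open>r\<close>, so any \<open>c\<close>
  with \<open>c ^ r = f (x [^] r)\<close> may be the value at \<open>x\<close>. This freedom in
  \<open>c\<close> is what later separates points.\<close>

lemma extend_partial_char:
  assumes f: "partial_char K f" and x: "x \<in> carrier G"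
    and r: "r > 0" "x [^] (r::nat) \<in> K" "\<And>i. 0 < i \<Longrightarrow> i < r \<Longrightarrow> x [^] i \<notin> K"
    and c: "c ^ r = f (x [^] r)"
  shows "\<exists>K' f'. partial_char K' f' \<and> K \<subseteq> K' \<and> x \<in> K' \<and> f' x = c \<and> (\<forall>y\<in>K. f' y = f y)"
proof -
  have K: "subgroup K G" and fnz: "\<And>x. x \<in> K \<Longrightarrow> f x \<noteq> 0"
    and fm: "\<And>x y. x \<in> K \<Longrightarrow> y \<in> K \<Longrightarrow> f (x \<otimes> y) = f x * f y"
    using f by (auto simp: partial_char_def)
  interpret K: subgroup K G by fact
  have KG: "\<And>k. k \<in> K \<Longrightarrow> k \<in> carrier G" using K.subset by blast
  have Kpow: "\<And>k i. k \<in> K \<Longrightarrow> k [^] (i::nat) \<in> K"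
    by (induct_tac i) auto
  have f1: "f \<one> = 1" using partial_char_pow[OF f K.one_closed, of 0] by simp
  have cnz: "c \<noteq> 0" using c fnz[OF r(2)] r(1) by (metis power_eq_0_iff)
  \<comment> \<open>Division with remainder by \<open>r\<close>: minimality kills the remainder, so
    every power of \<open>x\<close> inside \<open>K\<close> is a power of \<open>x [^] r\<close>,
    where \<open>f\<close> and \<open>c\<close> agree.\<close>
  have xinK: "r dvd i \<and> f (x [^] i) = c ^ i" if "x [^] i \<in> K" for i :: nat
  proof -
    have e: "x [^] i = (x [^] r) [^] (i div r) \<otimes> x [^] (i mod r)"
      using x by (simp add: nat_pow_pow nat_pow_mult)
    have p: "(x [^] r) [^] (i div r) \<in> K" using r(2) using Kpow by blast
    have "x [^] (i mod r) = inv ((x [^] r) [^] (i div r)) \<otimes> x [^] i"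
      unfolding e using x by (simp add: m_assoc[symmetric])
    then have "x [^] (i mod r) \<in> K" using p that by simp
    then have "i mod r = 0" using r(3)[of "i mod r"] r(1) by (meson mod_less_divisor neq0_conv)
    then have d: "r dvd i" and "x [^] i = (x [^] r) [^] (i div r)" using e x by auto
    then have "f (x [^] i) = (c ^ r) ^ (i div r)" using partial_char_pow[OF f r(2)] c by simp
    also have "\<dots> = c ^ i" using d by (simp add: power_mult[symmetric])
    finally show ?thesis using d by simp
  qed
  have wd_le: "f k * c ^ i = f k' * c ^ j"
    if kk: "k \<in> K" "k' \<in> K" "k \<otimes> x [^] i = k' \<otimes> x [^] j" "i \<le> j" for k k' and i j :: nat
  proof -
    have "k = k' \<otimes> x [^] (j - i)"
    proof -
      have "k \<otimes> x [^] i = k' \<otimes> x [^] (j - i) \<otimes> x [^] i"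
        using kk x KG by (simp add: m_assoc nat_pow_mult)
      then show ?thesis using kk x KG using right_cancel by simp
    qed
    moreover from this have "x [^] (j - i) = inv k' \<otimes> k"
      using kk x KG by (simp add: m_assoc[symmetric])
    then have m: "x [^] (j - i) \<in> K" using kk by simp
    ultimately have "f k = f k' * c ^ (j - i)" using fm[OF kk(2) m] xinK[OF m] by simp
    then show ?thesis using kk(4) by (simp add: power_add[symmetric])
  qed
  have wd: "f k * c ^ i = f k' * c ^ j"
    if "k \<in> K" "k' \<in> K" "k \<otimes> x [^] i = k' \<otimes> x [^] j" for k k' and i j :: nat
    using wd_le[OF that] wd_le[OF that(2,1) that(3)[symmetric]] by (metis nat_le_linear)
  define K' where "K' = {y. \<exists>k\<in>K. \<exists>i::nat. y = k \<otimes> x [^] i}"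
  \<comment> \<open>By \<open>wd\<close> the value does not depend on the representation that
    \<open>SOME\<close> picks.\<close>
  define f' where "f' y = (SOME z. \<exists>k\<in>K. \<exists>i::nat. y = k \<otimes> x [^] i \<and> z = f k * c ^ i)" for y
  have f': "f' (k \<otimes> x [^] i) = f k * c ^ i" if "k \<in> K" for k and i :: nat
  proof -
    have "\<exists>k'\<in>K. \<exists>j::nat. k \<otimes> x [^] i = k' \<otimes> x [^] j \<and> f' (k \<otimes> x [^] i) = f k' * c ^ j"
      unfolding f'_def by (rule someI_ex) (use that in blast)
    then show ?thesis using wd that by metis
  qed
  have mult: "(k \<otimes> x [^] i) \<otimes> (k' \<otimes> x [^] j) = (k \<otimes> k') \<otimes> x [^] (i + j)"
    if "k \<in> K" "k' \<in> K" for k k' and i j :: nat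
  proof -
    have "(k \<otimes> x [^] i) \<otimes> (k' \<otimes> x [^] j) = (k \<otimes> k') \<otimes> (x [^] i \<otimes> x [^] j)"
      using that x KG by (simp add: m_ac)
    then show ?thesis using x by (simp add: nat_pow_mult)
  qed
  have K'G: "K' \<subseteq> carrier G" unfolding K'_def using KG x by auto
  have "subgroup K' G"
  proof (rule subgroupI)
    show "K' \<subseteq> carrier G" by fact
    show "K' \<noteq> {}" unfolding K'_def using K.one_closed by blast
    show "y \<otimes> z \<in> K'" if yz: "y \<in> K'" "z \<in> K'" for y z
    proof -
      obtain k i k' j where "k \<in> K" "y = k \<otimes> x [^] (i::nat)" "k' \<in> K" "z = k' \<otimes> x [^] (j::nat)"
        using yz unfolding K'_def by blast
      then have "y \<otimes> z = (k \<otimes> k') \<otimes> x [^] (i + j)" "k \<otimes> k' \<in> K" using mult by auto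
      then show ?thesis unfolding K'_def by blast
    qed
    fix y assume "y \<in> K'"
    then obtain k and i :: nat where ki: "k \<in> K" "y = k \<otimes> x [^] i" unfolding K'_def by blast
    \<comment> \<open>Natural exponents only: as \<open>x [^] (r * i)\<close> lies in
      \<open>K\<close>, the inverse of \<open>x [^] i\<close> is \<open>x [^] ((r - 1) * i)\<close>
      up to a factor from \<open>K\<close>.\<close>
    define m where "m = (r - 1) * i"
    have m: "r * i = m + i" using r(1) by (cases r) (auto simp: m_def)
    have "(inv k \<otimes> inv (x [^] (r * i)) \<otimes> x [^] m) \<otimes> y = \<one>"
    proof -
      have "(inv k \<otimes> inv (x [^] (r * i)) \<otimes> x [^] m) \<otimes> y =
        (inv k \<otimes> k) \<otimes> (inv (x [^] (r * i)) \<otimes> (x [^] m \<otimes> x [^] i))"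
        unfolding ki(2) using KG[OF ki(1)] x by (simp only: m_ac m_closed inv_closed nat_pow_closed)
      also have "\<dots> = \<one>" using ki x KG by (simp add: nat_pow_mult m[symmetric])
      finally show ?thesis .
    qed
    then have "inv y = inv k \<otimes> inv (x [^] (r * i)) \<otimes> x [^] m"
      using ki x KG by (intro inv_equality) auto
    moreover have "inv k \<otimes> inv (x [^] (r * i)) \<in> K"
      using ki Kpow[OF r(2), of i] x by (simp add: nat_pow_pow)
    ultimately show "inv y \<in> K'" unfolding K'_def by blast
  qed
  moreover have "f' y \<noteq> 0" if "y \<in> K'" for y
  proof -
    obtain k i where "k \<in> K" "y = k \<otimes> x [^] (i::nat)" using \<open>y \<in> K'\<close> unfolding K'_def by blast
    then show ?thesis using f' fnz cnz by simp
  qed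
  moreover have "f' (y \<otimes> z) = f' y * f' z" if yz: "y \<in> K'" "z \<in> K'" for y z
  proof -
    obtain k i k' j where "k \<in> K" "y = k \<otimes> x [^] (i::nat)" "k' \<in> K" "z = k' \<otimes> x [^] (j::nat)"
      using yz unfolding K'_def by blast
    then show ?thesis using mult f' fm by (simp add: power_add)
  qed
  ultimately have "partial_char K' f'" by (simp add: partial_char_def)
  moreover have "f' y = f y \<and> y \<in> K'" if "y \<in> K" for y
    using f'[OF that, of 0] that KG unfolding K'_def by (auto intro!: bexI[of _ y] exI[of _ 0])
  moreover have "x \<in> K'" "f' x = c"
    using f'[OF K.one_closed, of 1] x f1 unfolding K'_def
    by (auto intro!: bexI[of _ \<one>] exI[of _ 1])
  ultimately show ?thesis by blast
qed

lemma least_power_in_subgroup: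
  assumes "subgroup K G" "x \<in> carrier G"
  obtains r :: nat where "r > 0" "x [^] r \<in> K" "\<And>i. 0 < i \<Longrightarrow> i < r \<Longrightarrow> x [^] i \<notin> K"
proof -
  let ?P = "\<lambda>r::nat. r > 0 \<and> x [^] r \<in> K"
  have "?P (card (carrier G))"
    using pow_order_eq_1[OF assms(2)] card_pos subgroup.one_closed[OF assms(1)] by (simp add: Coset.order_def)
  then have "?P (LEAST r. ?P r)" by (rule LeastI)
  then show ?thesis using not_less_Least[of _ ?P] that by blast
qed

text \<open>Induction on the number of elements outside \<open>K\<close>; the root required for the
  next value exists in the complex numbers.\<close>

lemma partial_char_extends_to_char:
  assumes "partial_char K f"
  shows "\<exists>X\<in>chars. \<forall>y\<in>K. X y = f y"
  using assms
proof (induction "card (carrier G) - card K" arbitrary: K f rule: less_induct)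
  case less
  have K: "subgroup K G" using less.prems by (simp add: partial_char_def)
  then have sub: "K \<subseteq> carrier G" by (rule subgroup.subset)
  show ?case
  proof (cases "K = carrier G")
    case True
    have "restrict f (carrier G) \<in> chars"
      using less.prems unfolding True by (auto simp: chars_iff partial_char_def)
    then show ?thesis by (rule bexI[rotated]) (simp add: True)
  next
    case False
    then obtain x where x: "x \<in> carrier G" "x \<notin> K" using sub by blast
    obtain r :: nat where r: "r > 0" "x [^] r \<in> K" "\<And>i. 0 < i \<Longrightarrow> i < r \<Longrightarrow> x [^] i \<notin> K"
      using least_power_in_subgroup[OF K x(1)] by blast
    obtain c where c: "c ^ r = f (x [^] r)"
    proof -
      have "card {z. z ^ r = f (x [^] r)} = r"
        using r(1,2) less.prems by (intro card_nth_roots) (auto simp: partial_char_def)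
      then have "{z. z ^ r = f (x [^] r)} \<noteq> {}" using r(1) by (metis card.empty less_irrefl)
      then show ?thesis using that by blast
    qed
    obtain K' f' where K': "partial_char K' f'" "K \<subseteq> K'" "x \<in> K'" "\<forall>y\<in>K. f' y = f y"
      using extend_partial_char[OF less.prems x(1) r c] by blast
    have "K' \<subseteq> carrier G" using K'(1) by (simp add: partial_char_def subgroup.subset)
    moreover have "K \<subset> K'" using K' x by blast
    ultimately have "card K < card K'" "card K' \<le> card (carrier G)"
      using fin by (meson finite_subset psubset_card_mono card_mono)+
    then have "card (carrier G) - card K' < card (carrier G) - card K" by simp
    from less.hyps[OF this K'(1)] obtain X where X: "X \<in> chars" "\<forall>y\<in>K'. X y = f' y" ..
    have "\<forall>y\<in>K. X y = f y"
    proof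
      fix y assume y: "y \<in> K"
      then have "X y = f' y" using X(2) K'(2) by (metis subsetD)
      also have "\<dots> = f y" using K'(4) y by metis
      finally show "X y = f y" .
    qed
    then show ?thesis using X(1) by (rule bexI)
  qed
qed

text \<open>The trivial character of the trivial subgroup extends with any \<open>r\<close>-th root
  of unity at \<open>g\<close>, where \<open>r\<close> is the order of \<open>g\<close>. As
  \<open>r \<ge> 2\<close>, a root other than 1 is available.\<close>

lemma char_separates:
  assumes "g \<in> carrier G" "g \<noteq> \<one>"
  obtains X where "X \<in> chars" "X g \<noteq> 1"
proof -
  have t: "subgroup {\<one>} G" by (rule triv_subgroup)
  then have p: "partial_char {\<one>} (\<lambda>_. 1)" by (simp add: partial_char_def)
  obtain r :: nat where r: "r > 0" "g [^] r \<in> {\<one>}" "\<And>i. 0 < i \<Longrightarrow> i < r \<Longrightarrow> g [^] i \<notin> {\<one>}"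
    using least_power_in_subgroup[OF t assms(1)] by blast
  have "r \<noteq> 1" using r(2) assms by auto
  then have "r \<ge> 2" using r(1) by simp
  then obtain c :: complex where c: "c ^ r = 1" "c \<noteq> 1"
  proof -
    have "card {z::complex. z ^ r = 1} = r" using r(1) by (rule card_roots_unity_eq)
    then have "\<not> {z::complex. z ^ r = 1} \<subseteq> {1}"
      using \<open>r \<ge> 2\<close> card_mono[of "{1::complex}" "{z::complex. z ^ r = 1}"] by auto
    then show ?thesis using that by blast
  qed
  obtain K f where "partial_char K f" "g \<in> K" "f g = c"
    using extend_partial_char[OF p assms(1) r, of c] c by auto
  then obtain X where "X \<in> chars" "X g = c" using partial_char_extends_to_char by metis
  then show ?thesis using that c by blast
qed

lemma sum_chars_raw:
  assumes "g \<in> carrier G"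
  shows "(\<Sum>X\<in>chars. X g) = (if g = \<one> then of_nat (card chars) else 0)"
proof (cases "g = \<one>")
  case False
  then obtain Y where Y: "Y \<in> chars" "Y g \<noteq> 1" using char_separates assms by blast
  have "(\<lambda>X. Y \<otimes>\<^bsub>char_group G\<^esub> X) ` chars = chars"
    using char_mult_left_inj[OF Y(1)] char_mult_closed[OF Y(1)] finite_chars
    by (intro endo_inj_surj) auto
  then have "(\<Sum>X\<in>chars. X g) = (\<Sum>X\<in>chars. (Y \<otimes>\<^bsub>char_group G\<^esub> X) g)"
    using sum.reindex[OF char_mult_left_inj[OF Y(1)], of "\<lambda>X. X g"] by simp
  also have "\<dots> = Y g * (\<Sum>X\<in>chars. X g)"
    using assms by (simp add: char_group_mult_apply sum_distrib_left)
  finally have "(\<Sum>X\<in>chars. X g) = 0" using Y(2) by (rule eq_zero_if_eq_mult)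
  then show ?thesis using False by simp
qed simp

text \<open>Double counting: in the sum of all \<open>X g\<close>, summing over \<open>g\<close>
  first leaves only the principal character, summing over \<open>X\<close> first only the
  identity.\<close>

lemma card_chars: "card chars = card (carrier G)"
proof -
  have "(\<Sum>X\<in>chars. \<Sum>g\<in>carrier G. X g) = of_nat (card (carrier G))"
    using finite_chars by (simp add: sum_char if_distrib sum.delta cong: if_cong)
  moreover have "(\<Sum>g\<in>carrier G. \<Sum>X\<in>chars. X g) = of_nat (card chars)"
    using fin by (simp add: sum_chars_raw if_distrib sum.delta cong: if_cong)
  ultimately have "of_nat (card chars) = (of_nat (card (carrier G)) :: complex)"
    using sum.swap[of "\<lambda>X g. X g" "carrier G" chars] by simp
  then show ?thesis by simp
qed

lemma sum_chars:
  "g \<in> carrier G \<Longrightarrow> (\<Sum>X\<in>chars. X g) = (if g = \<one> then of_nat (card (carrier G)) else 0)"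
  by (simp add: sum_chars_raw card_chars)

end

section \<open>Convolution and Fourier transform\<close>

text \<open>Multiplication in the group ring. The coefficient ring stays open because integral
  identities are checked after embedding into the complex numbers; the group is a parameter because
  a projection onto a second group occurs.\<close>

definition group_conv ::
  "('a, 'b) monoid_scheme \<Rightarrow> ('a \<Rightarrow> 'c::comm_ring_1) \<Rightarrow> ('a \<Rightarrow> 'c) \<Rightarrow> 'a \<Rightarrow> 'c" where
  "group_conv G f h g = (\<Sum>x\<in>carrier G. f x * h (inv\<^bsub>G\<^esub> x \<otimes>\<^bsub>G\<^esub> g))"

lemma of_int_group_conv:
  "of_int (group_conv G f h g) = group_conv G (\<lambda>x. of_int (f x)) (\<lambda>x. of_int (h x)) g"
  by (simp add: group_conv_def)

context finite_abelian_group
begin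

definition fourier :: "('a \<Rightarrow> complex) \<Rightarrow> ('a \<Rightarrow> complex) \<Rightarrow> complex" where
  "fourier f X = (\<Sum>g\<in>carrier G. f g * X g)"

lemma fourier_add: "fourier (\<lambda>g. f g + h g) X = fourier f X + fourier h X"
  by (simp add: fourier_def sum.distrib distrib_right)

lemma fourier_diff: "fourier (\<lambda>g. f g - h g) X = fourier f X - fourier h X"
  by (simp add: fourier_def sum_subtractf left_diff_distrib)

lemma fourier_scale: "fourier (\<lambda>g. c * f g) X = c * fourier f X"
  by (simp add: fourier_def sum_distrib_left mult.assoc)

lemma fourier_const:
  "X \<in> chars \<Longrightarrow> fourier (\<lambda>g. c) X = (if X = triv then c * of_nat (card (carrier G)) else 0)"
  by (simp add: fourier_def sum_distrib_left[symmetric] sum_char)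

lemma fourier_delta: "X \<in> chars \<Longrightarrow> fourier (\<lambda>g. if g = \<one> then c else 0) X = c"
proof -
  assume X: "X \<in> chars"
  have "fourier (\<lambda>g. if g = \<one> then c else 0) X = (\<Sum>g\<in>carrier G. if g = \<one> then c * X g else 0)"
    unfolding fourier_def by (intro sum.cong) auto
  then show ?thesis using X fin by simp
qed

lemma fourier_cong: "(\<And>g. g \<in> carrier G \<Longrightarrow> f g = h g) \<Longrightarrow> fourier f X = fourier h X"
  by (simp add: fourier_def)

lemma fourier_indicator:
  assumes "A \<subseteq> carrier G"
  shows "fourier (indicator A) X = char_sum X A"
proof -
  have "fourier (indicator A) X = (\<Sum>g\<in>carrier G. if g \<in> A then X g else 0)"
    unfolding fourier_def by (intro sum.cong) (auto simp: indicator_def)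
  also have "\<dots> = sum X (carrier G \<inter> A)" using fin by (simp add: sum.inter_restrict)
  also have "carrier G \<inter> A = A" using assms by blast
  finally show ?thesis by (simp add: char_sum_def)
qed

lemma fourier_conv:
  assumes X: "X \<in> chars"
  shows "fourier (group_conv G f h) X = fourier f X * fourier h X"
proof -
  have "fourier (group_conv G f h) X =
      (\<Sum>x\<in>carrier G. \<Sum>g\<in>carrier G. f x * h (inv x \<otimes> g) * X g)"
    unfolding fourier_def group_conv_def sum_distrib_right by (rule sum.swap)
  also have "\<dots> = (\<Sum>x\<in>carrier G. \<Sum>g\<in>carrier G. f x * X x * (h g * X g))"
  proof (rule sum.cong[OF refl])
    fix x assume x: "x \<in> carrier G"
    have "(\<Sum>g\<in>carrier G. f x * h (inv x \<otimes> g) * X g) =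
        (\<Sum>g\<in>carrier G. f x * h (inv x \<otimes> (x \<otimes> g)) * X (x \<otimes> g))"
      using sum_group_shift[OF x, of "\<lambda>g. f x * h (inv x \<otimes> g) * X g"] by simp
    also have "\<dots> = (\<Sum>g\<in>carrier G. f x * X x * (h g * X g))"
      using x X by (intro sum.cong) (simp_all add: m_assoc[symmetric] char_mult)
    finally show "(\<Sum>g\<in>carrier G. f x * h (inv x \<otimes> g) * X g) = \<dots>" .
  qed
  also have "\<dots> = fourier f X * fourier h X"
    by (simp add: fourier_def sum_product)
  finally show ?thesis .
qed

lemma fourier_inversion:
  assumes g: "g \<in> carrier G"
  shows "(\<Sum>X\<in>chars. fourier f X * cnj (X g)) = of_nat (card (carrier G)) * f g"
proof -
  have "(\<Sum>X\<in>chars. fourier f X * cnj (X g)) =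
      (\<Sum>x\<in>carrier G. \<Sum>X\<in>chars. f x * X x * cnj (X g))"
    unfolding fourier_def sum_distrib_right by (rule sum.swap)
  also have "\<dots> = (\<Sum>x\<in>carrier G. f x * (\<Sum>X\<in>chars. X (x \<otimes> inv g)))"
    using g by (intro sum.cong) (simp_all add: sum_distrib_left char_mult char_inv mult.assoc)
  also have "\<dots> = (\<Sum>x\<in>carrier G. if x = g then of_nat (card (carrier G)) * f x else 0)"
  proof (rule sum.cong[OF refl])
    fix x assume x: "x \<in> carrier G"
    have "x \<otimes> inv g = \<one> \<longleftrightarrow> x = g" using x g
      by (metis inv_equality inv_inv inv_closed r_inv)
    then show "f x * (\<Sum>X\<in>chars. X (x \<otimes> inv g)) = (if x = g then of_nat (card (carrier G)) * f x else 0)"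
      using x g by (simp add: sum_chars)
  qed
  also have "\<dots> = of_nat (card (carrier G)) * f g" using g fin by simp
  finally show ?thesis .
qed

lemma fourier_inj:
  assumes "\<And>X. X \<in> chars \<Longrightarrow> fourier f X = fourier h X" and g: "g \<in> carrier G"
  shows "f g = h g"
proof -
  have "of_nat (card (carrier G)) * f g = of_nat (card (carrier G)) * h g"
    unfolding fourier_inversion[OF g, symmetric] using assms(1) by simp
  then show ?thesis using card_pos by simp
qed

lemma parseval:
  "(\<Sum>X\<in>chars. fourier f X * cnj (fourier f X)) =
     of_nat (card (carrier G)) * (\<Sum>g\<in>carrier G. f g * cnj (f g))"
proof -
  have "(\<Sum>X\<in>chars. fourier f X * cnj (fourier f X)) =
      (\<Sum>X\<in>chars. \<Sum>g\<in>carrier G. fourier f X * cnj (X g) * cnj (f g))"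
    by (intro sum.cong refl) (simp add: fourier_def[of f] sum_distrib_left ac_simps)
  also have "\<dots> = (\<Sum>g\<in>carrier G. \<Sum>X\<in>chars. fourier f X * cnj (X g) * cnj (f g))"
    by (rule sum.swap)
  also have "\<dots> = (\<Sum>g\<in>carrier G. of_nat (card (carrier G)) * f g * cnj (f g))"
    by (intro sum.cong refl) (simp add: sum_distrib_right[symmetric] fourier_inversion)
  finally show ?thesis by (simp add: sum_distrib_left mult.assoc)
qed

lemma char_sum_set_inv:
  assumes "A \<subseteq> carrier G" "X \<in> chars"
  shows "char_sum X (set_inv A) = cnj (char_sum X A)"
proof -
  have "inj_on (\<lambda>x. inv x) A" using assms(1) by (intro inj_onI) (metis inv_inv subsetD)
  then have "char_sum X ((\<lambda>x. inv x) ` A) = (\<Sum>x\<in>A. X (inv x))"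
    by (simp add: char_sum_def sum.reindex)
  also have "\<dots> = cnj (char_sum X A)"
    unfolding char_sum_def cnj_sum using assms by (intro sum.cong) (auto simp: char_inv)
  also have "(\<lambda>x. inv x) ` A = set_inv A" by (auto simp: SET_INV_def)
  finally show ?thesis .
qed

lemma set_inv_iff:
  assumes "A \<subseteq> carrier G" "g \<in> carrier G"
  shows "g \<in> set_inv A \<longleftrightarrow> inv g \<in> A"
  using assms unfolding SET_INV_def by (auto intro!: bexI[of _ "inv g"])

lemma set_inv_subset: "A \<subseteq> carrier G \<Longrightarrow> set_inv A \<subseteq> carrier G"
  unfolding SET_INV_def by auto

text \<open>The image under \<open>X\<close> of the group ring identity
  \<open>D * D^(-1) = n + l * G\<close>, obtained by grouping pairs from \<open>D\<close> by their
  quotient.\<close>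

lemma char_sum_difference_set:
  assumes D: "difference_set G D v k l" and X: "X \<in> chars"
  shows "char_sum X D * cnj (char_sum X D) =
    of_nat k - of_nat l + (if X = triv then of_nat l * of_nat v else 0)"
proof -
  let ?P = "\<lambda>g. {p \<in> D \<times> D. fst p \<otimes> inv (snd p) = g}"
  have DG: "D \<subseteq> carrier G" and kD: "card D = k" and v: "card (carrier G) = v"
    using D by (auto simp: difference_set_def)
  have finD: "finite D" using DG fin by (rule finite_subset)
  have cP: "card (?P g) = (if g = \<one> then k else l)" if g: "g \<in> carrier G" for g
  proof (cases "g = \<one>")
    case True
    have "x \<otimes> inv y = \<one> \<longleftrightarrow> x = y" if "x \<in> D" "y \<in> D" for x y
      using that DG by (metis inv_equality inv_inv inv_closed r_inv subsetD)
    then have "?P g = (\<lambda>x. (x, x)) ` D" using True by auto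
    then have "card (?P g) = k" using kD by (simp add: card_image inj_on_def)
    then show ?thesis using True by simp
  next
    case False
    have "?P g = {(d1, d2). d1 \<in> D \<and> d2 \<in> D \<and> d1 \<otimes> inv d2 = g}" by auto
    then show ?thesis using D False g unfolding difference_set_def by simp
  qed
  have "char_sum X D * cnj (char_sum X D) = (\<Sum>x\<in>D. \<Sum>y\<in>D. X (x \<otimes> inv y))"
    unfolding char_sum_def cnj_sum sum_product
    using X DG by (intro sum.cong refl) (auto simp: char_mult char_inv subset_iff)
  also have "\<dots> = (\<Sum>p\<in>D \<times> D. X (fst p \<otimes> inv (snd p)))"
    by (simp add: sum.cartesian_product case_prod_beta)
  also have "\<dots> = (\<Sum>g\<in>carrier G. \<Sum>p\<in>?P g. X (fst p \<otimes> inv (snd p)))"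
    by (rule sum.group[symmetric]) (use finD fin DG in \<open>auto simp: subset_iff\<close>)
  also have "\<dots> = (\<Sum>g\<in>carrier G. of_nat (card (?P g)) * X g)"
    by (intro sum.cong refl) simp
  also have "\<dots> = (\<Sum>g\<in>carrier G. (of_nat l + (if g = \<one> then of_nat k - of_nat l else 0)) * X g)"
    by (intro sum.cong refl) (simp add: cP)
  also have "\<dots> = fourier (\<lambda>g. of_nat l + (if g = \<one> then of_nat k - of_nat l else 0)) X"
    by (simp add: fourier_def)
  also have "\<dots> = of_nat k - of_nat l + (if X = triv then of_nat l * of_nat v else 0)"
    using X by (simp add: fourier_add fourier_const fourier_delta v)
  finally show ?thesis .
qed

end

section \<open>Square roots in the group ring of a group of odd order\<close>

lemma even_sum_involution:
  fixes h :: "'a \<Rightarrow> int"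
  assumes "finite S" "\<And>x. x \<in> S \<Longrightarrow> i x \<in> S" "\<And>x. x \<in> S \<Longrightarrow> i (i x) = x"
    "\<And>x. x \<in> S \<Longrightarrow> i x \<noteq> x" "\<And>x. x \<in> S \<Longrightarrow> h (i x) = h x"
  shows "even (sum h S)"
  using assms
proof (induction "card S" arbitrary: S rule: less_induct)
  case less
  show ?case
  proof (cases "S = {}")
    case False
    then obtain x where x: "x \<in> S" by blast
    let ?T = "S - {x, i x}"
    have fin: "finite ?T" using less.prems(1) by simp
    have "even (sum h ?T)"
    proof (rule less.hyps[OF _ fin])
      show "card ?T < card S" using x less.prems(1) by (intro psubset_card_mono) auto
      fix y assume y: "y \<in> ?T"
      have "i y \<noteq> x" using y less.prems(3)[of y] by auto
      moreover have "i y \<noteq> i x" using y less.prems(3)[of y] less.prems(3)[OF x] by auto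
      ultimately show "i y \<in> ?T" using y less.prems(2) by auto
      show "i (i y) = y" "i y \<noteq> y" "h (i y) = h y" using y less.prems(3-5) by auto
    qed
    moreover have "sum h S = sum h ?T + sum h {x, i x}"
      using x less.prems(1,2) by (intro sum.subset_diff) auto
    moreover have "sum h {x, i x} = 2 * h x"
      using less.prems(4,5)[OF x] by (subst sum.insert) auto
    ultimately show ?thesis by simp
  qed simp
qed

text \<open>The map of group rings induced by \<open>\<phi>\<close>.\<close>

definition push :: "('a, 'b) monoid_scheme \<Rightarrow> ('a \<Rightarrow> 'd) \<Rightarrow> ('a \<Rightarrow> 'c::comm_ring_1) \<Rightarrow> 'd \<Rightarrow> 'c" where
  "push G \<phi> f q = (\<Sum>g\<in>{g \<in> carrier G. \<phi> g = q}. f g)"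

context finite_abelian_group
begin

lemma sum_group_reflect:
  assumes "g \<in> carrier G"
  shows "(\<Sum>x\<in>carrier G. f (inv x \<otimes> g)) = (\<Sum>x\<in>carrier G. f x)"
proof -
  have "(\<Sum>x\<in>carrier G. f (inv x \<otimes> g)) = (\<Sum>x\<in>carrier G. f (g \<otimes> x))"
    using sum_group_inv[of "\<lambda>x. f (g \<otimes> x)"] assms by (simp add: m_comm)
  then show ?thesis using sum_group_shift[OF assms, of f] by simp
qed

lemma reflect_reflect: "x \<in> carrier G \<Longrightarrow> g \<in> carrier G \<Longrightarrow> inv (inv x \<otimes> g) \<otimes> g = x"
  by (simp add: inv_mult m_assoc)

lemma conv_comm:
  assumes "g \<in> carrier G"
  shows "group_conv G f h g = group_conv G h f g"
proof -
  have "group_conv G f h g = (\<Sum>x\<in>carrier G. f (inv x \<otimes> g) * h (inv (inv x \<otimes> g) \<otimes> g))"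
    unfolding group_conv_def
    using sum_group_reflect[OF assms, of "\<lambda>x. f x * h (inv x \<otimes> g)"] by simp
  also have "\<dots> = group_conv G h f g"
    unfolding group_conv_def using assms by (intro sum.cong refl) (simp add: reflect_reflect)
  finally show ?thesis .
qed

lemma conv_cong:
  "(\<And>x. x \<in> carrier G \<Longrightarrow> f x = f' x) \<Longrightarrow> (\<And>x. x \<in> carrier G \<Longrightarrow> h x = h' x) \<Longrightarrow> g \<in> carrier G \<Longrightarrow>
    group_conv G f h g = group_conv G f' h' g"
  unfolding group_conv_def by (intro sum.cong) auto

lemma conv_add_left: "group_conv G (\<lambda>x. f x + f' x) h g = group_conv G f h g + group_conv G f' h g"
  by (simp add: group_conv_def sum.distrib distrib_right)

lemma conv_add_right: "group_conv G h (\<lambda>x. f x + f' x) g = group_conv G h f g + group_conv G h f' g"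
  by (simp add: group_conv_def sum.distrib distrib_left)

lemma conv_scale_left: "group_conv G (\<lambda>x. c * f x) h g = c * group_conv G f h g"
  by (simp add: group_conv_def sum_distrib_left mult.assoc)

lemma conv_scale_right: "group_conv G f (\<lambda>x. c * h x) g = c * group_conv G f h g"
  by (simp add: group_conv_def sum_distrib_left ac_simps)

lemma conv_delta:
  assumes "g \<in> carrier G"
  shows "group_conv G (\<lambda>x. if x = \<one> then c else 0) f g = c * f g"
proof -
  have "group_conv G (\<lambda>x. if x = \<one> then c else 0) f g =
      (\<Sum>x\<in>carrier G. if x = \<one> then c * f g else 0)"
    unfolding group_conv_def using assms by (intro sum.cong) auto
  then show ?thesis using fin by simp
qed

lemma conv_subgroup:
  assumes K: "subgroup K G" and g: "g \<in> carrier G"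
  shows "group_conv G (indicator K) (indicator K) g = of_nat (card K) * indicator K g"
proof -
  have KG: "K \<subseteq> carrier G" using K by (rule subgroup.subset)
  have eq: "(inv x \<otimes> g \<in> K) = (g \<in> K)" if "x \<in> K" for x
  proof
    assume "inv x \<otimes> g \<in> K"
    then have "x \<otimes> (inv x \<otimes> g) \<in> K" using that subgroup.m_closed[OF K] by blast
    then show "g \<in> K" using that KG g by (simp add: m_assoc[symmetric] subset_iff)
  next
    assume "g \<in> K"
    then show "inv x \<otimes> g \<in> K" using that subgroup.m_closed[OF K] subgroup.m_inv_closed[OF K] by blast
  qed
  have "group_conv G (indicator K) (indicator K) g =
      (\<Sum>x\<in>carrier G. if x \<in> K then indicator K g else 0)"
    unfolding group_conv_def using eq by (intro sum.cong refl) (auto simp: indicator_def)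
  also have "\<dots> = of_nat (card (carrier G \<inter> K)) * indicator K g"
    using fin by (simp add: sum.inter_restrict[symmetric])
  also have "carrier G \<inter> K = K" using KG by blast
  finally show ?thesis .
qed

lemma square_inj:
  assumes sq: "\<And>x. x \<in> carrier G \<Longrightarrow> x \<otimes> x = \<one> \<Longrightarrow> x = \<one>"
    and y: "y \<in> carrier G" and z: "z \<in> carrier G" and eq: "y \<otimes> y = z \<otimes> z"
  shows "y = z"
proof -
  have "(y \<otimes> inv z) \<otimes> (y \<otimes> inv z) = (y \<otimes> y) \<otimes> inv (z \<otimes> z)"
    using y z by (simp add: m_ac inv_mult)
  also have "\<dots> = \<one>" using y z unfolding eq by simp
  finally have "y \<otimes> inv z = \<one>" by (rule sq[rotated]) (use y z in simp)
  then have "inv (inv z) = y" using y z by (intro inv_equality) auto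
  then show ?thesis using z by simp
qed

text \<open>Sending \<open>y\<close> to \<open>inv y \<otimes> (x \<otimes> x)\<close> swaps the two
  factors of each product contributing to the coefficient. Its only fixed point is
  \<open>y = x\<close>, as squaring is injective, so modulo 2 just \<open>f x * f x\<close>
  survives, which has the parity of \<open>f x\<close>.\<close>

lemma square_root_mod_2:
  fixes f :: "'a \<Rightarrow> int"
  assumes sq: "\<And>x. x \<in> carrier G \<Longrightarrow> x \<otimes> x = \<one> \<Longrightarrow> x = \<one>" and x: "x \<in> carrier G"
  shows "even (group_conv G f f (x \<otimes> x) - f x)"
proof -
  let ?F = "\<lambda>y. f y * f (inv y \<otimes> (x \<otimes> x))"
  let ?i = "\<lambda>y. inv y \<otimes> (x \<otimes> x)"
  have xx: "x \<otimes> x \<in> carrier G" using x by simp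
  have ix: "?i x = x" using x by (simp add: m_assoc[symmetric])
  have fixed: "y = x" if y: "y \<in> carrier G" "?i y = y" for y
  proof -
    have "y \<otimes> (inv y \<otimes> (x \<otimes> x)) = y \<otimes> y" using y(2) by simp
    then have "y \<otimes> y = x \<otimes> x" using y(1) x by (simp add: m_assoc[symmetric])
    then show ?thesis using square_inj[OF sq] y(1) x by blast
  qed
  have "even (sum ?F (carrier G - {x}))"
  proof (rule even_sum_involution[where i = ?i])
    show "finite (carrier G - {x})" using fin by simp
    fix y assume y: "y \<in> carrier G - {x}"
    then show "?i (?i y) = y" using xx reflect_reflect by blast
    have "?i y \<noteq> x"
    proof
      assume a: "?i y = x"
      have "?i (?i y) = y" using y xx reflect_reflect by blast
      then show False using a ix y by simp
    qed
    then show "?i y \<in> carrier G - {x}" using y xx by simp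
    show "?i y \<noteq> y" using fixed y by blast
    show "?F (?i y) = ?F y" using y xx reflect_reflect by (simp add: mult.commute)
  qed
  moreover have "group_conv G f f (x \<otimes> x) = f x * f x + sum ?F (carrier G - {x})"
    unfolding group_conv_def using x fin ix by (subst sum.remove[of _ x]) auto
  ultimately show ?thesis by simp
qed

lemma odd_card_subgroup:
  assumes sq: "\<And>x. x \<in> carrier G \<Longrightarrow> x \<otimes> x = \<one> \<Longrightarrow> x = \<one>" and K: "subgroup K G"
  shows "odd (card K)"
proof -
  have KG: "K \<subseteq> carrier G" using K by (rule subgroup.subset)
  have fK: "finite K" using KG fin by (rule finite_subset)
  have 1: "\<one> \<in> K" by (rule subgroup.one_closed[OF K])
  have "even (\<Sum>x\<in>K - {\<one>}. 1::int)"
  proof (rule even_sum_involution[where i = "\<lambda>x. inv x"])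
    fix x assume x: "x \<in> K - {\<one>}"
    then have xG: "x \<in> carrier G" using KG by blast
    show "inv x \<in> K - {\<one>}" using x xG subgroup.m_inv_closed[OF K] by auto
    show "inv (inv x) = x" using xG by simp
    show "inv x \<noteq> x"
    proof
      assume "inv x = x"
      then have "x \<otimes> x = \<one>" using r_inv[OF xG] by simp
      then show False using sq xG x by blast
    qed
  qed (use fK in auto)
  then have "even (card (K - {\<one>}))" by simp
  moreover have "card K = Suc (card (K - {\<one>}))" by (rule card.remove[OF fK 1])
  ultimately show ?thesis by simp
qed

text \<open>Squaring is the Frobenius modulo 2, so it is injective on the group ring of a group of odd
  order over the field with two elements: this permits halving \<open>f\<close> as long as \<open>s\<close> is even.  For odd
  \<open>s\<close> it gives \<open>f \<equiv> w\<close> modulo 2 for \<open>w = card K * 1 - K\<close>, and \<open>w * w = card K * w\<close>, which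
  contradicts the sign in the equation modulo 4.\<close>

lemma no_square_root_of_negative:
  fixes f :: "'a \<Rightarrow> int" and s :: nat
  assumes sq: "\<And>x. x \<in> carrier G \<Longrightarrow> x \<otimes> x = \<one> \<Longrightarrow> x = \<one>" and K: "subgroup K G"
    and "s > 0"
    and "\<And>g. g \<in> carrier G \<Longrightarrow> int (card K) * group_conv G f f g =
      - (int s)\<^sup>2 * ((if g = \<one> then int (card K) else 0) - indicator K g)"
  shows "K = {\<one>}"
  using assms(3,4)
proof (induction s arbitrary: f rule: less_induct)
  case (less s)
  let ?\<kappa> = "int (card K)"
  \<comment> \<open>Up to the factor \<open>card K\<close> this is the idempotent complementary to
    \<open>K / card K\<close>; the form \<open>(-1) * _\<close> suits
    \<open>conv_scale_left\<close>.\<close>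
  define w :: "'a \<Rightarrow> int" where "w g = (if g = \<one> then ?\<kappa> else 0) + (-1) * indicator K g" for g
  have eq: "?\<kappa> * group_conv G f f g = - (int s)\<^sup>2 * w g" if "g \<in> carrier G" for g
    using less.prems(2)[OF that] by (simp add: w_def)
  have odd\<kappa>: "odd ?\<kappa>" using odd_card_subgroup[OF sq K] by simp
  have KG: "K \<subseteq> carrier G" using K by (rule subgroup.subset)
  have sqr: "even (group_conv G f f (x \<otimes> x) - f x)" if "x \<in> carrier G" for x
    using square_root_mod_2[OF sq that] .
  show ?case
  proof (cases "even s")
    case True
    then obtain r where r: "s = 2 * r" by (rule evenE)
    \<comment> \<open>For even \<open>s\<close> all coefficients of \<open>f\<close> are even,
      because \<open>?\<kappa>\<close> is odd; so \<open>f / 2\<close> solves the equation for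
      \<open>s / 2\<close>.\<close>
    have "f x = 2 * (f x div 2)" if x: "x \<in> carrier G" for x
    proof -
      have "even (?\<kappa> * group_conv G f f (x \<otimes> x))" using eq[of "x \<otimes> x"] x True by simp
      then have "even (f x)" using odd\<kappa> sqr[OF x] by simp
      then show ?thesis by simp
    qed
    then have conv: "group_conv G f f g = 4 * group_conv G (\<lambda>x. f x div 2) (\<lambda>x. f x div 2) g"
      if "g \<in> carrier G" for g
      using conv_cong[of f "\<lambda>x. 2 * (f x div 2)" f "\<lambda>x. 2 * (f x div 2)" g] that
      unfolding conv_scale_left conv_scale_right by simp
    show ?thesis
    proof (rule less.IH[of r "\<lambda>x. f x div 2"])
      show "r < s" "r > 0" using r less.prems(1) by auto
      fix g assume g: "g \<in> carrier G"
      show "?\<kappa> * group_conv G (\<lambda>x. f x div 2) (\<lambda>x. f x div 2) g =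
        - (int r)\<^sup>2 * ((if g = \<one> then ?\<kappa> else 0) - indicator K g)"
        using less.prems(2)[OF g] unfolding conv[OF g] r by (simp add: power_mult_distrib)
    qed
  next
    case False
    \<comment> \<open>Squaring permutes \<open>K\<close>, so \<open>w\<close> is invariant under it
      and can be compared with \<open>f\<close> modulo 2.\<close>
    have wsq: "w (x \<otimes> x) = w x" if x: "x \<in> carrier G" for x
    proof -
      have inj: "y = z" if "y \<in> carrier G" "z \<in> carrier G" "y \<otimes> y = z \<otimes> z" for y z
        using square_inj[OF sq that] .
      have "(\<lambda>y. y \<otimes> y) ` K = K"
      proof (rule endo_inj_surj)
        show "finite K" using KG fin by (rule finite_subset)
        show "(\<lambda>y. y \<otimes> y) ` K \<subseteq> K" using subgroup.m_closed[OF K] by blast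
        show "inj_on (\<lambda>y. y \<otimes> y) K" using inj KG by (intro inj_onI) blast
      qed
      then have "x \<otimes> x \<in> K \<longleftrightarrow> x \<in> K" using inj[OF x] KG subgroup.m_closed[OF K] by blast
      moreover have "x \<otimes> x = \<one> \<longleftrightarrow> x = \<one>" using sq[OF x] by auto
      ultimately show ?thesis by (simp add: w_def indicator_def)
    qed
    define Y where "Y x = (f x - w x) div 2" for x
    have fwY: "f x = w x + 2 * Y x" if x: "x \<in> carrier G" for x
    proof -
      have "even (?\<kappa> * group_conv G f f (x \<otimes> x)) \<longleftrightarrow> even ((int s)\<^sup>2 * w (x \<otimes> x))"
        using eq[of "x \<otimes> x"] x by simp
      then have "even (group_conv G f f (x \<otimes> x)) \<longleftrightarrow> even (w x)"
        using odd\<kappa> False wsq[OF x] by simp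
      then have "even (f x - w x)" using sqr[OF x] by simp
      then show ?thesis by (simp add: Y_def)
    qed
    have ww: "group_conv G w w g = ?\<kappa> * w g" if g: "g \<in> carrier G" for g
    proof -
      have "group_conv G w w g =
        ?\<kappa> * w g + (-1) * group_conv G (indicator K) w g"
        unfolding w_def[abs_def] conv_add_left conv_scale_left conv_delta[OF g] by simp
      also have "group_conv G (indicator K) w g = group_conv G w (indicator K) g"
        by (rule conv_comm[OF g])
      also have "\<dots> = 0"
        unfolding w_def[abs_def] conv_add_left conv_scale_left conv_delta[OF g] conv_subgroup[OF K g]
        by simp
      finally show ?thesis by simp
    qed
    have "g = \<one>" if gK: "g \<in> K" for g
    proof (rule ccontr)
      assume g1: "g \<noteq> \<one>"
      have g: "g \<in> carrier G" using gK KG by blast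
      have "group_conv G f f g = group_conv G (\<lambda>x. w x + 2 * Y x) (\<lambda>x. w x + 2 * Y x) g"
        using fwY by (intro conv_cong[OF _ _ g]) auto
      also have "\<dots> = group_conv G w w g + 4 * (group_conv G w Y g + group_conv G Y Y g)"
        unfolding conv_add_left conv_add_right conv_scale_left conv_scale_right
        using conv_comm[OF g, of Y w] by simp
      finally have "?\<kappa> * (?\<kappa> * w g + 4 * (group_conv G w Y g + group_conv G Y Y g)) = - (int s)\<^sup>2 * w g"
        using eq[OF g] ww[OF g] by simp
      \<comment> \<open>At a nonidentity element of \<open>K\<close> the equation forces
        \<open>?\<kappa>^2 + s^2\<close> to be 0 modulo 4, but two odd squares add up to 2.\<close>
      moreover have "w g = -1" using gK g1 by (simp add: w_def)
      ultimately have "?\<kappa>\<^sup>2 + (int s)\<^sup>2 = 4 * (?\<kappa> * (group_conv G w Y g + group_conv G Y Y g))"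
        by (simp add: algebra_simps power2_eq_square)
      then have "4 dvd ?\<kappa>\<^sup>2 + (int s)\<^sup>2" by simp
      moreover have "odd (int s)" using False by simp
      then obtain a b where "?\<kappa> = 2 * a + 1" "int s = 2 * b + 1"
        using odd\<kappa> by (metis oddE)
      then have "?\<kappa>\<^sup>2 + (int s)\<^sup>2 = 4 * (a\<^sup>2 + a + b\<^sup>2 + b) + 2"
        by (simp add: power2_eq_square algebra_simps)
      ultimately show False by presburger
    qed
    then show ?thesis using subgroup.one_closed[OF K] by blast
  qed
qed

lemma push_conv:
  assumes G': "group G'" and \<phi>: "\<phi> \<in> hom G G'" and q: "q \<in> carrier G'" and fin': "finite (carrier G')"
  shows "group_conv G' (push G \<phi> f) (push G \<phi> h) q = push G \<phi> (group_conv G f h) q"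
proof -
  interpret G': group G' by fact
  interpret \<phi>: group_hom G G' \<phi> using \<phi> by unfold_locales
  let ?E = "\<lambda>q. {g \<in> carrier G. \<phi> g = q}"
  have "group_conv G' (push G \<phi> f) (push G \<phi> h) q =
      (\<Sum>r\<in>carrier G'. \<Sum>x\<in>?E r. f x * push G \<phi> h (inv\<^bsub>G'\<^esub> r \<otimes>\<^bsub>G'\<^esub> q))"
    by (simp add: group_conv_def push_def sum_distrib_right)
  also have "\<dots> = (\<Sum>r\<in>carrier G'. \<Sum>x\<in>?E r. f x * push G \<phi> h (inv\<^bsub>G'\<^esub> (\<phi> x) \<otimes>\<^bsub>G'\<^esub> q))"
    by (intro sum.cong refl) simp
  also have "\<dots> = (\<Sum>x\<in>carrier G. f x * push G \<phi> h (inv\<^bsub>G'\<^esub> (\<phi> x) \<otimes>\<^bsub>G'\<^esub> q))"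
    by (rule sum.group) (use fin fin' in auto)
  also have "\<dots> = (\<Sum>x\<in>carrier G. \<Sum>g\<in>?E q. f x * h (inv x \<otimes> g))"
  proof (rule sum.cong[OF refl])
    fix x assume x: "x \<in> carrier G"
    have "push G \<phi> h (inv\<^bsub>G'\<^esub> (\<phi> x) \<otimes>\<^bsub>G'\<^esub> q) = (\<Sum>g\<in>?E q. h (inv x \<otimes> g))"
      unfolding push_def
      by (rule sum.reindex_bij_witness[of _ "\<lambda>g. inv x \<otimes> g" "\<lambda>g. x \<otimes> g"])
        (use x q in \<open>auto simp: m_assoc[symmetric] G'.m_assoc[symmetric]\<close>)
    then show "f x * push G \<phi> h (inv\<^bsub>G'\<^esub> (\<phi> x) \<otimes>\<^bsub>G'\<^esub> q) = (\<Sum>g\<in>?E q. f x * h (inv x \<otimes> g))"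
      by (simp add: sum_distrib_left)
  qed
  also have "\<dots> = push G \<phi> (group_conv G f h) q"
    unfolding push_def group_conv_def by (rule sum.swap)
  finally show ?thesis .
qed

end

lemma nat_odd_part:
  assumes "(n::nat) \<noteq> 0"
  obtains b m where "n = 2 ^ b * m" "odd m"
  using multiplicity_decompose'[of n 2, OF assms] that by (metis not_prime_unit two_is_prime_nat)

text \<open>By Sylow's theorem with exponent 1, an odd prime factor of the order would give a
  nonidentity element whose order divides both this prime and \<open>2 ^ b\<close>.\<close>

lemma (in group) card_power_of_2:
  assumes fin: "finite (carrier G)" and el: "\<And>x. x \<in> carrier G \<Longrightarrow> x [^] (2 ^ b :: nat) = \<one>"
  shows "\<exists>e. card (carrier G) = 2 ^ e"
proof -
  have "card (carrier G) \<noteq> 0" using fin by auto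
  then obtain e m where m: "card (carrier G) = 2 ^ e * m" "odd m"
    by (rule nat_odd_part)
  have "m = 1"
  proof (rule ccontr)
    assume "m \<noteq> 1"
    then obtain p where p: "prime p" "p dvd m" using prime_factor_nat by blast
    then obtain r where "m = p * r" by (auto elim: dvdE)
    then have "Coset.order G = p ^ 1 * (2 ^ e * r)" using m by (simp add: Coset.order_def ac_simps)
    then obtain P where P: "subgroup P G" "card P = p"
      using sylow_thm[OF p(1) group_axioms _ fin, of 1] by auto
    have "P \<noteq> {\<one>}" using P(2) p(1) by auto
    then obtain x where x: "x \<in> P" "x \<noteq> \<one>" using subgroup.one_closed[OF P(1)] by blast
    have xG: "x \<in> carrier G" using x(1) subgroup.subset[OF P(1)] by blast
    interpret P: group "G\<lparr>carrier := P\<rparr>" by (rule subgroup_imp_group[OF P(1)])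
    have "x [^]\<^bsub>G\<lparr>carrier := P\<rparr>\<^esub> card P = \<one>"
      using P.pow_order_eq_1[of x] x(1) by (simp add: Coset.order_def)
    then have "x [^] p = \<one>" using P(2) nat_pow_consistent[of x p P] by simp
    then have "ord x dvd p" "ord x dvd 2 ^ b" using pow_eq_id[OF xG] el[OF xG] by auto
    moreover have "coprime p (2 ^ b)"
      using p m(2) by (metis coprime_power_right_iff dvd_trans prime_imp_coprime_nat
          primes_coprime two_is_prime_nat)
    ultimately have "ord x = 1" by (meson coprime_common_divisor_nat)
    then show False using x(2) xG by (metis ord_eq_1)
  qed
  then show ?thesis using m by auto
qed

context finite_abelian_group
begin

text \<open>The equality case of the triangle inequality: every real part is at most 1, hence equal
  to 1, and on the unit circle this determines the value.\<close>

lemma sum_char_subgroup_eq_card: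
  assumes H: "H \<subseteq> carrier G" and X: "X \<in> chars" and s: "(\<Sum>h\<in>H. X h) = of_nat (card H)" and h: "h \<in> H"
  shows "X h = 1"
proof -
  have fH: "finite H" using H fin by (rule finite_subset)
  have le: "0 \<le> 1 - Re (X x)" if "x \<in> H" for x
    using norm_char[OF X, of x] complex_Re_le_cmod[of "X x"] that H by auto
  have "(\<Sum>x\<in>H. 1 - Re (X x)) = 0"
    using arg_cong[OF s, of Re] by (simp add: sum_subtractf)
  then have "1 - Re (X h) = 0" using sum_nonneg_eq_0_iff[OF fH, of "\<lambda>x. 1 - Re (X x)"] le h by simp
  moreover have "(Re (X h))\<^sup>2 + (Im (X h))\<^sup>2 = 1"
    using norm_char[OF X, of h] h H by (auto simp: cmod_def)
  ultimately show ?thesis by (simp add: complex_eq_iff)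
qed

lemma ring_elem_inv:
  assumes "D \<subseteq> carrier G" "g \<in> carrier G"
  shows "ring_elem (set_inv D) g = ring_elem D (inv g)"
  using set_inv_iff[OF assms] by (simp add: ring_elem_def indicator_def)

lemma fourier_ring_elem:
  assumes "A \<subseteq> carrier G"
  shows "fourier (\<lambda>g. of_int (ring_elem A g)) X = char_sum X A"
  unfolding fourier_indicator[OF assms, symmetric]
  by (intro fourier_cong) (simp add: ring_elem_def indicator_def)

lemma char_sum_triv: "A \<subseteq> carrier G \<Longrightarrow> char_sum triv A = of_nat (card A)"
  by (simp add: char_sum_def subset_iff)

lemma char_sum_carrier:
  "X \<in> chars \<Longrightarrow> char_sum X (carrier G) = (if X = triv then of_nat (card (carrier G)) else 0)"
  by (simp add: char_sum_def sum_char)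

lemma int_fourier_inj:
  fixes f h :: "'a \<Rightarrow> int"
  assumes "\<And>X. X \<in> chars \<Longrightarrow> fourier (\<lambda>g. of_int (f g)) X = fourier (\<lambda>g. of_int (h g)) X"
    and "g \<in> carrier G"
  shows "f g = h g"
  using fourier_inj[of "\<lambda>g. of_int (f g)" "\<lambda>g. of_int (h g)", OF assms] by simp

lemma fourier_of_int_conv:
  "X \<in> chars \<Longrightarrow> fourier (\<lambda>g. of_int (group_conv G f h g)) X =
     fourier (\<lambda>g. of_int (f g)) X * fourier (\<lambda>g. of_int (h g)) X"
  by (simp add: of_int_group_conv fourier_conv)

text \<open>Pushing the equation for \<open>E\<close> forward along the projection \<open>g \<mapsto> g ^ 2 ^ b\<close> onto the part of
  odd order leads to the situation of \<open>no_square_root_of_negative\<close>.\<close>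

lemma subgroup_2_power:
  fixes E :: "'a \<Rightarrow> int"
  assumes H: "subgroup H G" and s: "card H = 2 * s"
    and conv: "\<And>g. g \<in> carrier G \<Longrightarrow>
      group_conv G E E g = - 4 * (int s)\<^sup>2 * (if g = \<one> then 1 else 0) + 2 * int s * indicator H g"
  shows "\<exists>e. card H = 2 ^ e"
proof -
  have HG: "H \<subseteq> carrier G" using H by (rule subgroup.subset)
  have fH: "finite H" using HG fin by (rule finite_subset)
  have sp: "s > 0" using s fH subgroup.one_closed[OF H] by (metis card_eq_0_iff empty_iff mult_0_right neq0_conv)
  obtain b m where m: "card (carrier G) = 2 ^ b * m" "odd m"
    using card_pos nat_odd_part[of "card (carrier G)"] by auto
  \<comment> \<open>The elements of odd order; the power map \<open>\<phi>\<close> below projects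
    onto this part of \<open>G\<close>.\<close>
  define Q where "Q = {g \<in> carrier G. g [^] m = \<one>}"
  have Q: "subgroup Q G"
    by (rule subgroupI) (auto simp: Q_def pow_mult_distrib m_comm nat_pow_inv)
  define G' where "G' = G\<lparr>carrier := Q\<rparr>"
  have G'c: "carrier G' = Q" and G'1: "\<one>\<^bsub>G'\<^esub> = \<one>" and G'm: "x \<otimes>\<^bsub>G'\<^esub> y = x \<otimes> y" for x y
    by (simp_all add: G'_def)
  interpret G': group G' unfolding G'_def by (rule subgroup_imp_group[OF Q])
  interpret G': finite_abelian_group G'
  proof
    show "finite (carrier G')" unfolding G'c Q_def using fin by simp
    fix x y assume "x \<in> carrier G'" "y \<in> carrier G'"
    then show "x \<otimes>\<^bsub>G'\<^esub> y = y \<otimes>\<^bsub>G'\<^esub> x" unfolding G'c G'm Q_def by (simp add: m_comm)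
  qed
  define \<phi> where "\<phi> g = g [^] (2 ^ b :: nat)" for g
  have \<phi>Q: "\<phi> g \<in> Q" if "g \<in> carrier G" for g
    using that pow_order_eq_1[OF that] m by (simp add: Q_def \<phi>_def nat_pow_pow Coset.order_def)
  have \<phi>m: "\<phi> (x \<otimes> y) = \<phi> x \<otimes> \<phi> y" if "x \<in> carrier G" "y \<in> carrier G" for x y
    using that by (simp add: \<phi>_def pow_mult_distrib m_comm)
  have hom: "\<phi> \<in> hom G G'"
    unfolding hom_def G'c G'm using \<phi>Q \<phi>m by auto
  interpret \<phi>: group_hom G G' \<phi> using hom by unfold_locales
  have sq: "x = \<one>\<^bsub>G'\<^esub>" if x: "x \<in> carrier G'" "x \<otimes>\<^bsub>G'\<^esub> x = \<one>\<^bsub>G'\<^esub>" for x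
  proof -
    have xG: "x \<in> carrier G" and xm: "x [^] m = \<one>" and xx: "x \<otimes> x = \<one>"
      using x unfolding G'c G'1 G'm Q_def by auto
    obtain r where r: "m = 2 * r + 1" using m(2) by (rule oddE)
    have "x [^] (2::nat) = \<one>" using xx xG by (simp add: numeral_2_eq_2)
    then have "x [^] (2 * r) = \<one>" using xG by (simp add: nat_pow_pow[symmetric])
    then have "x [^] m = x" using xG r by simp
    then show ?thesis using xm unfolding G'1 by simp
  qed
  define K where "K = \<phi> ` H"
  have K: "subgroup K G'" unfolding K_def by (rule \<phi>.subgroup_img_is_subgroup[OF H])
  define N where "N = {h \<in> H. \<phi> h = \<one>}"
  \<comment> \<open>Fibres of \<open>\<phi>\<close> over \<open>K\<close> meet \<open>H\<close> in
    cosets of \<open>N\<close>, the kernel of \<open>\<phi>\<close> on \<open>H\<close>.\<close>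
  have pushH: "(\<Sum>g\<in>{g \<in> carrier G. \<phi> g = q}. indicator H g) = int (card N) * indicator K q"
    for q
  proof (cases "q \<in> K")
    case True
    then obtain h where h: "h \<in> H" "\<phi> h = q" unfolding K_def by blast
    have hG: "h \<in> carrier G" using h HG by blast
    have "(\<Sum>g\<in>{g \<in> carrier G. \<phi> g = q}. indicator H g) = int (card {g \<in> H. \<phi> g = q})"
    proof -
      have "{g \<in> carrier G. \<phi> g = q} \<inter> H = {g \<in> H. \<phi> g = q}" using HG by blast
      then show ?thesis using fin by (simp add: indicator_def sum.inter_restrict[symmetric] if_distrib cong: if_cong)
    qed
    also have "card {g \<in> H. \<phi> g = q} = card N"
    proof (rule bij_betw_same_card[symmetric], rule bij_betw_byWitness[where f' = "\<lambda>g. inv h \<otimes> g"])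
      show "\<forall>n\<in>N. inv h \<otimes> (h \<otimes> n) = n"
        using hG HG unfolding N_def by (auto simp: m_assoc[symmetric] subset_iff)
      show "\<forall>g\<in>{g \<in> H. \<phi> g = q}. h \<otimes> (inv h \<otimes> g) = g"
        using hG HG by (auto simp: m_assoc[symmetric] subset_iff)
      show "(\<otimes>) h ` N \<subseteq> {g \<in> H. \<phi> g = q}"
      proof
        fix y assume "y \<in> (\<otimes>) h ` N"
        then obtain n where n: "n \<in> H" "\<phi> n = \<one>" "y = h \<otimes> n" unfolding N_def by blast
        have "\<phi> y = \<phi> h \<otimes> \<phi> n" unfolding n(3) using n(1) hG HG by (intro \<phi>m) auto
        moreover have "q \<in> carrier G" using h(2) \<phi>Q[OF hG] by (simp add: Q_def)
        ultimately show "y \<in> {g \<in> H. \<phi> g = q}"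
          using n h subgroup.m_closed[OF H] by simp
      qed
      show "(\<lambda>g. inv h \<otimes> g) ` {g \<in> H. \<phi> g = q} \<subseteq> N"
      proof
        fix y assume "y \<in> (\<lambda>g. inv h \<otimes> g) ` {g \<in> H. \<phi> g = q}"
        then obtain g where g: "g \<in> H" "\<phi> g = q" "y = inv h \<otimes> g" by blast
        have yH: "y \<in> H" unfolding g(3) using g(1) h(1) subgroup.m_closed[OF H] subgroup.m_inv_closed[OF H] by blast
        have gG: "g \<in> carrier G" using g(1) HG by blast
        have "\<phi> y = inv\<^bsub>G'\<^esub> (\<phi> h) \<otimes>\<^bsub>G'\<^esub> \<phi> g" unfolding g(3) using hG gG by simp
        also have "\<dots> = \<one>" unfolding h(2) g(2) using \<phi>Q[OF gG] g(2) G'.l_inv[of q] G'c G'1 by simp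
        finally show "y \<in> N" using yH by (simp add: N_def)
      qed
    qed
    finally show ?thesis using True by simp
  next
    case False
    then have "\<And>g. g \<in> {g \<in> carrier G. \<phi> g = q} \<Longrightarrow> indicator H g = (0::int)"
      unfolding K_def by (auto simp: indicator_def)
    then show ?thesis using False by simp
  qed
  have card: "int (card K) * int (card N) = 2 * int s"
  proof -
    have "int (card H) = (\<Sum>g\<in>carrier G. indicator H g)"
    proof -
      have "carrier G \<inter> H = H" using HG by blast
      then show ?thesis using fin by (simp add: indicator_def sum.inter_restrict[symmetric] if_distrib cong: if_cong)
    qed
    also have "\<dots> = (\<Sum>q\<in>carrier G'. \<Sum>g\<in>{g \<in> carrier G. \<phi> g = q}. indicator H g)"
      by (rule sum.group[symmetric]) (use fin G'.fin \<phi>Q G'c in auto)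
    also have "\<dots> = (\<Sum>q\<in>carrier G'. int (card N) * indicator K q)"
      unfolding pushH ..
    also have "\<dots> = int (card N) * int (card K)"
    proof -
      have "carrier G' \<inter> K = K" using subgroup.subset[OF K] by blast
      then show ?thesis using G'.fin
        by (simp add: sum_distrib_left[symmetric] indicator_def sum.inter_restrict[symmetric] if_distrib cong: if_cong)
    qed
    finally show ?thesis using s by simp
  qed
  \<comment> \<open>As \<open>card K * card N = 2s\<close>, multiplying the pushed equation by
    \<open>card K\<close> turns \<open>2s * card N\<close> into \<open>(2s)^2\<close>; this is the
    equation of the lemma with \<open>2 * s\<close> in place of \<open>s\<close>.\<close>
  have "K = {\<one>\<^bsub>G'\<^esub>}"
  proof (rule G'.no_square_root_of_negative[OF sq K, where f = "push G \<phi> E" and s = "2 * s"])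
    show "0 < 2 * s" using sp by simp
    fix q assume q: "q \<in> carrier G'"
    have "group_conv G' (push G \<phi> E) (push G \<phi> E) q = push G \<phi> (group_conv G E E) q"
      by (rule push_conv[OF G'.group_axioms hom q G'.fin])
    also have "\<dots> = (\<Sum>g\<in>{g \<in> carrier G. \<phi> g = q}.
        - 4 * (int s)\<^sup>2 * (if g = \<one> then 1 else 0) + 2 * int s * indicator H g)"
      unfolding push_def by (intro sum.cong refl) (simp add: conv)
    also have "\<dots> = - 4 * (int s)\<^sup>2 * (\<Sum>g\<in>{g \<in> carrier G. \<phi> g = q}. if g = \<one> then 1 else 0)
        + 2 * int s * (\<Sum>g\<in>{g \<in> carrier G. \<phi> g = q}. indicator H g)"
      by (simp only: sum.distrib sum_distrib_left)
    also have "(\<Sum>g\<in>{g \<in> carrier G. \<phi> g = q}. if g = \<one> then 1 else 0) = (if q = \<one>\<^bsub>G'\<^esub> then 1 else 0 :: int)"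
      using fin \<phi>.hom_one by auto
    finally have c: "group_conv G' (push G \<phi> E) (push G \<phi> E) q =
      - 4 * (int s)\<^sup>2 * (if q = \<one>\<^bsub>G'\<^esub> then 1 else 0) + 2 * int s * (int (card N) * indicator K q)"
      unfolding pushH .
    have "int (card K) * group_conv G' (push G \<phi> E) (push G \<phi> E) q =
      - 4 * (int s)\<^sup>2 * (if q = \<one>\<^bsub>G'\<^esub> then int (card K) else 0) +
      2 * int s * ((int (card K) * int (card N)) * indicator K q)"
      unfolding c by (simp add: algebra_simps)
    then show "int (card K) * group_conv G' (push G \<phi> E) (push G \<phi> E) q =
      - (int (2 * s))\<^sup>2 * ((if q = \<one>\<^bsub>G'\<^esub> then int (card K) else 0) - indicator K q)"
      unfolding card by (simp add: power2_eq_square algebra_simps)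
  qed
  then have one: "h [^] (2 ^ b :: nat) = \<one>" if "h \<in> H" for h
    using that unfolding K_def G'1 \<phi>_def by auto
  interpret H: group "G\<lparr>carrier := H\<rparr>" by (rule subgroup_imp_group[OF H])
  have "\<exists>e. card (carrier (G\<lparr>carrier := H\<rparr>)) = 2 ^ e"
  proof (rule H.card_power_of_2)
    show "finite (carrier (G\<lparr>carrier := H\<rparr>))" using fH by simp
    fix x assume "x \<in> carrier (G\<lparr>carrier := H\<rparr>)"
    then show "x [^]\<^bsub>G\<lparr>carrier := H\<rparr>\<^esub> (2 ^ b :: nat) = \<one>\<^bsub>G\<lparr>carrier := H\<rparr>\<^esub>"
      using one nat_pow_consistent[of x "2 ^ b" H] by simp
  qed
  then show ?thesis by simp
qed

end

section \<open>Difference sets with three character values\<close>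

text \<open>\<open>s\<close> is real here; that it is an integer is derived separately in
  \<open>hadamard_plus\<close>, \<open>hadamard_minus_impossible\<close> and
  \<open>s_nat_and_Re_rational\<close>.\<close>

locale three_valued_difference_set = finite_abelian_group +
  fixes D :: "'a set" and v k l :: nat and a :: complex and s :: real
  assumes D: "difference_set G D v k l"
    and l_pos: "l > 0"
    and s_def: "s = sqrt (real k - real l)"
    and char_values: "(\<lambda>X. char_sum X D) ` (chars - {triv}) = {complex_of_real s, a, cnj a}"
    and distinct_values: "distinct [complex_of_real s, a, cnj a]"
begin

definition M :: "('a \<Rightarrow> complex) set" where
  "M = {triv} \<union> {X \<in> chars. char_sum X D = complex_of_real s}"

definition F :: "'a \<Rightarrow> int" where
  "F g = ring_elem D g + ring_elem (set_inv D) g"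

text \<open>The coefficients of \<open>F\<close> depend on the set \<open>M\<close> only through
  these sums, see \<open>F_formula\<close>.\<close>

definition m :: "'a \<Rightarrow> complex" where
  "m g = (\<Sum>X\<in>M. X g)"

lemma DG: "D \<subseteq> carrier G" and card_D: "card D = k" and card_G: "card (carrier G) = v"
  using D by (auto simp: difference_set_def)

lemma v_pos: "v > 0"
  using card_pos card_G by simp

lemma char_cases:
  assumes "X \<in> chars" "X \<noteq> triv"
  obtains "char_sum X D = complex_of_real s" | "char_sum X D = a" | "char_sum X D = cnj a"
  using assms char_values by blast

lemma value_attained:
  assumes "z \<in> {complex_of_real s, a, cnj a}"
  obtains X where "X \<in> chars" "X \<noteq> triv" "char_sum X D = z"
  using assms unfolding char_values[symmetric] by blast

lemma values_distinct: "complex_of_real s \<noteq> a" "complex_of_real s \<noteq> cnj a" "a \<noteq> cnj a"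
  using distinct_values by auto

lemma norm_a: "a * cnj a = of_nat k - of_nat l"
proof -
  obtain X where "X \<in> chars" "X \<noteq> triv" "char_sum X D = a" using value_attained by blast
  then show ?thesis using char_sum_difference_set[OF D] by fastforce
qed

lemma s_sq: "s\<^sup>2 = real k - real l" and s_pos: "s > 0"
proof -
  have "complex_of_real ((norm a)\<^sup>2) = of_real (real k - real l)"
    by (simp only: complex_norm_square norm_a) simp
  then have "(norm a)\<^sup>2 = real k - real l" using of_real_eq_iff by blast
  moreover have "a \<noteq> 0" using values_distinct(3) by auto
  ultimately have "real k - real l > 0" by (metis zero_less_norm_iff zero_less_power)
  then show "s\<^sup>2 = real k - real l" "s > 0" by (auto simp: s_def)
qed

lemma norm_a_sq: "(Re a)\<^sup>2 + (Im a)\<^sup>2 = s\<^sup>2"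
proof -
  have "complex_of_real ((Re a)\<^sup>2 + (Im a)\<^sup>2) = of_real (s\<^sup>2)"
    unfolding complex_mult_cnj[symmetric] norm_a s_sq by simp
  then show ?thesis using of_real_eq_iff by blast
qed

lemma Im_a: "Im a \<noteq> 0"
  using values_distinct(3) by (auto simp: complex_eq_iff)

lemma Re_a_less: "\<bar>Re a\<bar> < s"
proof -
  have "(Re a)\<^sup>2 < s\<^sup>2" using norm_a_sq Im_a by (simp add: norm_a_sq[symmetric])
  then show ?thesis using s_pos by (metis abs_of_pos power2_less_imp_less less_imp_le power2_abs)
qed

lemma k_sq: "(real k)\<^sup>2 = s\<^sup>2 + real l * real v"
proof -
  have "complex_of_real ((real k)\<^sup>2) = of_real (s\<^sup>2 + real l * real v)"
    unfolding s_sq using char_sum_difference_set[OF D triv_in_chars]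
    by (simp add: char_sum_triv[OF DG] card_D power2_eq_square)
  then show ?thesis using of_real_eq_iff by blast
qed

lemma s_less_k: "s < real k"
proof -
  have "s\<^sup>2 < (real k)\<^sup>2" using k_sq l_pos v_pos by simp
  then show ?thesis by (rule power2_less_imp_less) simp
qed

lemma k_less_v: "k < v"
proof -
  have "k \<le> v" using DG card_D card_G fin card_mono by blast
  moreover have "k \<noteq> v"
  proof
    assume "k = v"
    then have "real v * (real v - real l) = s\<^sup>2" using k_sq by (simp add: power2_eq_square algebra_simps)
    then have "real v * s\<^sup>2 = s\<^sup>2" unfolding s_sq \<open>k = v\<close> .
    then have "v = 1" using s_pos by simp
    moreover have "real k - real l > 0" unfolding s_sq[symmetric] using s_pos by simp
    ultimately show False using \<open>k = v\<close> l_pos by simp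
  qed
  ultimately show ?thesis by simp
qed

lemma M_subset: "M \<subseteq> chars" and triv_in_M: "triv \<in> M"
  by (auto simp: M_def)

lemma finite_M: "finite M"
  using M_subset finite_chars by (rule finite_subset)

lemma card_M_ge: "card M \<ge> 2"
proof -
  obtain X where "X \<in> chars" "X \<noteq> triv" "char_sum X D = of_real s" using value_attained by blast
  then have "{triv, X} \<subseteq> M" "card {triv, X} = 2" by (auto simp: M_def)
  then show ?thesis using card_mono[OF finite_M] by metis
qed

lemma in_M_iff: "X \<in> chars \<Longrightarrow> X \<noteq> triv \<Longrightarrow> X \<in> M \<longleftrightarrow> char_sum X D = of_real s"
  by (auto simp: M_def)

text \<open>The principal character and one character for each of the three values are distinct, and
  the one with value \<open>a\<close> lies outside \<open>M\<close>.\<close>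

lemma card_M_less: "card M < v" and v_ge_4: "v \<ge> 4"
proof -
  obtain X where X: "X \<in> chars" "X \<noteq> triv" "char_sum X D = a" using value_attained by blast
  obtain Y where Y: "Y \<in> chars" "Y \<noteq> triv" "char_sum Y D = cnj a" using value_attained by blast
  obtain Z where Z: "Z \<in> chars" "Z \<noteq> triv" "char_sum Z D = of_real s" using value_attained by blast
  have "X \<notin> M" using X in_M_iff values_distinct by auto
  then have "M \<subset> chars" using M_subset X(1) by blast
  then show "card M < v" using psubset_card_mono[OF finite_chars] card_chars card_G by simp
  have "X \<noteq> Y" "Y \<noteq> Z" "X \<noteq> Z" using X Y Z values_distinct by auto
  then have "card {triv, X, Y, Z} = 4" using X(2) Y(2) Z(2) by auto
  moreover have "{triv, X, Y, Z} \<subseteq> chars" using X Y Z by auto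
  ultimately show "v \<ge> 4" using card_mono[OF finite_chars] card_chars card_G by metis
qed

lemma F_cases: "F g \<in> {0, 1, 2}"
  by (auto simp: F_def ring_elem_def indicator_def)

lemma F_inv: "g \<in> carrier G \<Longrightarrow> F (inv g) = F g"
  using ring_elem_inv[OF DG, of g] ring_elem_inv[OF DG, of "inv g"] by (simp add: F_def)

lemma F_eq: "g \<in> carrier G \<Longrightarrow> F g = ring_elem D g + ring_elem D (inv g)"
  using ring_elem_inv[OF DG] by (simp add: F_def)

text \<open>A self-inverse element lies in both or in neither of \<open>D\<close> and its set of
  inverses.\<close>

lemma F_involution:
  assumes "g \<in> carrier G" "g \<otimes> g = \<one>"
  shows "F g \<in> {0, 2}"
proof -
  have "inv g = g" using assms by (metis inv_equality)
  then show ?thesis using F_eq[OF assms(1)] by (auto simp: ring_elem_def indicator_def)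
qed

lemma fourier_F:
  assumes X: "X \<in> chars"
  shows "fourier (\<lambda>g. of_int (F g)) X =
    (if X = triv then 2 * of_nat k else if X \<in> M then 2 * of_real s else of_real (2 * Re a))"
proof -
  have "fourier (\<lambda>g. of_int (F g)) X = char_sum X D + cnj (char_sum X D)"
    unfolding F_def of_int_add fourier_add fourier_ring_elem[OF DG]
      fourier_ring_elem[OF set_inv_subset[OF DG]] char_sum_set_inv[OF DG X] ..
  also have "\<dots> = (if X = triv then 2 * of_nat k else if X \<in> M then 2 * of_real s else of_real (2 * Re a))"
  proof (cases "X = triv")
    case True
    then show ?thesis by (simp add: char_sum_triv[OF DG] card_D)
  next
    case False
    show ?thesis
      by (rule char_cases[OF X False])
        (use False in_M_iff[OF X False] values_distinct in \<open>auto simp: complex_eq_iff\<close>)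
  qed
  finally show ?thesis .
qed

text \<open>Fourier inversion, with the transform of \<open>F\<close> split into the constant
  \<open>2 * Re a\<close>, the excess over it on \<open>M\<close>, and the further excess
  \<open>2k - 2s\<close> at the principal character. The symmetry of \<open>F\<close> removes the
  conjugate.\<close>

lemma F_formula:
  assumes g: "g \<in> carrier G"
  shows "of_nat v * of_int (F g) = 2 * of_nat k - 2 * of_real s + (2 * of_real s - of_real (2 * Re a)) * m g
    + (if g = \<one> then of_nat v * of_real (2 * Re a) else 0)"
proof -
  let ?t = "complex_of_real (2 * Re a)"
  have "of_nat v * of_int (F g) = (\<Sum>X\<in>chars. fourier (\<lambda>g. of_int (F g)) X * cnj (X (inv g)))"
    using fourier_inversion[of "inv g" "\<lambda>g. of_int (F g)"] g F_inv[OF g] card_G by simp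
  also have "\<dots> = (\<Sum>X\<in>chars. fourier (\<lambda>g. of_int (F g)) X * X g)"
    using g by (intro sum.cong refl) (simp add: char_inv)
  also have "\<dots> = (\<Sum>X\<in>chars. (if X = triv then (2 * of_nat k - 2 * of_real s) * X g else 0)
      + (if X \<in> M then (2 * of_real s - ?t) * X g else 0) + ?t * X g)"
    using triv_in_M by (intro sum.cong refl) (auto simp: fourier_F algebra_simps)
  also have "\<dots> = (2 * of_nat k - 2 * of_real s) + (2 * of_real s - ?t) * m g + ?t * (\<Sum>X\<in>chars. X g)"
  proof -
    have "chars \<inter> M = M" using M_subset by blast
    then show ?thesis using finite_chars g
      by (simp add: sum.distrib sum_distrib_left m_def sum.inter_restrict[symmetric])
  qed
  finally show ?thesis using sum_chars[OF g] card_G by (simp add: mult.commute)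
qed

lemma m_one: "m \<one> = of_nat (card M)"
  using M_subset by (simp add: m_def subset_iff)

theorem hadamard_plus:
  assumes v: "real v = 4 * s\<^sup>2" and k: "real k = 2 * s\<^sup>2 + s" and Re0: "Re a = 0"
  shows "(\<exists>m::nat.
            real v = 2 powi (2 * int m) \<and>
            real k = 2 powi (2 * int m - 1) + 2 powi (int m - 1) \<and>
            real l = 2 powi (2 * int m - 2) + 2 powi (int m - 1))
         \<and> finite_p_group 2 G
         \<and> (\<exists>H. subgroup H G
              \<and> (\<lambda>g. ring_elem D g + ring_elem (set_inv D) g - ring_elem (carrier G) g)
                  = ring_elem H
              \<and> char_perp G H = M)"
proof -
  obtain r :: nat where r: "s = real r"
  proof -
    have "s = of_int (int k - 2 * (int k - int l))" using k s_sq by simp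
    moreover from this have "int k - 2 * (int k - int l) \<ge> 0" using s_pos by linarith
    ultimately show ?thesis using that[of "nat (int k - 2 * (int k - int l))"] by simp
  qed
  have r_pos: "r > 0" using r s_pos by simp
  have vr: "v = 4 * r\<^sup>2" and kr: "k = 2 * r\<^sup>2 + r"
  proof -
    have "real v = real (4 * r\<^sup>2)" "real k = real (2 * r\<^sup>2 + r)" using v k r by simp_all
    then show "v = 4 * r\<^sup>2" "k = 2 * r\<^sup>2 + r" by (simp_all only: of_nat_eq_iff)
  qed
  define B where "B g = F g - ring_elem (carrier G) g" for g
  have B_F: "B g = F g - 1" if "g \<in> carrier G" for g using that by (simp add: B_def ring_elem_def)
  have fB: "fourier (\<lambda>g. of_int (B g)) X = (if X \<in> M then of_nat (2 * r) else 0)" if X: "X \<in> chars" for X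
  proof -
    have "fourier (\<lambda>g. of_int (B g)) X = fourier (\<lambda>g. of_int (F g)) X - (if X = triv then of_nat v else 0)"
      unfolding B_def of_int_diff fourier_diff fourier_ring_elem[OF subset_refl]
      using X by (simp add: char_sum_carrier card_G)
    then show ?thesis using X triv_in_M by (simp add: fourier_F Re0 vr kr r)
  qed
  have BB: "group_conv G B B g = 2 * int r * B g" if g: "g \<in> carrier G" for g
  proof (rule int_fourier_inj[OF _ g])
    fix X assume X: "X \<in> chars"
    have "fourier (\<lambda>g. of_int (2 * int r * B g)) X = of_nat (2 * r) * fourier (\<lambda>g. of_int (B g)) X"
      using fourier_scale[of "of_nat (2 * r)" "\<lambda>g. of_int (B g)" X] by simp
    then show "fourier (\<lambda>g. of_int (group_conv G B B g)) X = fourier (\<lambda>g. of_int (2 * int r * B g)) X"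
      unfolding fourier_of_int_conv[OF X] using fB[OF X] by simp
  qed
  have sumB: "(\<Sum>g\<in>carrier G. B g) = 2 * int r"
  proof -
    have "complex_of_int (\<Sum>g\<in>carrier G. B g) = of_int (2 * int r)"
      using fB[OF triv_in_chars] triv_in_M by (simp add: fourier_def)
    then show ?thesis using of_int_eq_iff by blast
  qed
  have B_inv: "B (inv g) = B g" if "g \<in> carrier G" for g using that F_inv by (simp add: B_F)
  have B_cases: "B g \<in> {-1, 0, 1}" if "g \<in> carrier G" for g using F_cases[of g] B_F[OF that] by auto
  have B1_cases: "B \<one> \<in> {-1, 1}" using F_involution[of \<one>] B_F[of \<one>] by auto
  \<comment> \<open>The coefficient of \<open>B * B\<close> at the identity is a sum of squares
    because \<open>B\<close> is symmetric. Its sign excludes \<open>B \<one> = -1\<close>.\<close>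
  have sumB2: "(\<Sum>g\<in>carrier G. (B g)\<^sup>2) = 2 * int r * B \<one>"
    using BB[of \<one>] unfolding group_conv_def by (simp add: B_inv power2_eq_square)
  have B1: "B \<one> = 1"
  proof (rule ccontr)
    assume "B \<one> \<noteq> 1"
    then have "B \<one> = -1" using B1_cases by simp
    then have "(\<Sum>g\<in>carrier G. (B g)\<^sup>2) < 0" using sumB2 r_pos by simp
    moreover have "(\<Sum>g\<in>carrier G. (B g)\<^sup>2) \<ge> 0" by (intro sum_nonneg) simp
    ultimately show False by simp
  qed
  have B01: "B g \<in> {0, 1}" if g: "g \<in> carrier G" for g
  proof -
    have "(\<Sum>g\<in>carrier G. (B g)\<^sup>2 - B g) = 0" using sumB sumB2 B1 by (simp add: sum_subtractf)
    moreover have "(B x)\<^sup>2 - B x \<ge> 0" if "x \<in> carrier G" for x using B_cases[OF that] by auto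
    ultimately have "(B g)\<^sup>2 - B g = 0" using sum_nonneg_eq_0_iff[OF fin, of "\<lambda>g. (B g)\<^sup>2 - B g"] g by simp
    then show ?thesis using B_cases[OF g] by auto
  qed
  define H where "H = {g \<in> carrier G. B g = 1}"
  have HG: "H \<subseteq> carrier G" by (auto simp: H_def)
  have fH: "finite H" using HG fin by (rule finite_subset)
  have BH: "B g = ring_elem H g" for g
  proof (cases "g \<in> carrier G")
    case True
    then show ?thesis using B01[OF True] by (auto simp: H_def ring_elem_def indicator_def)
  next
    case False
    moreover have "g \<notin> D" "g \<notin> set_inv D" using False DG set_inv_subset[OF DG] by auto
    ultimately show ?thesis using HG by (auto simp: B_def F_def ring_elem_def indicator_def)
  qed
  have cardH: "card H = 2 * r"
  proof -
    have "complex_of_nat (card H) = of_nat (2 * r)"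
      using fB[OF triv_in_chars] triv_in_M unfolding BH fourier_ring_elem[OF HG] char_sum_triv[OF HG] by simp
    then show ?thesis using of_nat_eq_iff by blast
  qed
  \<comment> \<open>For \<open>g\<close> in \<open>H\<close> the coefficient of \<open>B * B\<close>
    at \<open>g\<close> equals the full sum of \<open>B\<close>, so no term may be lost:
    \<open>B (inv y \<otimes> g) = 1\<close> whenever \<open>B y = 1\<close>.\<close>
  have div: "inv x \<otimes> g \<in> H" if x: "x \<in> H" and g: "g \<in> H" for x g
  proof -
    have gG: "g \<in> carrier G" and xG: "x \<in> carrier G" using g x HG by auto
    have "(\<Sum>y\<in>carrier G. B y - B y * B (inv y \<otimes> g)) = 0"
      using BB[OF gG] sumB g unfolding group_conv_def by (simp add: sum_subtractf H_def)
    moreover have "B y - B y * B (inv y \<otimes> g) \<ge> 0" if "y \<in> carrier G" for y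
      using B01[OF that] B01[of "inv y \<otimes> g"] that gG by auto
    ultimately have "B x - B x * B (inv x \<otimes> g) = 0"
      using sum_nonneg_eq_0_iff[OF fin, of "\<lambda>y. B y - B y * B (inv y \<otimes> g)"] xG by simp
    then show ?thesis using x xG gG by (simp add: H_def)
  qed
  have oneH: "\<one> \<in> H" using B1 by (simp add: H_def)
  have invH: "inv x \<in> H" if "x \<in> H" for x using div[OF that oneH] that HG by auto
  have H: "subgroup H G"
  proof (rule subgroupI)
    show "x \<otimes> y \<in> H" if xy: "x \<in> H" "y \<in> H" for x y
      using div[OF invH[OF xy(1)] xy(2)] xy(1) HG by auto
  qed (use HG oneH invH in auto)
  have sH: "char_sum X H = (if X \<in> M then of_nat (card H) else 0)" if "X \<in> chars" for X
    using fB[OF that] unfolding BH fourier_ring_elem[OF HG] cardH .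
  have perp: "char_perp G H = M"
  proof (intro equalityI subsetI)
    fix X assume X: "X \<in> char_perp G H"
    then have Xc: "X \<in> chars" by (simp add: char_perp_def)
    have "char_sum X H = of_nat (card H)" using X by (simp add: char_perp_def char_sum_def)
    then show "X \<in> M" using sH[OF Xc] cardH r_pos by (metis mult_eq_0_iff neq0_conv of_nat_eq_0_iff zero_neq_numeral)
  next
    fix X assume X: "X \<in> M"
    then have Xc: "X \<in> chars" using M_subset by blast
    have "(\<Sum>h\<in>H. X h) = of_nat (card H)" using sH[OF Xc] X by (simp add: char_sum_def)
    then show "X \<in> char_perp G H"
      unfolding char_perp_def using Xc sum_char_subgroup_eq_card[OF HG Xc] by simp
  qed
  define E where "E g = ring_elem D g - ring_elem (set_inv D) g" for g
  \<comment> \<open>The transform of the right side is \<open>- 4 r^2\<close> off \<open>M\<close>,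
    the square of \<open>a - cnj a\<close>; on \<open>M\<close> the term with \<open>H\<close>
    cancels it.\<close>
  have EE: "group_conv G E E g = - 4 * (int r)\<^sup>2 * (if g = \<one> then 1 else 0) + 2 * int r * indicator H g"
    if g: "g \<in> carrier G" for g
  proof (rule int_fourier_inj[OF _ g])
    fix X assume X: "X \<in> chars"
    have fE: "fourier (\<lambda>g. of_int (E g)) X = char_sum X D - cnj (char_sum X D)"
      unfolding E_def of_int_diff fourier_diff fourier_ring_elem[OF DG]
        fourier_ring_elem[OF set_inv_subset[OF DG]] char_sum_set_inv[OF DG X] ..
    have "fourier (\<lambda>g. of_int (E g)) X * fourier (\<lambda>g. of_int (E g)) X
      = (if X \<in> M then 0 else - 4 * (of_nat r)\<^sup>2)"
    proof (cases "X = triv")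
      case True
      then show ?thesis unfolding fE using triv_in_M by (simp add: char_sum_triv[OF DG])
    next
      case False
      have ima: "(Im a)\<^sup>2 = (real r)\<^sup>2" using norm_a_sq Re0 r by simp
      have "(a - cnj a) * (a - cnj a) = - 4 * (of_nat r)\<^sup>2"
      proof -
        have "(a - cnj a) * (a - cnj a) = of_real (- 4 * (Im a)\<^sup>2)"
          by (simp add: complex_eq_iff power2_eq_square)
        then show ?thesis unfolding ima by simp
      qed
      moreover from this have "(cnj a - a) * (cnj a - a) = - 4 * (of_nat r)\<^sup>2"
        by (simp add: algebra_simps)
      ultimately show ?thesis
        unfolding fE using in_M_iff[OF X False] values_distinct
        by (cases rule: char_cases[OF X False]) (auto simp: r)
    qed
    moreover have "fourier (\<lambda>g. of_int (- 4 * (int r)\<^sup>2 * (if g = \<one> then 1 else 0) + 2 * int r * indicator H g)) X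
      = - 4 * (of_nat r)\<^sup>2 + 2 * of_nat r * char_sum X H"
    proof -
      have "fourier (\<lambda>g. of_int (- 4 * (int r)\<^sup>2 * (if g = \<one> then 1 else 0) + 2 * int r * indicator H g)) X
        = fourier (\<lambda>g. (if g = \<one> then - 4 * (of_nat r)\<^sup>2 else 0) + 2 * of_nat r * indicator H g) X"
        by (intro fourier_cong) (simp add: indicator_def)
      then show ?thesis
        unfolding fourier_add fourier_scale fourier_indicator[OF HG] fourier_delta[OF X] .
    qed
    ultimately show "fourier (\<lambda>g. of_int (group_conv G E E g)) X =
      fourier (\<lambda>g. of_int (- 4 * (int r)\<^sup>2 * (if g = \<one> then 1 else 0) + 2 * int r * indicator H g)) X"
      unfolding fourier_of_int_conv[OF X] using sH[OF X] cardH by (simp add: power2_eq_square)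
  qed
  obtain e where "card H = 2 ^ e" using subgroup_2_power[OF H cardH EE] by blast
  then have e: "2 * r = 2 ^ e" using cardH by simp
  \<comment> \<open>\<open>e\<close> is the exponent \<open>m\<close> of the claim; being positive,
    it gives \<open>s = 2 ^ (e - 1)\<close> with a natural exponent \<open>j\<close>.\<close>
  then have "e \<noteq> 0" using r_pos by (cases e) auto
  then obtain j where j: "e = Suc j" by (cases e) auto
  have rj: "r = 2 ^ j" using e j by simp
  have lr: "real l = (2 ^ j)\<^sup>2 + 2 ^ j" using s_sq k r rj by simp
  have "real v = 2 powi (2 * int e) \<and>
    real k = 2 powi (2 * int e - 1) + 2 powi (int e - 1) \<and>
    real l = 2 powi (2 * int e - 2) + 2 powi (int e - 1)"
  proof -
    have i: "2 * int e = int (2 * j + 2)" "2 * int e - 1 = int (2 * j + 1)"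
      "2 * int e - 2 = int (2 * j)" "int e - 1 = int j" by (simp_all add: j)
    have p: "(2::real) ^ (2 * j + 2) = 4 * (2 ^ j)\<^sup>2" "(2::real) ^ (2 * j + 1) = 2 * (2 ^ j)\<^sup>2"
      "(2::real) ^ (2 * j) = (2 ^ j)\<^sup>2"
      by (simp_all only: power_add power_mult power2_eq_square mult_2) simp_all
    have "real r = 2 ^ j" using rj by simp
    then have "real v = 4 * (2 ^ j)\<^sup>2" "real k = 2 * (2 ^ j)\<^sup>2 + 2 ^ j" using v k r by simp_all
    moreover have "(2::real) powi (2 * int e) = 4 * (2 ^ j)\<^sup>2" by (simp only: i(1) power_int_of_nat p(1))
    moreover have "(2::real) powi (2 * int e - 1) = 2 * (2 ^ j)\<^sup>2" by (simp only: i(2) power_int_of_nat p(2))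
    moreover have "(2::real) powi (2 * int e - 2) = (2 ^ j)\<^sup>2" by (simp only: i(3) power_int_of_nat p(3))
    moreover have "(2::real) powi (int e - 1) = 2 ^ j" by (simp only: i(4) power_int_of_nat)
    ultimately show ?thesis using lr by simp
  qed
  moreover have "finite_p_group 2 G"
  proof -
    have "card (carrier G) = (2 * r)\<^sup>2" unfolding card_G vr by (simp add: power_mult_distrib)
    also have "\<dots> = 2 ^ (e * 2)" unfolding e power_mult ..
    finally have "card (carrier G) = 2 ^ (e * 2)" .
    then show ?thesis unfolding finite_p_group_def using fin group_axioms by auto
  qed
  moreover have "(\<lambda>g. ring_elem D g + ring_elem (set_inv D) g - ring_elem (carrier G) g) = ring_elem H"
    using BH unfolding B_def F_def by blast
  ultimately show ?thesis using H perp by blast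
qed


text \<open>Now \<open>2k - v = -2s\<close>. Subtracting \<open>F\<close> from \<open>G\<close> and
  adding the identity yields a \<open>C\<close> whose transform takes only the values
  \<open>1\<close> and \<open>1 - 2r\<close> off the principal character. Nonnegativity of
  \<open>C * C\<close> leaves \<open>r = 2\<close>, and counting factorizations of a square
  finishes.\<close>

lemma hadamard_minus_impossible:
  assumes v: "real v = 4 * s\<^sup>2" and k: "real k = 2 * s\<^sup>2 - s" and Re0: "Re a = 0"
  shows False
proof -
  obtain r :: nat where r: "s = real r"
  proof -
    have "s = of_int (2 * (int k - int l) - int k)" using k s_sq by simp
    moreover from this have "2 * (int k - int l) - int k \<ge> 0" using s_pos by linarith
    ultimately show ?thesis using that[of "nat (2 * (int k - int l) - int k)"] by simp
  qed
  have r_pos: "r > 0" using r s_pos by simp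
  \<comment> \<open>\<open>r = 1\<close> would be a one-element set with \<open>l = 0\<close>, which
    \<open>l_pos\<close> excludes; thus \<open>2 - 2r\<close> is strictly negative.\<close>
  have r1: "r \<noteq> 1"
  proof
    assume "r = 1"
    then have "real k = 1" "real k - real l = 1" using k s_sq r by simp_all
    then show False using l_pos by simp
  qed
  have vr: "real v = 4 * (real r)\<^sup>2" and kr: "real k = 2 * (real r)\<^sup>2 - real r" using v k r by simp_all
  define C where "C g = (if g = \<one> then 1 else 0) + (ring_elem (carrier G) g - F g)" for g
  have C_F: "C g = (if g = \<one> then 1 else 0) + 1 - F g" if "g \<in> carrier G" for g
    using that by (simp add: C_def ring_elem_def)
  have fC: "fourier (\<lambda>g. of_int (C g)) X =
      (if X = triv then 2 * of_nat r + 1 else if X \<in> M then 1 - 2 * of_nat r else 1)"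
    if X: "X \<in> chars" for X
  proof -
    have "fourier (\<lambda>g. of_int (C g)) X =
        1 + ((if X = triv then of_nat v else 0) - fourier (\<lambda>g. of_int (F g)) X)"
      unfolding C_def of_int_diff of_int_add fourier_diff fourier_add fourier_ring_elem[OF subset_refl]
      using X by (simp add: char_sum_carrier card_G if_distrib[of of_int] fourier_delta cong: if_cong)
    moreover have "of_nat v - 2 * of_nat k = (2 * of_nat r :: complex)"
    proof -
      have "complex_of_real (real v - 2 * real k) = of_real (2 * real r)" using vr kr by simp
      then show ?thesis by simp
    qed
    moreover have "complex_of_real s = of_nat r" using r by simp
    ultimately show ?thesis using triv_in_M by (auto simp: fourier_F[OF X] Re0 algebra_simps)
  qed
  \<comment> \<open>The quadratic with roots \<open>1\<close> and \<open>1 - 2r\<close>; the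
    constant \<open>2\<close> is a multiple of \<open>G\<close> that corrects the principal
    character, where the value is \<open>2r + 1\<close>.\<close>
  have CC: "group_conv G C C g = (2 - 2 * int r) * C g + ((if g = \<one> then 2 * int r - 1 else 0) + 2)"
    if g: "g \<in> carrier G" for g
  proof (rule int_fourier_inj[OF _ g])
    fix X assume X: "X \<in> chars"
    have "complex_of_real (real v) = of_real (4 * (real r)\<^sup>2)" unfolding vr ..
    then have vc: "of_nat v = (4 * (of_nat r)\<^sup>2 :: complex)" by simp
    have "fourier (\<lambda>g. of_int ((2 - 2 * int r) * C g + ((if g = \<one> then 2 * int r - 1 else 0) + 2))) X
      = fourier (\<lambda>g. (2 - 2 * of_nat r) * of_int (C g) + ((if g = \<one> then 2 * of_nat r - 1 else 0) + 2)) X"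
      by (intro fourier_cong) simp
    also have "\<dots> = (2 - 2 * of_nat r) * fourier (\<lambda>g. of_int (C g)) X
        + ((2 * of_nat r - 1) + (if X = triv then 2 * of_nat v else 0))"
      unfolding fourier_add fourier_scale fourier_delta[OF X] fourier_const[OF X] card_G ..
    also have "\<dots> = fourier (\<lambda>g. of_int (C g)) X * fourier (\<lambda>g. of_int (C g)) X"
      unfolding fC[OF X] vc using triv_in_M by (simp add: algebra_simps power2_eq_square)
    finally show "fourier (\<lambda>g. of_int (group_conv G C C g)) X =
      fourier (\<lambda>g. of_int ((2 - 2 * int r) * C g + ((if g = \<one> then 2 * int r - 1 else 0) + 2))) X"
      unfolding fourier_of_int_conv[OF X] ..
  qed
  have sumC: "(\<Sum>g\<in>carrier G. C g) = 2 * int r + 1"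
  proof -
    have "complex_of_int (\<Sum>g\<in>carrier G. C g) = of_int (2 * int r + 1)"
      using fC[OF triv_in_chars] by (simp add: fourier_def)
    then show ?thesis using of_int_eq_iff by blast
  qed
  have C_inv: "C (inv g) = C g" if "g \<in> carrier G" for g using that F_inv by (simp add: C_F)
  have C_cases: "C g \<in> {-1, 0, 1, 2}" if "g \<in> carrier G" for g
    using F_cases[of g] C_F[OF that] by auto
  have C1_cases: "C \<one> \<in> {0, 2}" using F_involution[of \<one>] C_F[of \<one>] by auto
  have sumC2: "(\<Sum>g\<in>carrier G. (C g)\<^sup>2) = (2 - 2 * int r) * C \<one> + (2 * int r + 1)"
    using CC[of \<one>] unfolding group_conv_def by (simp add: C_inv power2_eq_square)
  have C2_ge: "(C g)\<^sup>2 - C g \<ge> 0" if "g \<in> carrier G" for g using C_cases[OF that] by auto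
  have diff: "(\<Sum>g\<in>carrier G. (C g)\<^sup>2 - C g) = (2 - 2 * int r) * C \<one>"
    using sumC sumC2 by (simp add: sum_subtractf)
  \<comment> \<open>\<open>C \<one>\<close> is even, and the value 2 would make a sum of nonnegative
    terms equal to \<open>2 * (2 - 2r)\<close>.\<close>
  have C1: "C \<one> = 0"
  proof (rule ccontr)
    assume "C \<one> \<noteq> 0"
    then have "C \<one> = 2" using C1_cases by simp
    moreover have "(\<Sum>g\<in>carrier G. (C g)\<^sup>2 - C g) \<ge> 0" using C2_ge by (intro sum_nonneg) auto
    ultimately show False using diff r_pos r1 by simp
  qed
  have C01: "C g \<in> {0, 1}" if g: "g \<in> carrier G" for g
  proof -
    have "(C g)\<^sup>2 - C g = 0"
      using sum_nonneg_eq_0_iff[OF fin, of "\<lambda>g. (C g)\<^sup>2 - C g"] C2_ge diff C1 g by simp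
    then show ?thesis using C_cases[OF g] by auto
  qed
  define S where "S = {g \<in> carrier G. C g = 1}"
  have SG: "S \<subseteq> carrier G" by (auto simp: S_def)
  have fS: "finite S" using SG fin by (rule finite_subset)
  have cardS: "int (card S) = 2 * int r + 1"
  proof -
    have "(\<Sum>g\<in>carrier G. C g) = (\<Sum>g\<in>carrier G. if g \<in> S then 1 else 0)"
      using C01 by (intro sum.cong) (auto simp: S_def)
    also have "\<dots> = int (card (carrier G \<inter> S))" using fin by (simp add: sum.inter_restrict[symmetric])
    also have "carrier G \<inter> S = S" using SG by blast
    finally show ?thesis using sumC by simp
  qed
  have CC_nonneg: "0 \<le> C y * C (inv y \<otimes> g)" if "y \<in> carrier G" "g \<in> carrier G" for y g
    using C01[of y] C01[of "inv y \<otimes> g"] that by auto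
  \<comment> \<open>At an element of \<open>S\<close> the coefficient of \<open>C * C\<close> is
    \<open>4 - 2r\<close>, which must not be negative. For \<open>r = 2\<close> it is 0, whence
    \<open>sum_free\<close>.\<close>
  have r2: "r = 2"
  proof -
    have "S \<noteq> {}" using cardS by auto
    then obtain g where g: "g \<in> carrier G" "C g = 1" by (auto simp: S_def)
    have "group_conv G C C g \<ge> 0" unfolding group_conv_def using CC_nonneg g by (intro sum_nonneg) auto
    moreover have "g \<noteq> \<one>" using g C1 by auto
    ultimately show ?thesis using CC[OF g(1)] g(2) r_pos r1 by simp
  qed
  have sum_free: "C (x \<otimes> y) = 0" if x: "x \<in> carrier G" "C x = 1" and y: "y \<in> carrier G" "C y = 1" for x y
  proof (rule ccontr)
    assume "C (x \<otimes> y) \<noteq> 0"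
    then have c: "C (x \<otimes> y) = 1" using C01[of "x \<otimes> y"] x y by auto
    then have "x \<otimes> y \<noteq> \<one>" using C1 by auto
    then have "group_conv G C C (x \<otimes> y) = 0" using CC[of "x \<otimes> y"] x y c r2 by simp
    moreover have xy: "x \<otimes> y \<in> carrier G" using x y by simp
    ultimately have "\<forall>z\<in>carrier G. C z * C (inv z \<otimes> (x \<otimes> y)) = 0"
      unfolding group_conv_def
      using sum_nonneg_eq_0_iff[OF fin, of "\<lambda>z. C z * C (inv z \<otimes> (x \<otimes> y))"] CC_nonneg[OF _ xy] by blast
    then have "C x * C (inv x \<otimes> (x \<otimes> y)) = 0" using x(1) by blast
    then show False using x y by (simp add: m_assoc[symmetric])
  qed
  \<comment> \<open>At an involution \<open>C\<close> is odd, because \<open>F\<close> is even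
    there.\<close>
  have involution: "C g = 1" if g: "g \<in> carrier G" "g \<noteq> \<one>" "g \<otimes> g = \<one>" for g
    using F_involution[OF g(1,3)] C_F[OF g(1)] C01[OF g(1)] g(2) by auto
  have "\<exists>x\<in>S. x \<otimes> x \<noteq> \<one>"
  proof (rule ccontr)
    assume "\<not> (\<exists>x\<in>S. x \<otimes> x \<noteq> \<one>)"
    then have inv2: "x \<otimes> x = \<one>" if "x \<in> S" for x using that by blast
    have "\<not> card S \<le> Suc 0" using cardS r2 by simp
    then obtain x y where xy: "x \<in> S" "y \<in> S" "x \<noteq> y"
      unfolding card_le_Suc0_iff_eq[OF fS] by blast
    have xG: "x \<in> carrier G" and yG: "y \<in> carrier G" using xy SG by auto
    have "x \<otimes> y \<noteq> \<one>"
      using inv2[OF xy(2)] xy(3) xG yG by (metis right_cancel)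
    moreover have "(x \<otimes> y) \<otimes> (x \<otimes> y) = (x \<otimes> x) \<otimes> (y \<otimes> y)" using xG yG by (simp add: m_ac)
    then have "(x \<otimes> y) \<otimes> (x \<otimes> y) = \<one>" using inv2 xy by simp
    ultimately have "C (x \<otimes> y) = 1" using involution xG yG by simp
    moreover have "C (x \<otimes> y) = 0" using sum_free xy by (simp add: S_def)
    ultimately show False by simp
  qed
  then obtain x where x: "x \<in> carrier G" "C x = 1" "x \<otimes> x \<noteq> \<one>"
    unfolding S_def by blast
  \<comment> \<open>The coefficient of \<open>C * C\<close> at \<open>x \<otimes> x\<close> is 2 and
    counts ordered factorizations within \<open>S\<close>. One is \<open>x\<close> times
    \<open>x\<close>. Another one, \<open>z\<close> times \<open>w\<close>, can be reversed to give
    a third unless \<open>z = w\<close>; then \<open>z \<otimes> inv x\<close> is an involution,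
    hence in \<open>S\<close>, and \<open>z\<close> is a product of two elements of
    \<open>S\<close>.\<close>
  let ?T = "\<lambda>y. C y * C (inv y \<otimes> (x \<otimes> x))"
  have xx: "x \<otimes> x \<in> carrier G" using x by simp
  have sumT: "(\<Sum>y\<in>carrier G. ?T y) = 2"
    using CC[OF xx] sum_free[OF x(1,2) x(1,2)] x(3) unfolding group_conv_def by simp
  have Tx: "?T x = 1" using x by (simp add: m_assoc[symmetric])
  obtain z where z: "z \<in> carrier G" "z \<noteq> x" "?T z \<noteq> 0"
  proof (rule ccontr)
    assume "\<not> thesis"
    then have "(\<Sum>y\<in>carrier G - {x}. ?T y) = 0" using that by (intro sum.neutral) auto
    moreover have "(\<Sum>y\<in>carrier G. ?T y) = ?T x + (\<Sum>y\<in>carrier G - {x}. ?T y)"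
      by (rule sum.remove[OF fin x(1)])
    ultimately show False using sumT Tx by simp
  qed
  define w where "w = inv z \<otimes> (x \<otimes> x)"
  have wG: "w \<in> carrier G" using z x by (simp add: w_def)
  have Cz: "C z = 1" and Cw: "C w = 1" using z C01[OF z(1)] C01[OF wG] by (auto simp: w_def)
  have zw: "inv w \<otimes> (x \<otimes> x) = z" unfolding w_def by (rule reflect_reflect[OF z(1) xx])
  have wx: "w \<noteq> x"
  proof
    assume "w = x"
    then have "z = x" using zw x by (simp add: m_assoc[symmetric])
    then show False using z(2) by simp
  qed
  show False
  proof (cases "w = z")
    case True
    let ?u = "z \<otimes> inv x"
    have "z \<otimes> z = z \<otimes> (inv z \<otimes> (x \<otimes> x))" using True by (simp add: w_def)
    then have zz: "z \<otimes> z = x \<otimes> x" using z x by (simp add: m_assoc[symmetric])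
    have "?u \<otimes> ?u = (z \<otimes> z) \<otimes> inv (x \<otimes> x)" using x z by (simp add: m_ac inv_mult)
    also have "\<dots> = \<one>" unfolding zz using xx by simp
    finally have "?u \<otimes> ?u = \<one>" .
    moreover have ux: "?u \<otimes> x = z" using x z by (simp add: m_assoc)
    then have "?u \<noteq> \<one>" using x z(2) by auto
    ultimately have "C ?u = 1" using involution x z by simp
    then have "C (?u \<otimes> x) = 0" using sum_free x z by simp
    then show False using ux Cz by simp
  next
    case False
    have "(\<Sum>y\<in>{x, z, w}. ?T y) \<le> (\<Sum>y\<in>carrier G. ?T y)"
      using x z wG fin CC_nonneg[OF _ xx] by (intro sum_mono2) auto
    moreover have "(\<Sum>y\<in>{x, z, w}. ?T y) = 3"
      using False wx z(2) Tx Cz Cw zw by (auto simp: w_def[symmetric])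
    ultimately show False using sumT by simp
  qed
qed

theorem hadamard_case:
  assumes had: "hadamard_difference_set G D v k l" and Re0: "Re a = 0"
  shows "real v = 4 * s\<^sup>2 \<and> real k = 2 * s\<^sup>2 + s"
proof -
  have "real v = 4 * s\<^sup>2" and "real k = 2 * s\<^sup>2 + s \<or> real k = 2 * s\<^sup>2 - s"
    using had unfolding hadamard_difference_set_def Let_def s_sq s_def[symmetric] by auto
  then show ?thesis using hadamard_minus_impossible Re0 by blast
qed

section \<open>The case in which \<open>M\<close> is a subgroup\<close>

lemma parameters_from_k:
  assumes "real v = 2 * real k - 2 * s"
  shows "real v = 4 * s\<^sup>2" "real k = 2 * s\<^sup>2 + s"
proof -
  have k: "real k = real v / 2 + s" using assms by linarith
  have l: "real l = real v / 2 + s - s\<^sup>2" using s_sq k by simp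
  have "(real v / 2 + s)\<^sup>2 = s\<^sup>2 + (real v / 2 + s - s\<^sup>2) * real v" using k_sq unfolding k l .
  then have "real v * (real v - 4 * s\<^sup>2) = 0" by (auto simp: power2_eq_square field_simps)
  then show v: "real v = 4 * s\<^sup>2" using v_pos by simp
  show "real k = 2 * s\<^sup>2 + s" unfolding k v by simp
qed

lemma sum_m_cnj:
  assumes X: "X \<in> chars"
  shows "(\<Sum>g\<in>carrier G. m g * cnj (X g)) = (if X \<in> M then of_nat v else 0)"
proof -
  have "(\<Sum>g\<in>carrier G. m g * cnj (X g)) = (\<Sum>Y\<in>M. \<Sum>g\<in>carrier G. Y g * cnj (X g))"
    unfolding m_def sum_distrib_right by (rule sum.swap)
  also have "\<dots> = (\<Sum>Y\<in>M. if Y = X then of_nat v else 0)"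
    using M_subset X by (intro sum.cong refl) (auto simp: orthogonality card_G)
  finally show ?thesis using finite_M by simp
qed

text \<open>Here \<open>m\<close> is \<open>card M\<close> times the indicator of the annihilator
  \<open>H\<close> of \<open>M\<close>, so \<open>F_formula\<close> gives one value outside
  \<open>H\<close>, one on \<open>H\<close> apart from the identity, and one at the identity; each
  must be 0, 1 or 2.\<close>

theorem subgroup_case:
  assumes M: "subgroup M (char_group G)"
  shows "real v = 4 * s\<^sup>2 \<and> real k = 2 * s\<^sup>2 + s \<and> Re a = 0"
proof -
  define H where "H = {g \<in> carrier G. \<forall>X\<in>M. X g = 1}"
  have HG: "H \<subseteq> carrier G" by (auto simp: H_def)
  have mH: "m g = (if g \<in> H then of_nat (card M) else 0)" if g: "g \<in> carrier G" for g
  proof (cases "g \<in> H")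
    case True
    then have "m g = (\<Sum>X\<in>M. 1)" unfolding m_def H_def by (intro sum.cong refl) blast
    then show ?thesis using True by simp
  next
    case False
    then obtain Y where Y: "Y \<in> M" "Y g \<noteq> 1" using g by (auto simp: H_def)
    have Yc: "Y \<in> chars" using Y M_subset by blast
    have inj: "inj_on (\<lambda>X. Y \<otimes>\<^bsub>char_group G\<^esub> X) M"
      using char_mult_left_inj[OF Yc] M_subset by (rule inj_on_subset)
    have "(\<lambda>X. Y \<otimes>\<^bsub>char_group G\<^esub> X) ` M = M"
      using inj finite_M subgroup.m_closed[OF M Y(1)] by (intro endo_inj_surj) auto
    then have "m g = (\<Sum>X\<in>M. (Y \<otimes>\<^bsub>char_group G\<^esub> X) g)"
      unfolding m_def using sum.reindex[OF inj, of "\<lambda>X. X g"] by simp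
    also have "\<dots> = Y g * m g" using g by (simp add: char_group_mult_apply sum_distrib_left m_def)
    finally have "m g = 0" using Y(2) by (rule eq_zero_if_eq_mult)
    then show ?thesis using False by simp
  qed
  have cardHM: "card M * card H = v"
  proof -
    have "of_nat v = (\<Sum>g\<in>carrier G. if g \<in> H then of_nat (card M) else (0::complex))"
      using sum_m_cnj[OF triv_in_chars] triv_in_M mH by simp
    also have "\<dots> = (\<Sum>g\<in>carrier G \<inter> H. of_nat (card M))" by (rule sum.inter_restrict[OF fin, symmetric])
    also have "carrier G \<inter> H = H" using HG by blast
    finally have "of_nat v = (of_nat (card M * card H) :: complex)" by (simp add: mult.commute)
    then show ?thesis using of_nat_eq_iff by metis
  qed
  define t where "t = 2 * Re a"
  have formula: "real v * real_of_int (F g) = 2 * real k - 2 * s + (if g \<in> H then (2 * s - t) * real (card M) else 0)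
      + (if g = \<one> then real v * t else 0)" if g: "g \<in> carrier G" for g
  proof -
    have "complex_of_real (real v * real_of_int (F g)) = of_real (2 * real k - 2 * s
      + (if g \<in> H then (2 * s - t) * real (card M) else 0) + (if g = \<one> then real v * t else 0))"
      using F_formula[OF g] mH[OF g] by (simp add: t_def)
    then show ?thesis using of_real_eq_iff by blast
  qed
  \<comment> \<open>Outside \<open>H\<close>, \<open>v\<close> times the coefficient is
    \<open>2k - 2s\<close>, strictly between 0 and \<open>2v\<close>; so the coefficient is
    1.\<close>
  have v2: "real v = 2 * real k - 2 * s"
  proof -
    obtain X where X: "X \<in> M" "X \<noteq> triv"
    proof -
      have "M \<noteq> {triv}" using card_M_ge by auto
      then show ?thesis using that triv_in_M by blast
    qed
    then obtain g where g: "g \<in> carrier G" "X g \<noteq> triv g"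
      using char_eqI[OF _ triv_in_chars, of X] M_subset by blast
    then have "g \<notin> H" "g \<noteq> \<one>" using X M_subset by (auto simp: H_def)
    then have eq: "real v * real_of_int (F g) = 2 * real k - 2 * s" using formula[OF g(1)] by simp
    have "F g \<noteq> 0" using eq s_less_k by auto
    moreover have "F g \<noteq> 2" using eq s_pos k_less_v by auto
    ultimately have "F g = 1" using F_cases[of g] by simp
    then show ?thesis using eq by simp
  qed
  have dpos: "2 * s - t > 0" using Re_a_less by (simp add: t_def)
  have H1: "card H \<noteq> 1" using cardHM card_M_less by auto
  have oneH: "\<one> \<in> H" using M_subset by (auto simp: H_def)
  \<comment> \<open>On \<open>H\<close> the coefficient exceeds 1, so it is 2 and
    \<open>(2s - t) * card M = v\<close>. A nonidentity element of \<open>H\<close> exists by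
    \<open>card_M_less\<close>.\<close>
  have d: "2 * s - t = real (card H)"
  proof -
    have "H \<noteq> {\<one>}" using H1 by auto
    then obtain g where g: "g \<in> H" "g \<noteq> \<one>" using oneH by blast
    then have eq: "real v * real_of_int (F g) = real v + (2 * s - t) * real (card M)"
      using formula[of g] HG v2 by auto
    have "(2 * s - t) * real (card M) > 0" using dpos card_M_ge by simp
    then have "F g \<noteq> 0" "F g \<noteq> 1" using eq v_pos by auto
    then have "F g = 2" using F_cases[of g] by simp
    then have "(2 * s - t) * real (card M) = real v" using eq by simp
    also have "\<dots> = real (card H) * real (card M)" unfolding cardHM[symmetric] by simp
    finally show ?thesis using card_M_ge by simp
  qed
  have t02: "t = 0 \<or> t = -2"
  proof -
    have "real v * real_of_int (F \<one>) = 2 * real v + real v * t"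
    proof -
      have "real v = (2 * s - t) * real (card M)" unfolding d using cardHM by (metis of_nat_mult mult.commute)
      then show ?thesis using formula[of \<one>] oneH v2 by simp
    qed
    also have "\<dots> = real v * (2 + t)" by (simp add: algebra_simps)
    finally have "real_of_int (F \<one>) = 2 + t" using v_pos by simp
    then show ?thesis using F_involution[of \<one>] by auto
  qed
  \<comment> \<open>For \<open>t = -2\<close>, \<open>card H = 2s + 2\<close> and
    \<open>v = (card H - 2)^2\<close>. As \<open>card H\<close> divides \<open>v\<close>, it divides
    4; being larger than 2 it is 4, and \<open>card M = 1\<close>.\<close>
  have "t \<noteq> -2"
  proof
    assume t: "t = -2"
    then have h: "real (card H) = 2 * s + 2" using d by simp
    have "real v = (real (card H) - 2)\<^sup>2"
      using parameters_from_k(1)[OF v2] h by (simp add: power2_eq_square)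
    then have "real_of_int (int (card M) * int (card H)) = of_int ((int (card H) - 2)\<^sup>2)"
      using cardHM by (simp flip: of_nat_mult)
    then have eq: "int (card M) * int (card H) = (int (card H) - 2)\<^sup>2" by (simp only: of_int_eq_iff)
    then have "int (card H) * (int (card M) - int (card H) + 4) = 4"
      by (simp add: power2_eq_square algebra_simps)
    then have "int (card H) dvd 4" by (metis dvd_triv_left)
    moreover have "card H > 2" using h s_pos by linarith
    ultimately have "card H \<le> 4" "card H \<noteq> 3" using zdvd_imp_le[of "int (card H)" 4] by auto
    then have "card H = 4" using \<open>card H > 2\<close> by simp
    then have "card M = 1" using eq by simp
    then show False using card_M_ge by simp
  qed
  then have "Re a = 0" using t02 by (simp add: t_def)
  then show ?thesis using parameters_from_k[OF v2] by simp
qed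

text \<open>\<open>F_formula\<close> at the identity is \<open>tA\<close>, Parseval's identity is
  \<open>t2A\<close>. Comparing the square of the first with the second expresses
  \<open>4 * R * B * s\<close> rationally; being an algebraic integer, \<open>s\<close> is then an
  integer.\<close>

lemma s_nat_and_Re_rational: "(\<exists>r::nat. s = real r) \<and> 2 * Re a \<in> \<rat>"
proof -
  define t where "t = 2 * Re a"
  define A where "A = real v - real (card M)"
  define B where "B = real (card M) - 1"
  define R where "R = real v * real_of_int (F \<one>) - 2 * real k"
  define Z where "Z = real v * (\<Sum>g\<in>carrier G. (real_of_int (F g))\<^sup>2) - 4 * (real k)\<^sup>2 - 4 * s\<^sup>2 * B"
  have s2: "s\<^sup>2 \<in> \<rat>" unfolding s_sq by simp
  have rat: "A \<in> \<rat>" "B \<in> \<rat>" "R \<in> \<rat>" "Z \<in> \<rat>"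
    using s2 by (auto simp: A_def B_def R_def Z_def intro!: Rats_diff Rats_mult Rats_sum Rats_power)
  have pos: "A > 0" "B > 0" using card_M_less card_M_ge by (auto simp: A_def B_def)
  \<comment> \<open>\<open>F \<one>\<close> is 0 or 2, whereas \<open>0 < k < v\<close>.\<close>
  have R0: "R \<noteq> 0"
  proof
    assume "R = 0"
    then have "real v * real_of_int (F \<one>) = 2 * real k" by (simp add: R_def)
    then show False using F_involution[of \<one>] k_less_v s_less_k s_pos by auto
  qed
  have tA: "t * A = R - 2 * s * B"
  proof -
    have "complex_of_real (real v * real_of_int (F \<one>)) =
      of_real (2 * real k - 2 * s + (2 * s - t) * real (card M) + real v * t)"
      using F_formula[of \<one>] m_one by (simp add: t_def)
    then have "real v * real_of_int (F \<one>) = 2 * real k - 2 * s + (2 * s - t) * real (card M) + real v * t"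
      using of_real_eq_iff by blast
    then show ?thesis by (simp add: R_def A_def B_def algebra_simps)
  qed
  have t2A: "t\<^sup>2 * A = Z"
  proof -
    have "(\<Sum>X\<in>chars. fourier (\<lambda>g. of_int (F g)) X * cnj (fourier (\<lambda>g. of_int (F g)) X)) =
        (\<Sum>X\<in>chars. (if X = triv then 4 * (of_nat k)\<^sup>2 - 4 * (of_real s)\<^sup>2 else 0)
          + (if X \<in> M then 4 * (of_real s)\<^sup>2 - (of_real t)\<^sup>2 else 0) + (of_real t)\<^sup>2)"
      using triv_in_M by (intro sum.cong refl) (auto simp: fourier_F t_def power2_eq_square)
    also have "\<dots> = 4 * (of_nat k)\<^sup>2 - 4 * (of_real s)\<^sup>2
        + of_nat (card M) * (4 * (of_real s)\<^sup>2 - (of_real t)\<^sup>2) + of_nat v * (of_real t)\<^sup>2"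
    proof -
      have "chars \<inter> M = M" using M_subset by blast
      then show ?thesis using finite_chars card_chars card_G
        by (simp add: sum.distrib sum.inter_restrict[symmetric])
    qed
    finally have "complex_of_real (4 * (real k)\<^sup>2 - 4 * s\<^sup>2 + real (card M) * (4 * s\<^sup>2 - t\<^sup>2) + real v * t\<^sup>2)
      = of_real (real v * (\<Sum>g\<in>carrier G. (real_of_int (F g))\<^sup>2))"
      unfolding parseval card_G by (simp add: power2_eq_square)
    then have "4 * (real k)\<^sup>2 - 4 * s\<^sup>2 + real (card M) * (4 * s\<^sup>2 - t\<^sup>2) + real v * t\<^sup>2
      = real v * (\<Sum>g\<in>carrier G. (real_of_int (F g))\<^sup>2)"
      using of_real_eq_iff by blast
    then show ?thesis by (simp add: Z_def A_def B_def algebra_simps)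
  qed
  have "(R - 2 * s * B)\<^sup>2 = Z * A"
    unfolding tA[symmetric] t2A[symmetric] by (simp add: power2_eq_square)
  then have "4 * R * B * s = R\<^sup>2 + 4 * s\<^sup>2 * B\<^sup>2 - Z * A"
    by (simp add: power2_eq_square algebra_simps)
  then have "s = (R\<^sup>2 + 4 * s\<^sup>2 * B\<^sup>2 - Z * A) / (4 * R * B)"
    using R0 pos by (simp add: field_simps)
  moreover have "(R\<^sup>2 + 4 * s\<^sup>2 * B\<^sup>2 - Z * A) / (4 * R * B) \<in> \<rat>"
    using rat s2 by (intro Rats_divide Rats_diff Rats_add Rats_mult) auto
  ultimately have s_rat: "s \<in> \<rat>" by simp
  have "algebraic_int s"
  proof -
    have "s = sqrt (of_int (int k - int l))" by (simp add: s_def)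
    then show ?thesis by (metis algebraic_int_of_int algebraic_int_sqrt)
  qed
  then have "s \<in> \<int>" using s_rat by (rule rational_algebraic_int_is_int)
  then obtain i where i: "s = of_int i" by (rule Ints_cases)
  then have "s = real (nat i)" using s_pos by simp
  moreover have "t = (R - 2 * s * B) / A" using tA pos by (simp add: field_simps)
  then have "t \<in> \<rat>" using rat s_rat by (simp add: Rats_divide Rats_diff Rats_mult)
  ultimately show ?thesis unfolding t_def by blast
qed

end

section \<open>Parameters of difference sets in \<open>p\<close>-groups\<close>

lemma prime_power_dvd_factor:
  fixes p a b :: int
  assumes "prime p" "p ^ e dvd a * b" "\<not> (p dvd a \<and> p dvd b)"
  shows "p ^ e dvd a \<or> p ^ e dvd b"
proof (cases "p dvd a")
  case True
  then have "coprime (p ^ e) b" using assms by (simp add: prime_imp_coprime)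
  then show ?thesis using assms(2) by (simp add: coprime_dvd_mult_left_iff)
next
  case False
  then have "coprime (p ^ e) a" using assms by (simp add: prime_imp_coprime)
  then show ?thesis using assms(2) by (simp add: coprime_dvd_mult_right_iff)
qed

text \<open>With \<open>w = v - 2k\<close> in mind:
  \<open>(w - 2s) * (w + 2s) = v * (v - 4s^2)\<close>. The bound on \<open>s\<close> lets a suitable
  power of \<open>p\<close> be removed from \<open>w\<close> and \<open>s\<close>; afterwards
  \<open>p\<close> does not divide both factors, so one of them absorbs the whole power of
  \<open>p\<close>.\<close>

lemma prime_power_parameters_dvd:
  fixes p s s' v w :: int
  assumes p: "prime p" and v: "v = p ^ e" and s: "s = p ^ f * s'" "\<not> p dvd s'" "s > 0"
    and ve: "v \<ge> 4" and sv: "4 * s\<^sup>2 \<le> v + 1" and ne: "v \<noteq> 4 * s\<^sup>2"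
    and w: "w\<^sup>2 = 4 * s\<^sup>2 + v * (v - 4 * s\<^sup>2)"
  shows "v * p ^ f dvd w - 2 * s \<or> v * p ^ f dvd w + 2 * s"
proof -
  have p1: "p > 1" using p by (simp add: prime_gt_1_int)
  have "e \<noteq> 0" using v ve by (cases e) auto
  then have pv: "p dvd v" using v by (simp add: dvd_power)
  \<comment> \<open>Sharpens the bound: \<open>p\<close> divides \<open>v\<close> and hence not
    \<open>v + 1\<close>, and \<open>ne\<close> excludes equality with \<open>v\<close>.\<close>
  have lt: "4 * s\<^sup>2 < v" if "p dvd 4 * s\<^sup>2"
  proof -
    have "\<not> p dvd v + 1" using pv p1 by (simp add: dvd_add_right_iff)
    then have "4 * s\<^sup>2 \<noteq> v + 1" using that by auto
    then show ?thesis using sv ne by linarith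
  qed
  have s'0: "s' \<noteq> 0" using s by auto
  then have s'1: "1 \<le> s'\<^sup>2" by (simp add: power2_eq_square) (metis abs_square_eq_1 int_one_le_iff_zero_less not_square_less_zero power2_eq_square zero_less_power2)
  have pf: "p ^ (2 * f) \<le> s\<^sup>2"
  proof -
    have "p ^ (2 * f) * 1 \<le> p ^ (2 * f) * s'\<^sup>2" using s'1 p1 by (intro mult_left_mono) auto
    also have "\<dots> = s\<^sup>2" unfolding s(1) by (simp add: power_mult_distrib power_mult mult.commute)
    finally show ?thesis by simp
  qed
  show ?thesis
  proof (cases "p = 2")
    case False
    then have odd: "\<not> p dvd 2" using zdvd_imp_le[of p 2] p1 by linarith
    have "2 * f \<le> e"
    proof (cases f)
      case (Suc f')
      then have "p dvd s" using s(1) by simp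
      then have "4 * s\<^sup>2 < v" by (intro lt) (simp add: power2_eq_square)
      then have "p ^ (2 * f) < p ^ e" using pf zero_less_power[OF s(3), of 2] unfolding v by linarith
      then show ?thesis using p1 by simp
    qed simp
    then obtain d where d: "e = 2 * f + d" using le_Suc_ex by blast
    have vd: "v = p ^ (2 * f) * p ^ d" unfolding v d by (simp add: power_add)
    have s2: "s\<^sup>2 = p ^ (2 * f) * s'\<^sup>2" unfolding s(1) by (simp add: power_mult_distrib power_mult mult.commute)
    have w2: "w\<^sup>2 = p ^ (2 * f) * (4 * s'\<^sup>2 + v * (p ^ d - 4 * s'\<^sup>2))"
      unfolding w s2 vd by (simp add: algebra_simps)
    then have "(p ^ f)\<^sup>2 dvd w\<^sup>2" by (simp add: power_mult mult.commute power_even_eq)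
    then have "p ^ f dvd w" by simp
    then obtain w' where w': "w = p ^ f * w'" by (rule dvdE)
    have "p ^ (2 * f) * w'\<^sup>2 = p ^ (2 * f) * (4 * s'\<^sup>2 + v * (p ^ d - 4 * s'\<^sup>2))"
      using w2 unfolding w' by (simp add: power_mult_distrib power_mult mult.commute)
    then have "w'\<^sup>2 = 4 * s'\<^sup>2 + v * (p ^ d - 4 * s'\<^sup>2)" using p1 by simp
    then have eq: "(w' - 2 * s') * (w' + 2 * s') = v * (p ^ d - 4 * s'\<^sup>2)"
      by (simp add: power2_eq_square algebra_simps)
    have dv: "p ^ e dvd (w' - 2 * s') * (w' + 2 * s')" unfolding eq v by (rule dvd_triv_left)
    have "\<not> (p dvd w' - 2 * s' \<and> p dvd w' + 2 * s')"
    proof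
      assume "p dvd w' - 2 * s' \<and> p dvd w' + 2 * s'"
      then have "p dvd (w' + 2 * s') - (w' - 2 * s')" using dvd_diff by blast
      then have "p dvd 2 * (2 * s')" by simp
      then show False
        using prime_dvd_multD[OF p, of 2 "2 * s'"] prime_dvd_multD[OF p, of 2 s'] odd s(2) by blast
    qed
    then have "v dvd w' - 2 * s' \<or> v dvd w' + 2 * s'" using prime_power_dvd_factor[OF p dv] v by simp
    moreover have "w - 2 * s = (w' - 2 * s') * p ^ f" "w + 2 * s = (w' + 2 * s') * p ^ f"
      unfolding w' s(1) by (simp_all add: algebra_simps)
    ultimately show ?thesis by (auto intro: mult_dvd_mono)
  next
    \<comment> \<open>For \<open>p = 2\<close> the reduced factors \<open>w' - s'\<close> and
      \<open>w' + s'\<close> are both even. Their halves \<open>a\<close> and \<open>b\<close>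
      differ by the odd number \<open>s'\<close>, so \<open>2 ^ (e - 2)\<close> divides one of
      them.\<close>
    case p2: True
    have "4 * s\<^sup>2 < v" using lt p2 by simp
    then have "2 ^ (2 * f + 2) < (2::int) ^ e" using pf unfolding v p2 by simp
    then have fe: "2 * f + 2 < e" by (rule power_less_imp_less_exp[rotated]) simp
    then obtain d where d: "e = 2 * f + 2 + d" using le_Suc_ex[of "2 * f + 2" e] by auto
    have vd: "v = 2 ^ (2 * f + 2) * 2 ^ d" unfolding v d p2 by (simp only: power_add)
    have s2: "4 * s\<^sup>2 = 2 ^ (2 * f + 2) * s'\<^sup>2"
      unfolding s(1) p2 by (simp add: power_mult_distrib power_mult mult.commute power_add)
    have w2: "w\<^sup>2 = 2 ^ (2 * f + 2) * (s'\<^sup>2 + v * (2 ^ d - s'\<^sup>2))"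
      unfolding w s2 using vd by (simp add: algebra_simps)
    have pw: "(2::int) ^ (2 * f + 2) = (2 ^ (f + 1))\<^sup>2" by (simp add: power_mult_distrib power_mult power_add mult.commute power_even_eq)
    have "(2 ^ (f + 1))\<^sup>2 dvd w\<^sup>2" unfolding w2 pw by simp
    then have "2 ^ (f + 1) dvd w" by (simp only: pow_divides_pow_iff[OF pos2])
    then obtain w' where w': "w = 2 ^ (f + 1) * w'" by (rule dvdE)
    have "(2 ^ (f + 1))\<^sup>2 * w'\<^sup>2 = (2 ^ (f + 1))\<^sup>2 * (s'\<^sup>2 + v * (2 ^ d - s'\<^sup>2))"
      using w2 unfolding w' pw by (simp only: power_mult_distrib)
    then have w'2: "w'\<^sup>2 = s'\<^sup>2 + v * (2 ^ d - s'\<^sup>2)" by simp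
    have s'odd: "odd s'" using s(2) p2 by simp
    have "even v" using pv p2 by simp
    then have "odd (w'\<^sup>2)" unfolding w'2 using s'odd by simp
    then have w'odd: "odd w'" by simp
    have "even (w' - s')" using s'odd w'odd by simp
    then obtain a where a: "w' - s' = 2 * a" by (rule evenE)
    define b where "b = a + s'"
    have b: "w' + s' = 2 * b" using a by (simp add: b_def)
    define c where "c = e - 2"
    have c: "e = c + 2" using fe by (simp add: c_def)
    have "4 * (a * b) = 4 * (2 ^ c * (2 ^ d - s'\<^sup>2))"
    proof -
      have "4 * (a * b) = (w' - s') * (w' + s')" unfolding a b by simp
      also have "\<dots> = v * (2 ^ d - s'\<^sup>2)" using w'2 by (simp add: power2_eq_square algebra_simps)
      finally show ?thesis unfolding v p2 c by (simp add: power_add)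
    qed
    then have "2 ^ c dvd a * b" by simp
    moreover have "\<not> (2 dvd a \<and> 2 dvd b)" using s'odd by (auto simp: b_def)
    ultimately have "2 ^ c dvd a \<or> 2 ^ c dvd b" using prime_power_dvd_factor[of 2] by simp
    moreover have "w - 2 * s = a * 2 ^ (f + 2)" "w + 2 * s = b * 2 ^ (f + 2)"
    proof -
      have "w - 2 * s = 2 ^ (f + 1) * (w' - s')" "w + 2 * s = 2 ^ (f + 1) * (w' + s')"
        unfolding w' s(1) p2 by (simp_all add: algebra_simps)
      then show "w - 2 * s = a * 2 ^ (f + 2)" "w + 2 * s = b * 2 ^ (f + 2)" unfolding a b by simp_all
    qed
    moreover have "v * p ^ f = 2 ^ c * 2 ^ (f + 2)" unfolding v p2 c by (simp add: power_add)
    ultimately show ?thesis by (auto intro: mult_dvd_mono)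
  qed
qed

text \<open>Both \<open>w - 2s\<close> and \<open>w + 2s\<close> are nonzero and below
  \<open>2v\<close> in absolute value, while \<open>v * p ^ f\<close> divides one of them. So
  \<open>f = 0\<close> and that number is \<open>v\<close> or \<open>-v\<close>; given
  \<open>s < k < v\<close> this means \<open>k = v - s\<close>, and then
  \<open>s = 1\<close>.\<close>

lemma prime_power_difference_set_parameters:
  fixes k l s v :: int
  assumes p: "prime (p::int)" and v: "v = p ^ e" and s: "s > 0" and ve: "v \<ge> 4"
    and ksq: "k\<^sup>2 = s\<^sup>2 + l * v" and kl: "k - l = s\<^sup>2" and sk: "s < k" and kv: "k < v"
  shows "v = 4 * s\<^sup>2 \<or> s = 1 \<and> k = v - 1"
proof (rule ccontr)
  assume neg: "\<not> ?thesis"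
  define w where "w = v - 2 * k"
  have w2: "w\<^sup>2 = 4 * s\<^sup>2 + v * (v - 4 * s\<^sup>2)"
  proof -
    have "w\<^sup>2 = v * v - 4 * v * k + 4 * k\<^sup>2" by (simp add: w_def power2_eq_square algebra_simps)
    also have "\<dots> = v * v - 4 * v * (k - l) + 4 * s\<^sup>2" unfolding ksq by (simp add: algebra_simps)
    finally show ?thesis unfolding kl by (simp add: algebra_simps)
  qed
  \<comment> \<open>\<open>w^2 \<ge> 0\<close> bounds \<open>4s^2 * (v - 1)\<close> by
    \<open>v^2\<close>, which is less than \<open>(v + 2) * (v - 1)\<close>.\<close>
  have sv: "4 * s\<^sup>2 \<le> v + 1"
  proof (rule ccontr)
    assume "\<not> ?thesis"
    then have "(v + 2) * (v - 1) \<le> 4 * s\<^sup>2 * (v - 1)" using ve by (intro mult_right_mono) auto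
    moreover have "0 \<le> w\<^sup>2" by simp
    then have "4 * s\<^sup>2 * (v - 1) \<le> v * v" unfolding w2 by (simp add: algebra_simps)
    ultimately show False using ve by (simp add: algebra_simps)
  qed
  have s2v: "2 * s < v"
  proof -
    have "(2 * s)\<^sup>2 \<le> v + 1" using sv by (simp add: power_mult_distrib)
    also have "v + 1 < v * 4" using ve by simp
    also have "v * 4 \<le> v\<^sup>2" using ve by (simp add: power2_eq_square)
    finally show ?thesis by (rule power2_less_imp_less) (use ve in simp)
  qed
  have s_ne: "s \<noteq> 0" "\<not> is_unit p" using s p by (auto simp: not_prime_unit)
  define f where "f = multiplicity p s"
  obtain s' where s': "s = p ^ f * s'" "\<not> p dvd s'"
    unfolding f_def by (rule multiplicity_decompose'[OF s_ne])
  have dv: "v * p ^ f dvd w - 2 * s \<or> v * p ^ f dvd w + 2 * s"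
    using prime_power_parameters_dvd[OF p v s' s ve sv _ w2] neg by blast
  have bounds: "\<bar>w - 2 * s\<bar> < 2 * v" "\<bar>w + 2 * s\<bar> < 2 * v"
    using s2v s sk kv unfolding w_def by linarith+
  have nz: "w - 2 * s \<noteq> 0" "w + 2 * s \<noteq> 0"
  proof -
    have "w\<^sup>2 \<noteq> (2 * s)\<^sup>2" using w2 ve neg by (simp add: power_mult_distrib)
    then show "w - 2 * s \<noteq> 0" "w + 2 * s \<noteq> 0" by (auto simp: eq_neg_iff_add_eq_0[symmetric])
  qed
  have f0: "f = 0"
  proof (rule ccontr)
    assume "f \<noteq> 0"
    then have "p ^ 1 \<le> p ^ f" using prime_gt_1_int[OF p] by (intro power_increasing) auto
    then have "2 \<le> p ^ f" using prime_ge_2_int[OF p] by simp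
    then have "v * 2 \<le> v * p ^ f" using ve by (intro mult_left_mono) auto
    moreover have "v * p ^ f \<le> \<bar>w - 2 * s\<bar> \<or> v * p ^ f \<le> \<bar>w + 2 * s\<bar>"
      using dv nz by (metis dvd_abs_iff zdvd_imp_le zero_less_abs_iff)
    ultimately show False using bounds by linarith
  qed
  have "\<bar>x\<bar> = v" if x: "v dvd x" "\<bar>x\<bar> < 2 * v" "x \<noteq> 0" for x
  proof -
    obtain c where c: "x = v * c" using x(1) by (rule dvdE)
    then have "v * \<bar>c\<bar> < v * 2" using x(2) ve by (simp add: abs_mult)
    then have "\<bar>c\<bar> < 2" using ve by simp
    moreover have "c \<noteq> 0" using x(3) c by auto
    ultimately have "\<bar>c\<bar> = 1" by linarith
    then show ?thesis using c ve by (simp add: abs_mult)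
  qed
  then have "\<bar>w - 2 * s\<bar> = v \<or> \<bar>w + 2 * s\<bar> = v" using dv f0 bounds nz by auto
  then have k: "k = v - s" using s sk kv unfolding w_def by linarith
  have "v * v - 2 * v * s = l * v" using ksq unfolding k by (simp add: power2_eq_square algebra_simps)
  then have "v * (v - 2 * s - l) = 0" by (simp add: algebra_simps)
  then have "l = v - 2 * s" using ve by simp
  then have "s * (s - 1) = 0" using kl k by (simp add: power2_eq_square algebra_simps)
  then have "s = 1" using s by simp
  then show False using neg k by simp
qed

section \<open>Cyclotomic integers of 2-power order\<close>

text \<open>The ring generated by \<open>z\<close> over the integers, set up for induction over the
  ring operations instead of a representation by polynomials.\<close>

inductive_set int_adjoin :: "complex \<Rightarrow> complex set" for z :: complex where
  of_int: "of_int n \<in> int_adjoin z"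
| generator: "z \<in> int_adjoin z"
| add: "x \<in> int_adjoin z \<Longrightarrow> y \<in> int_adjoin z \<Longrightarrow> x + y \<in> int_adjoin z"
| mult: "x \<in> int_adjoin z \<Longrightarrow> y \<in> int_adjoin z \<Longrightarrow> x * y \<in> int_adjoin z"

lemma int_adjoin_0: "0 \<in> int_adjoin z" and int_adjoin_1: "1 \<in> int_adjoin z"
  and int_adjoin_2: "2 \<in> int_adjoin z"
  using int_adjoin.of_int[of 0 z] int_adjoin.of_int[of 1 z] int_adjoin.of_int[of 2 z] by simp_all

lemma int_adjoin_minus: "x \<in> int_adjoin z \<Longrightarrow> - x \<in> int_adjoin z"
  using int_adjoin.mult[OF int_adjoin.of_int[of "-1"]] by fastforce

lemma int_adjoin_diff: "x \<in> int_adjoin z \<Longrightarrow> y \<in> int_adjoin z \<Longrightarrow> x - y \<in> int_adjoin z"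
  using int_adjoin.add[OF _ int_adjoin_minus] by fastforce

lemma int_adjoin_power: "x \<in> int_adjoin z \<Longrightarrow> x ^ n \<in> int_adjoin z"
  by (induction n) (auto intro: int_adjoin_1 int_adjoin.mult)

lemma int_adjoin_sum: "(\<And>i. i \<in> A \<Longrightarrow> f i \<in> int_adjoin z) \<Longrightarrow> sum f A \<in> int_adjoin z"
  by (induction A rule: infinite_finite_induct) (auto intro: int_adjoin_0 int_adjoin.add)

text \<open>Multiplication by \<open>x\<close> in terms of the powers of \<open>z\<close>. These
  need not be independent, so \<open>B\<close> is just some integral matrix with the right action;
  for \<open>z\<close> itself it is a cyclic shift.\<close>

lemma int_adjoin_matrix:
  assumes z: "z ^ N = 1" "N > 0" and "x \<in> int_adjoin z"
  shows "\<exists>B :: nat \<Rightarrow> nat \<Rightarrow> int. \<forall>i<N. (\<Sum>j<N. of_int (B i j) * z ^ j) = x * z ^ i"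
  using assms(3)
proof induction
  case (of_int n)
  have "(\<Sum>j<N. of_int (if j = i then n else 0) * z ^ j) = of_int n * z ^ i" if "i < N" for i
  proof -
    have "(\<Sum>j<N. of_int (if j = i then n else 0) * z ^ j) = (\<Sum>j<N. if j = i then of_int n * z ^ j else 0)"
      by (intro sum.cong) auto
    then show ?thesis using that by simp
  qed
  then show ?case by (intro exI[of _ "\<lambda>i j. if j = i then n else 0"]) blast
next
  case generator
  have "(\<Sum>j<N. of_int (if j = Suc i mod N then 1 else 0) * z ^ j) = z * z ^ i" if "i < N" for i
  proof -
    have "(\<Sum>j<N. of_int (if j = Suc i mod N then 1 else 0) * z ^ j) = (\<Sum>j<N. if j = Suc i mod N then z ^ j else 0)"
      by (intro sum.cong) auto
    also have "\<dots> = z ^ (Suc i mod N)" using z(2) by simp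
    also have "\<dots> = z ^ Suc i"
    proof -
      have "z ^ Suc i = z ^ (N * (Suc i div N) + Suc i mod N)" by simp
      also have "\<dots> = (z ^ N) ^ (Suc i div N) * z ^ (Suc i mod N)" by (simp only: power_add power_mult)
      finally show ?thesis using z(1) by simp
    qed
    finally show ?thesis by simp
  qed
  then show ?case by (intro exI[of _ "\<lambda>i j. if j = Suc i mod N then 1 else 0"]) blast
next
  case (add x y)
  then obtain B C :: "nat \<Rightarrow> nat \<Rightarrow> int" where
    B: "\<forall>i<N. (\<Sum>j<N. of_int (B i j) * z ^ j) = x * z ^ i" and
    C: "\<forall>i<N. (\<Sum>j<N. of_int (C i j) * z ^ j) = y * z ^ i" by blast
  show ?case
    by (intro exI[of _ "\<lambda>i j. B i j + C i j"])
      (use B C in \<open>simp add: distrib_right sum.distrib\<close>)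
next
  case (mult x y)
  then obtain B C :: "nat \<Rightarrow> nat \<Rightarrow> int" where
    B: "\<forall>i<N. (\<Sum>j<N. of_int (B i j) * z ^ j) = x * z ^ i" and
    C: "\<forall>i<N. (\<Sum>j<N. of_int (C i j) * z ^ j) = y * z ^ i" by blast
  have "(\<Sum>j<N. of_int (\<Sum>r<N. B i r * C r j) * z ^ j) = x * y * z ^ i" if i: "i < N" for i
  proof -
    have "(\<Sum>j<N. of_int (\<Sum>r<N. B i r * C r j) * z ^ j) =
        (\<Sum>j<N. \<Sum>r<N. of_int (B i r) * (of_int (C r j) * z ^ j))"
      by (simp add: sum_distrib_right mult.assoc)
    also have "\<dots> = (\<Sum>r<N. \<Sum>j<N. of_int (B i r) * (of_int (C r j) * z ^ j))" by (rule sum.swap)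
    also have "\<dots> = (\<Sum>r<N. of_int (B i r) * (y * z ^ r))"
      using C by (intro sum.cong refl) (simp add: sum_distrib_left[symmetric])
    also have "\<dots> = y * (\<Sum>r<N. of_int (B i r) * z ^ r)"
      by (simp add: sum_distrib_left ac_simps)
    also have "\<dots> = x * y * z ^ i" using B i by simp
    finally show ?thesis .
  qed
  then show ?case by (intro exI[of _ "\<lambda>i j. \<Sum>r<N. B i r * C r j"]) blast
qed

text \<open>\<open>x\<close> is an eigenvalue of an integral matrix, with the vector of powers of
  \<open>z\<close> as eigenvector, hence a root of its monic characteristic polynomial.\<close>

lemma int_adjoin_algebraic_int:
  assumes z: "z ^ N = 1" "N > 0" and x: "x \<in> int_adjoin z"
  shows "algebraic_int x"
proof -
  obtain B :: "nat \<Rightarrow> nat \<Rightarrow> int" where B: "\<And>i. i < N \<Longrightarrow> (\<Sum>j<N. of_int (B i j) * z ^ j) = x * z ^ i"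
    using int_adjoin_matrix[OF z x] by blast
  define A where "A = mat N N (\<lambda>(i, j). B i j)"
  define u where "u = vec N (\<lambda>i. z ^ i)"
  let ?A = "map_mat complex_of_int A"
  have A: "A \<in> carrier_mat N N" by (simp add: A_def)
  then have cA: "?A \<in> carrier_mat N N" by simp
  have "?A *\<^sub>v u = x \<cdot>\<^sub>v u"
  proof (rule eq_vecI)
    fix i assume "i < dim_vec (x \<cdot>\<^sub>v u)"
    then have i: "i < N" by (simp add: u_def)
    have "(?A *\<^sub>v u) $ i = (\<Sum>j<N. of_int (B i j) * z ^ j)"
      using i by (simp add: A_def u_def scalar_prod_def lessThan_atLeast0)
    then show "(?A *\<^sub>v u) $ i = (x \<cdot>\<^sub>v u) $ i" using B[OF i] i by (simp add: u_def)
  qed (simp add: A_def u_def)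
  moreover have "u \<noteq> 0\<^sub>v N"
  proof
    assume "u = 0\<^sub>v N"
    then have "u $ 0 = 0\<^sub>v N $ 0" by simp
    then show False using z(2) by (simp add: u_def)
  qed
  ultimately have "eigenvector ?A u x" using A by (simp add: eigenvector_def u_def)
  then have "eigenvalue ?A x" by (auto simp: eigenvalue_def)
  then have "poly (char_poly ?A) x = 0" using eigenvalue_root_char_poly[OF cA] by simp
  moreover have "char_poly ?A = map_poly of_int (char_poly A)" by (rule of_int_hom.char_poly_hom[OF A])
  moreover have "lead_coeff (char_poly A) = 1" using degree_monic_char_poly[OF A] by simp
  ultimately show ?thesis unfolding algebraic_int_altdef_ipoly by auto
qed

lemma frobenius_mod_2:
  assumes "x \<in> int_adjoin z" "y \<in> int_adjoin z"
  shows "\<exists>w\<in>int_adjoin z. (x + y) ^ (2 ^ c) = x ^ (2 ^ c) + y ^ (2 ^ c) + 2 * w"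
proof (induction c)
  case 0
  show ?case by (intro bexI[of _ 0]) (auto intro: int_adjoin_0)
next
  case (Suc c)
  then obtain w where w: "w \<in> int_adjoin z" "(x + y) ^ (2 ^ c) = x ^ (2 ^ c) + y ^ (2 ^ c) + 2 * w" by blast
  define X where "X = x ^ (2 ^ c)"
  define Y where "Y = y ^ (2 ^ c)"
  have XY: "X \<in> int_adjoin z" "Y \<in> int_adjoin z" unfolding X_def Y_def using assms by (auto intro: int_adjoin_power)
  have sq: "a ^ (2 ^ Suc c) = (a ^ (2 ^ c)) ^ 2" for a :: complex by (simp add: power_mult[symmetric] mult.commute)
  have "(x + y) ^ (2 ^ Suc c) = X\<^sup>2 + Y\<^sup>2 + 2 * (X * Y + 2 * (w * (X + Y)) + 2 * (w * w))"
    unfolding sq w(2) X_def[symmetric] Y_def[symmetric] by (simp add: power2_eq_square algebra_simps)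
  moreover have "X * Y + 2 * (w * (X + Y)) + 2 * (w * w) \<in> int_adjoin z"
    using XY w(1) by (intro int_adjoin.add int_adjoin.mult int_adjoin_2)
  ultimately show ?case unfolding sq X_def[symmetric] Y_def[symmetric] by blast
qed

text \<open>In \<open>\<int>[\<zeta>]\<close> the ideal \<open>(2)\<close> is the \<open>2 ^ c\<close>-th power of the prime ideal \<open>(1 - \<zeta>)\<close>, which is
  invariant under complex conjugation.\<close>

locale two_power_root_of_unity =
  fixes \<zeta> :: complex and c :: nat
  assumes root: "\<zeta> ^ (2 ^ c) = -1" and c_pos: "c > 0"
begin

abbreviation R :: "complex set" where "R \<equiv> int_adjoin \<zeta>"
abbreviation N :: nat where "N \<equiv> 2 ^ c"
abbreviation \<pi> :: complex where "\<pi> \<equiv> 1 - \<zeta>"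

lemma root_2N: "\<zeta> ^ (2 * N) = 1"
  unfolding mult.commute[of 2] power_mult root by simp

lemma cnj_root: "\<zeta> * cnj \<zeta> = 1" "cnj \<zeta> \<in> R"
proof -
  have "norm \<zeta> = 1" using power_eq_1_iff[OF root_2N] by simp
  then show 1: "\<zeta> * cnj \<zeta> = 1" by (simp add: complex_norm_square[symmetric])
  have "\<zeta> * \<zeta> ^ (2 * N - 1) = \<zeta> ^ (2 * N)" by (simp add: power_Suc[symmetric] del: power_Suc)
  then have e: "\<zeta> * \<zeta> ^ (2 * N - 1) = \<zeta> * cnj \<zeta>" using root_2N 1 by simp
  have "\<zeta> \<noteq> 0" using 1 by auto
  then have "\<zeta> ^ (2 * N - 1) = cnj \<zeta>" using e by (metis mult_left_cancel)
  then show "cnj \<zeta> \<in> R" using int_adjoin_power[OF int_adjoin.generator] by metis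
qed

lemma cnj_closed: "x \<in> R \<Longrightarrow> cnj x \<in> R"
  by (induction rule: int_adjoin.induct)
    (auto intro: int_adjoin.add int_adjoin.mult cnj_root int_adjoin.of_int)

lemma pi_in: "\<pi> \<in> R"
  by (intro int_adjoin_diff int_adjoin_1 int_adjoin.generator)

lemma cnj_pi: "cnj \<pi> = - cnj \<zeta> * \<pi>"
  using cnj_root(1) by (simp add: algebra_simps)

lemma pi_nonzero: "\<pi> \<noteq> 0"
  using root by auto

text \<open>Modulo 2 the power is \<open>1 + \<zeta> ^ N = 0\<close>; \<open>c_pos\<close> makes
  \<open>N\<close> even, which removes the sign of \<open>- \<zeta>\<close>.\<close>

lemma pi_power: "\<exists>y\<in>R. \<pi> ^ N = 2 * y"
proof -
  have "- \<zeta> \<in> R" by (intro int_adjoin_minus int_adjoin.generator)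
  then obtain w where w: "w \<in> R" "(1 + - \<zeta>) ^ N = 1 ^ N + (- \<zeta>) ^ N + 2 * w"
    using frobenius_mod_2[OF int_adjoin_1, of "- \<zeta>" \<zeta> c] by blast
  have "even N" using c_pos by simp
  then have "\<pi> ^ N = 2 * w" using w(2) root by simp
  then show ?thesis using w(1) by blast
qed

text \<open>\<open>2 = 1 - \<zeta> ^ N\<close> is reached by repeated squaring: in
  \<open>1 - x^2 = (1 - x) * (1 + x)\<close> the second factor is again a multiple of
  \<open>1 - x\<close>.\<close>

lemma two_multiple: "\<exists>u\<in>R. 2 = \<pi> ^ N * u"
proof -
  have "i \<le> c \<Longrightarrow> \<exists>u\<in>R. 1 - \<zeta> ^ (2 ^ i) = \<pi> ^ (2 ^ i) * u" for i
  proof (induction i)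
    case 0
    show ?case by (intro bexI[of _ 1]) (auto intro: int_adjoin_1)
  next
    case (Suc i)
    then obtain u where u: "u \<in> R" "1 - \<zeta> ^ (2 ^ i) = \<pi> ^ (2 ^ i) * u" by auto
    define x where "x = \<zeta> ^ (2 ^ i)"
    \<comment> \<open>Chosen such that \<open>x ^ n = - x\<close>, which turns \<open>1 + x\<close>
      into \<open>1 - x\<close> times a geometric sum.\<close>
    define n where "n = 2 ^ (c - i) + (1::nat)"
    have xR: "x \<in> R" unfolding x_def by (intro int_adjoin_power int_adjoin.generator)
    have "x ^ (2 ^ (c - i)) = \<zeta> ^ (2 ^ i * 2 ^ (c - i))" by (simp add: x_def power_mult)
    also have "2 ^ i * 2 ^ (c - i) = N" using Suc.prems by (simp flip: power_add)
    finally have "x ^ n = - x" using root by (simp add: n_def)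
    then have "1 + x = 1 - x ^ n" by simp
    also have "\<dots> = (1 - x) * (\<Sum>j<n. x ^ j)" by (rule one_diff_power_eq)
    finally have 1: "1 + x = (1 - x) * (\<Sum>j<n. x ^ j)" .
    have dbl: "a ^ (2 ^ Suc i) = a ^ (2 ^ i) * a ^ (2 ^ i)" for a :: complex
      by (simp add: mult_2 power_add)
    have ux: "1 - x = \<pi> ^ (2 ^ i) * u" using u(2) by (simp only: x_def)
    have "1 - \<zeta> ^ (2 ^ Suc i) = (1 - x) * (1 + x)"
      unfolding dbl x_def[symmetric] by (simp add: algebra_simps)
    also have "\<dots> = \<pi> ^ (2 ^ Suc i) * (u * u * (\<Sum>j<n. x ^ j))"
      unfolding 1 ux dbl by (simp only: ac_simps)
    finally show ?case using u(1) xR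
      by (intro bexI[of _ "u * u * (\<Sum>j<n. x ^ j)"])
        (auto intro!: int_adjoin.mult int_adjoin_sum int_adjoin_power)
  qed
  from this[of c] show ?thesis using root by simp
qed

lemma rational_in_R: "x \<in> R \<Longrightarrow> x \<in> \<rat> \<Longrightarrow> x \<in> \<int>"
  using int_adjoin_algebraic_int[OF root_2N] by (intro rational_algebraic_int_is_int) auto

text \<open>If \<open>\<pi>\<close> were a unit, so would be 2 by \<open>pi_power\<close>, but 1/2
  is not an algebraic integer.\<close>

lemma one_not_multiple: "h \<in> R \<Longrightarrow> 1 \<noteq> \<pi> * h"
proof
  assume h: "h \<in> R" and eq: "1 = \<pi> * h"
  obtain y where y: "y \<in> R" "\<pi> ^ N = 2 * y" using pi_power by blast
  have "1 = (\<pi> * h) ^ N" unfolding eq[symmetric] by simp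
  then have "1 = 2 * (y * h ^ N)" unfolding power_mult_distrib y(2) by (simp only: mult.assoc)
  then have "y * h ^ N = 1 / 2" by (simp add: field_simps)
  moreover have "y * h ^ N \<in> R" using y h by (intro int_adjoin.mult int_adjoin_power)
  ultimately have "(1 / 2 :: complex) \<in> R" by metis
  then have "(1 / 2 :: complex) \<in> \<int>" by (rule rational_in_R) simp
  then obtain n where "(1 / 2 :: complex) = of_int n" by (rule Ints_cases)
  then have "complex_of_int 1 = of_int (2 * n)" by (simp add: field_simps)
  then have "1 = 2 * n" by (simp only: of_int_eq_iff)
  then show False by presburger
qed

lemma two_pi: "\<exists>q\<in>R. 2 = \<pi> * q"
proof -
  obtain u where u: "u \<in> R" "2 = \<pi> ^ N * u" using two_multiple by blast
  obtain n where n: "N = Suc n" by (metis not0_implies_Suc power_not_zero zero_neq_numeral)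
  have "2 = \<pi> * (\<pi> ^ n * u)" using u(2) unfolding n by (simp add: mult.assoc)
  moreover have "\<pi> ^ n * u \<in> R" using u(1) pi_in by (intro int_adjoin.mult int_adjoin_power)
  ultimately show ?thesis by blast
qed

text \<open>The residue field at \<open>\<pi>\<close> has two elements, since \<open>\<zeta>\<close>
  is 1 and 2 is 0 modulo \<open>\<pi>\<close>.\<close>

lemma residue_cases: "x \<in> R \<Longrightarrow> (\<exists>h\<in>R. x = \<pi> * h) \<or> (\<exists>h\<in>R. x = 1 + \<pi> * h)"
proof (induction rule: int_adjoin.induct)
  case (of_int n)
  obtain q where q: "q \<in> R" "2 = \<pi> * q" using two_pi by blast
  have e: "complex_of_int n = of_int (n mod 2) + \<pi> * (q * of_int (n div 2))"
  proof -
    have "complex_of_int n = of_int (n mod 2 + 2 * (n div 2))" by (simp only: mod_mult_div_eq)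
    then show ?thesis using q(2) by (simp only: of_int_add of_int_mult of_int_numeral mult.assoc)
  qed
  have "q * of_int (n div 2) \<in> R" using q(1) by (intro int_adjoin.mult int_adjoin.of_int)
  moreover have "n mod 2 = 0 \<or> n mod 2 = 1" by presburger
  ultimately show ?case using e by auto
next
  case generator
  have "\<zeta> = 1 + \<pi> * (- 1)" by simp
  then show ?case using int_adjoin_minus[OF int_adjoin_1] by blast
next
  case (add x y)
  obtain q where q: "q \<in> R" "2 = \<pi> * q" using two_pi by blast
  obtain h e where h: "h \<in> R" "x = e + \<pi> * h" "e = 0 \<or> e = 1" using add.IH(1) by (metis add_0)
  obtain h' e' where h': "h' \<in> R" "y = e' + \<pi> * h'" "e' = 0 \<or> e' = 1" using add.IH(2) by (metis add_0)
  have R: "h + h' \<in> R" "q + (h + h') \<in> R" using h h' q by (auto intro: int_adjoin.add)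
  have s: "x + y = (e + e') + \<pi> * (h + h')" unfolding h(2) h'(2) by (simp only: distrib_left ac_simps)
  consider "e + e' = 0" | "e + e' = 1" | "e + e' = 2" using h(3) h'(3) by auto
  then show ?case
  proof cases
    case 3
    then have "x + y = \<pi> * (q + (h + h'))" using s q(2) by (simp add: distrib_left)
    then show ?thesis using R by blast
  qed (use s R in auto)
next
  case (mult x y)
  have x: "x \<in> R" and y: "y \<in> R" using mult.hyps by auto
  show ?case
  proof (cases "\<exists>h\<in>R. x = \<pi> * h")
    case True
    then obtain h where "h \<in> R" "x = \<pi> * h" by blast
    then have "x * y = \<pi> * (h * y)" "h * y \<in> R" using y by (auto intro: int_adjoin.mult)
    then show ?thesis by blast
  next
    case False
    then obtain h where h: "h \<in> R" "x = 1 + \<pi> * h" using mult.IH(1) by blast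
    have xy: "x * y = y + \<pi> * (h * y)" unfolding h(2) by (simp add: algebra_simps)
    have hy: "h * y \<in> R" using h y by (auto intro: int_adjoin.mult)
    from mult.IH(2) show ?thesis
    proof
      assume "\<exists>h\<in>R. y = \<pi> * h"
      then obtain g where g: "g \<in> R" "y = \<pi> * g" by blast
      have "x * y = \<pi> * (g + h * y)" unfolding xy using g(2) by (simp add: algebra_simps)
      then show ?thesis using int_adjoin.add[OF g(1) hy] by blast
    next
      assume "\<exists>h\<in>R. y = 1 + \<pi> * h"
      then obtain g where g: "g \<in> R" "y = 1 + \<pi> * g" by blast
      have "x * y = 1 + \<pi> * (g + h * y)" unfolding xy using g(2) by (simp add: algebra_simps)
      then show ?thesis using int_adjoin.add[OF g(1) hy] by blast
    qed
  qed
qed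

text \<open>Conjugation multiplies \<open>\<pi>\<close> by the unit \<open>- cnj \<zeta>\<close>, so
  it preserves the residue class of 1.\<close>

lemma odd_norm:
  assumes h: "h \<in> R"
  shows "\<exists>g\<in>R. (1 + \<pi> * h) * cnj (1 + \<pi> * h) = 1 + \<pi> * g"
proof -
  have "cnj (1 + \<pi> * h) = 1 + cnj \<pi> * cnj h" by simp
  also have "\<dots> = 1 + \<pi> * (- cnj \<zeta> * cnj h)" unfolding cnj_pi by (simp only: ac_simps)
  finally have e: "cnj (1 + \<pi> * h) = 1 + \<pi> * (- cnj \<zeta> * cnj h)" .
  have "(1 + p * x) * (1 + p * y) = 1 + p * (x + y + p * x * y)" for p x y :: complex
    by (simp add: algebra_simps)
  then have "(1 + \<pi> * h) * cnj (1 + \<pi> * h) =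
    1 + \<pi> * (h + - cnj \<zeta> * cnj h + \<pi> * h * (- cnj \<zeta> * cnj h))"
    unfolding e .
  moreover have "h + - cnj \<zeta> * cnj h + \<pi> * h * (- cnj \<zeta> * cnj h) \<in> R"
    using h cnj_closed[OF h] cnj_root(2) pi_in by (intro int_adjoin.add int_adjoin.mult int_adjoin_minus)
  ultimately show ?thesis by blast
qed

text \<open>Factors \<open>\<pi>\<close> are split off one at a time. If the cofactor
  \<open>w\<close> were 1 modulo \<open>\<pi>\<close>, so would be \<open>w * cnj w\<close>, and
  \<open>x * cnj x\<close> would contain \<open>\<pi>\<close> only \<open>2 * r\<close> times, too
  few for \<open>4 ^ j\<close>.\<close>

lemma divisible_by_norm:
  assumes x: "x \<in> R" and norm: "x * cnj x = 4 ^ j"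
  shows "\<exists>b\<in>R. x = 2 ^ j * b"
proof -
  obtain u where u: "u \<in> R" "2 = \<pi> ^ N * u" using two_multiple by blast
  obtain y where y: "y \<in> R" "\<pi> ^ N = 2 * y" using pi_power by blast
  have "r \<le> N * j \<Longrightarrow> \<exists>w\<in>R. x = \<pi> ^ r * w" for r
  proof (induction r)
    case 0
    show ?case using x by auto
  next
    case (Suc r)
    then obtain w where w: "w \<in> R" "x = \<pi> ^ r * w" by auto
    have "\<exists>h\<in>R. w = \<pi> * h"
    proof (rule ccontr)
      assume "\<not> ?thesis"
      then obtain h where h: "h \<in> R" "w = 1 + \<pi> * h" using residue_cases[OF w(1)] by blast
      obtain g where g: "g \<in> R" "w * cnj w = 1 + \<pi> * g" using odd_norm[OF h(1)] h(2) by blast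
      \<comment> \<open>\<open>Suc d\<close> keeps a factor \<open>\<pi>\<close> on the right after
        cancelling \<open>\<pi> ^ (2 * r)\<close>.\<close>
      obtain d where d: "2 * (N * j) = 2 * r + Suc d"
      proof -
        have "2 * (N * j) = 2 * r + Suc (2 * (N * j) - 2 * r - 1)" using Suc.prems by simp
        then show ?thesis using that by blast
      qed
      have "\<pi> * cnj \<pi> = \<pi>\<^sup>2 * (- cnj \<zeta>)" unfolding cnj_pi by (simp only: power2_eq_square ac_simps)
      then have cp: "(\<pi> * cnj \<pi>) ^ r = \<pi> ^ (2 * r) * (- cnj \<zeta>) ^ r"
        by (simp only: power_mult_distrib power_mult)
      have "(\<pi> * cnj \<pi>) ^ r * (1 + \<pi> * g) = x * cnj x"
        unfolding w(2) g(2)[symmetric] by (simp add: power_mult_distrib ac_simps)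
      also have "\<dots> = (\<pi> ^ N * u) ^ (2 * j)" unfolding norm u(2)[symmetric] by (simp add: power_mult)
      also have "\<dots> = \<pi> ^ (2 * r) * (\<pi> * (\<pi> ^ d * u ^ (2 * j)))"
      proof -
        have "(\<pi> ^ N * u) ^ (2 * j) = \<pi> ^ (2 * (N * j)) * u ^ (2 * j)"
          by (simp add: power_mult_distrib power_mult[symmetric] ac_simps)
        then show ?thesis unfolding d by (simp add: power_add ac_simps)
      qed
      finally have "\<pi> ^ (2 * r) * ((- cnj \<zeta>) ^ r * (1 + \<pi> * g)) = \<pi> ^ (2 * r) * (\<pi> * (\<pi> ^ d * u ^ (2 * j)))"
        unfolding cp by (simp only: mult.assoc)
      then have "(- cnj \<zeta>) ^ r * (1 + \<pi> * g) = \<pi> * (\<pi> ^ d * u ^ (2 * j))" using pi_nonzero by simp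
      then have "(- \<zeta>) ^ r * ((- cnj \<zeta>) ^ r * (1 + \<pi> * g)) = (- \<zeta>) ^ r * (\<pi> * (\<pi> ^ d * u ^ (2 * j)))" by simp
      moreover have "(- \<zeta>) ^ r * (- cnj \<zeta>) ^ r = 1" unfolding power_mult_distrib[symmetric] using cnj_root(1) by simp
      ultimately have "1 + \<pi> * g = (- \<zeta>) ^ r * (\<pi> * (\<pi> ^ d * u ^ (2 * j)))"
        by (simp add: mult.assoc[symmetric])
      then have "1 = \<pi> * ((- \<zeta>) ^ r * (\<pi> ^ d * u ^ (2 * j)) - g)" by (simp add: algebra_simps)
      moreover have "(- \<zeta>) ^ r \<in> R" "\<pi> ^ d \<in> R" "u ^ (2 * j) \<in> R"
        using u(1) by (intro int_adjoin_power pi_in int_adjoin_minus int_adjoin.generator; assumption)+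
      then have "(- \<zeta>) ^ r * (\<pi> ^ d * u ^ (2 * j)) - g \<in> R"
        using g(1) by (intro int_adjoin_diff int_adjoin.mult)
      ultimately show False using one_not_multiple by blast
    qed
    then obtain h where "h \<in> R" "w = \<pi> * h" by blast
    then show ?case using w(2) by (intro bexI[of _ h]) (auto simp: ac_simps)
  qed
  from this[of "N * j"] obtain w where w: "w \<in> R" "x = \<pi> ^ (N * j) * w" by blast
  then have "x = 2 ^ j * (y ^ j * w)" using y(2) by (simp add: power_mult power_mult_distrib)
  moreover have "y ^ j * w \<in> R" using y(1) w(1) by (intro int_adjoin.mult int_adjoin_power)
  ultimately show ?thesis by blast
qed

text \<open>The quotient \<open>b\<close> and its conjugate are both 1 modulo \<open>\<pi>\<close>,
  and 2 is 0, so \<open>\<pi>\<close> divides \<open>b + cnj b\<close>; it divides neither 1 nor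
  -1.\<close>

lemma Re_zero_if_rational:
  assumes x: "x \<in> R" and norm: "x * cnj x = 4 ^ j" and rat: "2 * Re x \<in> \<rat>" and less: "\<bar>Re x\<bar> < 2 ^ j"
  shows "Re x = 0"
proof -
  obtain b where b: "b \<in> R" "x = 2 ^ j * b" using divisible_by_norm[OF x norm] by blast
  have bb: "b * cnj b = 1"
  proof -
    have "x * cnj x = (2 * 2) ^ j * (b * cnj b)" unfolding b(2) power_mult_distrib by (simp add: ac_simps)
    then have "(4::complex) ^ j * (b * cnj b) = 4 ^ j" using norm by simp
    then show ?thesis by simp
  qed
  have Rex: "Re x = 2 ^ j * Re b"
  proof -
    have "x = of_real (2 ^ j) * b" using b(2) by simp
    then show ?thesis by (simp only: Re_complex_of_real times_complex.sel Im_complex_of_real)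
  qed
  have "\<not> (\<exists>h\<in>R. b = \<pi> * h)"
  proof
    assume "\<exists>h\<in>R. b = \<pi> * h"
    then obtain h where h: "h \<in> R" "b = \<pi> * h" by blast
    have "1 = \<pi> * (h * cnj b)" using bb h(2) by (simp add: mult.assoc)
    moreover have "h * cnj b \<in> R" using h(1) cnj_closed[OF b(1)] by (rule int_adjoin.mult)
    ultimately show False using one_not_multiple by blast
  qed
  then obtain h where h: "h \<in> R" "b = 1 + \<pi> * h" using residue_cases[OF b(1)] by blast
  obtain q where q: "q \<in> R" "2 = \<pi> * q" using two_pi by blast
  define t where "t = b + cnj b"
  define g where "g = q + h - cnj \<zeta> * cnj h"
  have gR: "g \<in> R"
    unfolding g_def using q h cnj_closed[OF h(1)] cnj_root(2)
    by (intro int_adjoin_diff int_adjoin.add int_adjoin.mult)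
  have "t = 2 + \<pi> * h + cnj \<pi> * cnj h" by (simp add: t_def h(2))
  also have "\<dots> = \<pi> * q + \<pi> * h + - cnj \<zeta> * \<pi> * cnj h" unfolding cnj_pi q(2)[symmetric] ..
  also have "\<dots> = \<pi> * g"
  proof -
    have "p * q + p * h + - y * p * z = p * (q + h - y * z)" for p y z :: complex
      by (simp add: algebra_simps)
    then show ?thesis unfolding g_def .
  qed
  finally have tg: "t = \<pi> * g" .
  have tR: "t \<in> R" unfolding t_def using b(1) cnj_closed[OF b(1)] by (rule int_adjoin.add)
  have t_real: "t = of_real (2 * Re b)" by (simp add: t_def complex_add_cnj)
  have "2 * Re b = 2 * Re x / 2 ^ j" unfolding Rex by simp
  then have "2 * Re b \<in> \<rat>" using rat by (simp add: Rats_divide)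
  then obtain i n where "2 * Re b = real_of_int i / real n" unfolding Rats_eq_int_div_nat by blast
  then have "t = of_int i / of_nat n" unfolding t_real by simp
  then have "t \<in> \<rat>" by simp
  then have "t \<in> \<int>" using rational_in_R tR by blast
  then obtain n where n: "t = of_int n" by (rule Ints_cases)
  then have nb: "real_of_int n = 2 * Re b" unfolding t_real by (metis of_real_eq_iff of_real_of_int_eq)
  have "\<bar>Re b\<bar> < 1" using less unfolding Rex by (simp add: abs_mult)
  then have "\<bar>n\<bar> < 2" using nb by linarith
  moreover have "n \<noteq> 1" using one_not_multiple[OF gR] tg n by auto
  moreover have "n \<noteq> -1"
  proof
    assume "n = -1"
    then have "\<pi> * g = - 1" using tg n by (metis of_int_minus of_int_1)
    then have "1 = - (\<pi> * g)" by simp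
    then have "1 = \<pi> * (- g)" by (simp only: mult_minus_right)
    then show False using one_not_multiple[OF int_adjoin_minus[OF gR]] by simp
  qed
  ultimately have "n = 0" by linarith
  then show ?thesis using nb Rex by simp
qed

end

section \<open>The case of \<open>p\<close>-groups\<close>

context three_valued_difference_set
begin

lemma char_sum_in_int_adjoin:
  assumes X: "X \<in> chars"
  shows "char_sum X D \<in> int_adjoin (cis (2 * pi / real v))"
  unfolding char_sum_def
proof (rule int_adjoin_sum)
  fix g assume "g \<in> D"
  then have "X g ^ v = 1" using char_root_of_unity[OF X] DG card_G by auto
  then have "X g \<in> (\<lambda>j. cis (2 * pi * real j / real v)) ` {..<v}"
    using bij_betw_roots_unity[OF v_pos] by (auto simp: bij_betw_def)
  then obtain j where "X g = cis (2 * pi * real j / real v)" by blast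
  also have "\<dots> = cis (2 * pi / real v) ^ j" by (simp add: DeMoivre mult.commute)
  finally show "X g \<in> int_adjoin (cis (2 * pi / real v))"
    by (simp add: int_adjoin_power int_adjoin.generator)
qed

text \<open>If \<open>D\<close> is the complement of \<open>{g}\<close>, then \<open>X \<mapsto> X g\<close> is injective on characters, because a
  nonprincipal character trivial on \<open>g\<close> would take the value \<open>-1\<close> on \<open>D\<close>.\<close>

lemma singleton_complement:
  assumes k: "k = v - 1" and s1: "s = 1"
  shows "v \<le> 4"
proof -
  have "card (carrier G - D) = 1"
    using card_Diff_subset[OF finite_subset[OF DG fin] DG] card_G card_D k v_pos by simp
  then obtain g where g: "carrier G - D = {g}" by (auto simp: card_1_singleton_iff)
  have gG: "g \<in> carrier G" using g by blast
  have val: "char_sum X D = - X g" if X: "X \<in> chars" "X \<noteq> triv" for X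
  proof -
    have "D = carrier G - {g}" using g DG by blast
    then have "char_sum X D = char_sum X (carrier G) - X g"
      unfolding char_sum_def using fin gG by (simp add: sum_diff1)
    then show ?thesis using X by (simp add: char_sum_carrier)
  qed
  have no: "X g \<noteq> 1" if X: "X \<in> chars" "X \<noteq> triv" for X
  proof
    assume "X g = 1"
    then have "char_sum X D = -1" using val[OF X] by simp
    then show False using s1 Im_a by (cases rule: char_cases[OF X]) (auto simp: complex_eq_iff)
  qed
  have inj: "inj_on (\<lambda>X. X g) chars"
  proof (rule inj_onI, rule ccontr)
    fix X Y assume XY: "X \<in> chars" "Y \<in> chars" "X g = Y g" "X \<noteq> Y"
    define Z where "Z = (\<lambda>x\<in>carrier G. X x * cnj (Y x))"
    have Z: "Z \<in> chars"
      using XY by (auto simp: chars_iff Z_def)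
    have "Z g = 1" using XY gG char_cnj_mult[OF XY(2) gG] by (simp add: Z_def)
    then have "Z = triv" using no[OF Z] by blast
    have "X x = Y x" if x: "x \<in> carrier G" for x
    proof -
      have "Z x = 1" using \<open>Z = triv\<close> x by simp
      then have "X x * cnj (Y x) = 1" using x by (simp add: Z_def)
      then have "X x * (Y x * cnj (Y x)) = Y x" by (simp add: ac_simps)
      then show ?thesis using char_cnj_mult[OF XY(2) x] by simp
    qed
    then show False using char_eqI[OF XY(1,2)] XY(4) by blast
  qed
  have "(\<lambda>X. X g) ` chars \<subseteq> set [1, -1, -a, - cnj a]"
  proof (rule image_subsetI)
    fix X assume X: "X \<in> chars"
    show "X g \<in> set [1, -1, -a, - cnj a]"
    proof (cases "X = triv")
      case True
      then show ?thesis using gG by simp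
    next
      case False
      have "X g = - char_sum X D" using val[OF X False] by simp
      then show ?thesis using s1 by (cases rule: char_cases[OF X False]) auto
    qed
  qed
  then have "card ((\<lambda>X. X g) ` chars) \<le> card (set [1, -1, -a, - cnj a])" by (intro card_mono) auto
  also have "\<dots> \<le> 4" using card_length[of "[1, -1, -a, - cnj a]"] by simp
  finally show ?thesis using card_image[OF inj] card_chars card_G by simp
qed

theorem p_group_case:
  assumes "finite_p_group p G"
  shows "real v = 4 * s\<^sup>2 \<and> real k = 2 * s\<^sup>2 + s \<and> Re a = 0"
proof -
  obtain e where p: "prime p" and e: "v = p ^ e"
    using assms card_G by (auto simp: finite_p_group_def)
  obtain r :: nat where r: "s = real r" using s_nat_and_Re_rational by blast
  have rat: "2 * Re a \<in> \<rat>" using s_nat_and_Re_rational by blast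
  have r_pos: "r > 0" using s_pos r by simp
  have ksq: "(int k)\<^sup>2 = (int r)\<^sup>2 + int l * int v"
  proof -
    have "real_of_int ((int k)\<^sup>2) = of_int ((int r)\<^sup>2 + int l * int v)" using k_sq r by simp
    then show ?thesis by (simp only: of_int_eq_iff)
  qed
  have kl: "int k - int l = (int r)\<^sup>2"
  proof -
    have "real_of_int (int k - int l) = of_int ((int r)\<^sup>2)" using s_sq r by simp
    then show ?thesis by (simp only: of_int_eq_iff)
  qed
  have "int v = int p ^ e" using e by simp
  moreover have "4 \<le> int v" using v_ge_4 by linarith
  ultimately have "int v = 4 * (int r)\<^sup>2 \<or> int r = 1 \<and> int k = int v - 1"
    by (intro prime_power_difference_set_parameters[OF _ _ _ _ ksq kl, of "int p" e])
      (use p r_pos s_less_k k_less_v r in simp_all)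
  then have v4: "int v = 4 * (int r)\<^sup>2"
  proof
    \<comment> \<open>Only \<open>v = 4\<close> survives, and there \<open>v = 4 * r^2\<close> holds
      as well; the complement of a generator in the cyclic group of order 4 is a genuine
      example.\<close>
    assume *: "int r = 1 \<and> int k = int v - 1"
    then have "v \<le> 4" using singleton_complement r by force
    then show ?thesis using * v_ge_4 by simp
  qed simp
  then have v4n: "v = 4 * r\<^sup>2" by (metis of_nat_eq_iff of_nat_mult of_nat_numeral of_nat_power)
  have vs: "real v = 4 * s\<^sup>2" using v4n r by simp
  have "2 dvd p ^ e" unfolding e[symmetric] v4n by simp
  then have p2: "p = 2" using p by (metis prime_dvd_power primes_dvd_imp_eq two_is_prime_nat)
  have "2 ^ e = 4 * r\<^sup>2" using e v4n p2 by simp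
  then have "r dvd 2 ^ e" by (simp add: power2_eq_square)
  then obtain j where j: "r = 2 ^ j" using divides_primepow_nat[OF two_is_prime_nat] by blast
  have sj: "s = 2 ^ j" using r j by simp
  \<comment> \<open>\<open>v = 2 ^ (2 * j + 2)\<close>, and half of it is the exponent at which a
    primitive \<open>v\<close>-th root of unity becomes -1.\<close>
  define c where "c = 2 * j + 1"
  have vc: "v = 2 * 2 ^ c" unfolding v4n j c_def by (simp add: power_even_eq)
  interpret two_power_root_of_unity "cis (2 * pi / real v)" c
  proof
    have "cis (2 * pi / real v) ^ (2 ^ c) = cis (2 ^ c * (2 * pi / real v))" by (simp add: DeMoivre)
    also have "2 ^ c * (2 * pi / real v) = pi" unfolding vc by simp
    finally show "cis (2 * pi / real v) ^ (2 ^ c) = -1" by simp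
    show "c > 0" by (simp add: c_def)
  qed
  obtain X where X: "X \<in> chars" "char_sum X D = a" using value_attained by blast
  have Re0: "Re a = 0"
  proof (rule Re_zero_if_rational[OF _ _ rat])
    show "a \<in> int_adjoin (cis (2 * pi / real v))" using char_sum_in_int_adjoin[OF X(1)] X(2) by simp
    have "a * cnj a = of_real (s\<^sup>2)" unfolding norm_a s_sq by simp
    also have "s\<^sup>2 = 4 ^ j" unfolding sj power_mult[symmetric] mult.commute[of j] unfolding power_mult by simp
    finally show "a * cnj a = 4 ^ j" by simp
    show "\<bar>Re a\<bar> < 2 ^ j" using Re_a_less sj by simp
  qed
  \<comment> \<open>With \<open>v = 4s^2\<close> the identity \<open>k_sq\<close> is quadratic in
    \<open>k\<close>, and its roots are the two Hadamard values; \<open>hadamard_case\<close>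
    selects the sign.\<close>
  have "hadamard_difference_set G D v k l"
  proof -
    have "(real k - 2 * s\<^sup>2 - s) * (real k - 2 * s\<^sup>2 + s) = 0"
    proof -
      have "real l = real k - s\<^sup>2" using s_sq by simp
      then have "(real k)\<^sup>2 = s\<^sup>2 + (real k - s\<^sup>2) * (4 * s\<^sup>2)" using k_sq vs by simp
      then show ?thesis by (simp add: power2_eq_square algebra_simps)
    qed
    then have "real k = 2 * s\<^sup>2 + s \<and> real l = s\<^sup>2 + s \<or> real k = 2 * s\<^sup>2 - s \<and> real l = s\<^sup>2 - s"
      using s_sq by auto
    then show ?thesis
      unfolding hadamard_difference_set_def Let_def s_def[symmetric] using D vs s_sq by simp
  qed
  then show ?thesis using hadamard_case Re0 by blast
qed

end

theorem theorem1:
  fixes G :: "('a, 'b) monoid_scheme"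
    and D :: "'a set"
    and v k l :: nat
    and n :: int
    and a :: complex
    and M :: "('a \<Rightarrow> complex) set"
  assumes "comm_group G"
    and "finite (carrier G)"
    and "difference_set G D v k l"
    and "l > 0"
    and "n = int k - int l"
    and "(\<lambda>X. char_sum X D) ` (carrier (char_group G) - {\<one>\<^bsub>char_group G\<^esub>})
           = {complex_of_real (sqrt (real_of_int n)), a, cnj a}"
    and "distinct [complex_of_real (sqrt (real_of_int n)), a, cnj a]"
    and "M = {\<one>\<^bsub>char_group G\<^esub>} \<union>
           {X \<in> carrier (char_group G). char_sum X D = complex_of_real (sqrt (real_of_int n))}"
    and "(hadamard_difference_set G D v k l \<and> a + cnj a = 0)
         \<or> (\<exists>p. finite_p_group p G)
         \<or> subgroup M (char_group G)"
  shows "(\<exists>m::nat.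
            real v = 2 powi (2 * int m) \<and>
            real k = 2 powi (2 * int m - 1) + 2 powi (int m - 1) \<and>
            real l = 2 powi (2 * int m - 2) + 2 powi (int m - 1))
         \<and> finite_p_group 2 G
         \<and> (\<exists>H. subgroup H G
              \<and> (\<lambda>g. ring_elem D g + ring_elem (set_inv\<^bsub>G\<^esub> D) g - ring_elem (carrier G) g)
                  = ring_elem H
              \<and> char_perp G H = M)"
proof -
  define s where "s = sqrt (real_of_int n)"
  interpret G: comm_group G by fact
  interpret T: three_valued_difference_set G D v k l a s
    using assms by unfold_locales (simp_all add: s_def)
  have M: "M = T.M" unfolding T.M_def unfolding s_def by (rule assms(8))
  have "Re a = 0" if "a + cnj a = 0" using that by (simp add: complex_eq_iff)
  then have "real v = 4 * s\<^sup>2 \<and> real k = 2 * s\<^sup>2 + s \<and> Re a = 0"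
    using assms(9) T.hadamard_case T.p_group_case T.subgroup_case unfolding M by blast
  then show ?thesis unfolding M using T.hadamard_plus by blast
qed

end
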